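(* Assume that $V$ satisfies conditions A1 and A2 given in the context. Then for all $\delta\ge0$, $x\ge0$ and $\lambda\in(0,1)$ $$\lim_{T\to\infty}\left|\mathcal{B}_Z^\delta(x)-\frac{\mathcal{B}_Z^\delta([0,T]^d\cap\delta\mathbb{Z}^d,x)}{T^d}\right|T^\lambda=0 .$$
   Context: Let $d\ge1$ and let $V(t),t\in\mathbb{R}^d$, be a centered Gaussian random field with almost surely continuous trajectories and stationary increments, with variance function $\sigma_V^2(t)=\mathrm{Var}(V(t))$, $\sigma_V(0)=0$. Put $Z(t)=\exp\left(V(t)-\sigma_V^2(t)/2\right)$, $t\in\mathbb{R}^d$. Conditions ($\|\cdot\|$ is the Euclidean norm): A1: $\sigma_V^2$ is continuous and strictly increasing (as a function on $[0,\infty)^d$, i.e. $\sigma_V^2(s)<\sigma_V^2(t)$ whenever $s\le t$ componentwise and $s\neq t$), and there exist $\alpha_0\in(0,2]$ and $A_0\in(0,\infty)$ such that $\limsup_{\|t\|\to0}\sigma_V^2(t)/\|t\|^{\alpha_0}\le A_0$. A2: there exists $\alpha_\infty\in(0,2]$ such that $\liminf_{\|t\|\to\infty}\sigma_V^2(t)/\|t\|^{\alpha_\infty}>0$. Let $\lambda_0$ be Lebesgue measure on $\mathbb{R}^d$ and $0\mathbb{Z}^d:=\mathbb{R}^d$; for $\delta>0$ let $\lambda_\delta$ be $\delta^d$ times the counting measure on $\delta\mathbb{Z}^d$. For $\delta,x\ge0$ and $T>0$ $$\mathcal{B}_Z^\delta([0,T]^d\cap\delta\mathbb{Z}^d,x)=\int_0^\infty\mathbb{P}\left\{\int_{[0,T]^d\cap\delta\mathbb{Z}^d}\mathbb{I}(Z(t)>s)\,\lambda_\delta(dt)>x\right\}ds,$$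 $$\mathcal{B}_Z^\delta(x)=\lim_{T\to\infty}T^{-d}\,\mathcal{B}_Z^\delta([0,T]^d\cap\delta\mathbb{Z}^d,x),$$ where $\mathbb{I}$ denotes an indicator; the last limit exists and is finite. *)

theory Defs
  imports "HOL-Probability.Probability"
begin

definition gaussian_rv :: "'a measure \<Rightarrow> ('a \<Rightarrow> real) \<Rightarrow> bool" where
  \<comment> \<open>the second disjunct is the degenerate normal law with variance 0\<close>
  "gaussian_rv M X \<longleftrightarrow> X \<in> borel_measurable M \<and>
     (\<exists>\<mu> \<sigma>. 0 < \<sigma> \<and> distributed M lborel X (\<lambda>x. ennreal (normal_density \<mu> \<sigma> x)) \<or>
            (AE \<omega> in M. X \<omega> = \<mu>))"

definition centered_gaussian_field :: "'a measure \<Rightarrow> ('t \<Rightarrow> 'a \<Rightarrow> real) \<Rightarrow> bool" where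
  "centered_gaussian_field M V \<longleftrightarrow>
     (\<forall>J c. finite J \<longrightarrow> gaussian_rv M (\<lambda>\<omega>. \<Sum>t\<in>J. c t * V t \<omega>)) \<and>
     (\<forall>t. prob_space.expectation M (V t) = 0)"

text \<open>The finite-dimensional distributions of \<open>t \<mapsto> V (t + h) - V h\<close> do not depend on \<open>h\<close>.\<close>

definition stationary_increments ::
    "'a measure \<Rightarrow> ('t::ab_group_add \<Rightarrow> 'a \<Rightarrow> real) \<Rightarrow> bool" where
  "stationary_increments M V \<longleftrightarrow>
     (\<forall>h J. finite J \<longrightarrow>
        distr M (Pi\<^sub>M J (\<lambda>_. borel)) (\<lambda>\<omega>. \<lambda>t\<in>J. V (t + h) \<omega> - V h \<omega>) =
        distr M (Pi\<^sub>M J (\<lambda>_. borel)) (\<lambda>\<omega>. \<lambda>t\<in>J. V t \<omega> - V 0 \<omega>))"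

definition var_fn :: "'a measure \<Rightarrow> ('t \<Rightarrow> 'a \<Rightarrow> real) \<Rightarrow> 't \<Rightarrow> real" where
  "var_fn M V t = prob_space.variance M (V t)"

definition Z_field :: "'a measure \<Rightarrow> ('t \<Rightarrow> 'a \<Rightarrow> real) \<Rightarrow> 't \<Rightarrow> 'a \<Rightarrow> real" where
  "Z_field M V t \<omega> = exp (V t \<omega> - var_fn M V t / 2)"

text \<open>The order on \<^typ>\<open>real ^ 'n\<close> is componentwise, so \<open>s < t\<close> means
  \<open>s \<le> t\<close> componentwise and \<open>s \<noteq> t\<close>.\<close>

definition cond_A1 :: "(real ^ 'n \<Rightarrow> real) \<Rightarrow> bool" where
  "cond_A1 v \<longleftrightarrow>
     continuous_on UNIV v \<and> strict_mono_on {t. 0 \<le> t} v \<and>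
     (\<exists>\<alpha>\<^sub>0 A\<^sub>0. 0 < \<alpha>\<^sub>0 \<and> \<alpha>\<^sub>0 \<le> 2 \<and> 0 < A\<^sub>0 \<and>
        Limsup (at 0) (\<lambda>t. ereal (v t / norm t powr \<alpha>\<^sub>0)) \<le> ereal A\<^sub>0)"

definition cond_A2 :: "(real ^ 'n \<Rightarrow> real) \<Rightarrow> bool" where
  "cond_A2 v \<longleftrightarrow>
     (\<exists>\<alpha>. 0 < \<alpha> \<and> \<alpha> \<le> 2 \<and>
        0 < Liminf at_infinity (\<lambda>t. ereal (v t / norm t powr \<alpha>)))"

definition grid :: "real \<Rightarrow> (real ^ 'n) set" where
  "grid \<delta> = (if \<delta> = 0 then UNIV else {t. \<forall>i. \<exists>k::int. t $ i = \<delta> * of_int k})"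

definition grid_measure :: "real \<Rightarrow> (real ^ 'n) measure" where
  "grid_measure \<delta> =
     (if \<delta> = 0 then lborel
      else scale_measure (ennreal (\<delta> ^ CARD('n))) (count_space (grid \<delta>)))"

definition cube :: "real \<Rightarrow> (real ^ 'n) set" where
  "cube T = {t. \<forall>i. 0 \<le> t $ i \<and> t $ i \<le> T}"

text \<open>Since paths are only almost surely continuous, for \<open>\<delta> = 0\<close> the event below need only be
  measurable up to a null set; hence the completion. Values are taken in \<^typ>\<open>ennreal\<close>, so that
  an infinite integral is not identified with a real number.\<close>

definition berman_set ::
    "'a measure \<Rightarrow> (real ^ 'n \<Rightarrow> 'a \<Rightarrow> real) \<Rightarrow> real \<Rightarrow> (real ^ 'n) set \<Rightarrow> real \<Rightarrow> ennreal" where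
  "berman_set M Z \<delta> E x =
     (\<integral>\<^sup>+ s \<in> {0..}.
        emeasure (completion M)
          {\<omega> \<in> space M. (\<integral>\<^sup>+ t \<in> E. indicator {s<..} (Z t \<omega>) \<partial>grid_measure \<delta>) > ennreal x}
      \<partial>lborel)"

definition berman ::
    "'a measure \<Rightarrow> (real ^ 'n \<Rightarrow> 'a \<Rightarrow> real) \<Rightarrow> real \<Rightarrow> real \<Rightarrow> ennreal" where
  "berman M Z \<delta> x =
     Lim at_top (\<lambda>T. berman_set M Z \<delta> (cube T \<inter> grid \<delta>) x / ennreal (T ^ CARD('n)))"

end

theory Submission
  imports Defs "HOL-Real_Asymp.Real_Asymp"
begin

text \<open>Put \<open>y(t) = V(t) - \<sigma>\<^sup>2(t)/2\<close>, so that \<open>Z = exp y\<close>. For fixed \<open>x\<close>, the Berman functional of a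
set \<open>E\<close> is the mean of the level functional \<open>Q(E)\<close>, the Lebesgue measure of the set of all
\<open>s \<ge> 0\<close> such that \<open>Z > s\<close> on a part of \<open>E\<close> of measure more than \<open>x\<close>. Three properties of \<open>Q\<close> carry
the proof: it is homogeneous in \<open>Z\<close>, it is monotone in \<open>E\<close>, and enlarging \<open>E\<close> by \<open>F\<close> raises it by at
most the supremum of \<open>Z\<close> over \<open>F\<close>, since \<open>F\<close> does not count above that level.

Cut \<open>E\<close> into congruent cells \<open>k + C\<close>, with \<open>k\<close> in a finite set \<open>K\<close> of lattice points: single points
for the discrete grid, half-open unit cubes for the continuum. Let \<open>S\<^sub>k\<close> be the supremum of \<open>Z\<close> over
cell \<open>k\<close>, and distribute \<open>Q(K)\<close> among the cells in proportion to \<open>S\<^sub>k\<close>: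
\<open>Q(K) = \<Sum>h\<in>K. S\<^sub>h Q(K) / (\<Sum>k\<in>K. S\<^sub>k)\<close>. The quotient \<open>Q(K) / \<Sum>S\<^sub>k\<close> lies between 0 and 1 and does
not change when \<open>Z\<close> is multiplied by a factor. Under the change of measure with density
\<open>Z(h)\<close> the path \<open>y(h + \<cdot>) - y(h)\<close> has the law that \<open>y\<close> has under the original measure
(\<open>tilt_law\<close>). So the share of cell \<open>h\<close> has mean \<open>G(K - h)\<close>, where
\<open>G(K) = E[S\<^sub>0 Q(K) / \<Sum>S\<^sub>k]\<close>, and \<open>E Q(K) = \<Sum>h\<in>K. G(K - h)\<close> (\<open>mean_level_eq_sum\<close>).

The function \<open>G\<close> is bounded by \<open>E S\<^sub>0\<close>, and adding a cell \<open>k\<close> to \<open>K\<close> changes it by at most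
\<open>E min(S\<^sub>0, S\<^sub>k)\<close> (\<open>cell_share_compare\<close>). This overlap is at most a constant times
\<open>exp(-\<sigma>\<^sup>2(k)/32)\<close> (\<open>overlap_le\<close>): far from the origin \<open>Z\<close> is typically of size
\<open>exp(-\<sigma>\<^sup>2/2)\<close>, and the Hoelder bound on the variance near 0 controls, by \<open>chaining\<close>, the
fluctuations inside a cell. As \<open>\<sigma>\<^sup>2\<close> grows at least like a power of the norm, the overlap decays
faster than every power. Hence \<open>G(K - h)\<close> is within \<open>O(w^(-m))\<close> of a constant \<open>G\<close> for all
\<open>h\<close> at distance at least \<open>w\<close> from the boundary of the box \<open>K = {0..<n}^d\<close>, and the remaining
\<open>O(w n^(d-1))\<close> cells contribute a bounded amount each. With \<open>w = n^\<epsilon>\<close> and large \<open>m\<close> this gives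
\<open>E Q(K) / n^d = G + O(n^(\<epsilon>-1))\<close> (\<open>box_average_rate\<close>). Cubes with real side lie between two boxes,
by monotonicity, which costs another \<open>O(1/n)\<close>; then \<open>\<epsilon> = (1 - \<lambda>)/2\<close> proves the theorem.\<close>

section \<open>Centred Gaussian variables\<close>

abbreviation centered_normal_law :: "real \<Rightarrow> real measure" where
  "centered_normal_law s \<equiv> distr std_normal_distribution borel (\<lambda>x. s * x)"

text \<open>Writing the law as the image of the standard normal law under \<open>x \<mapsto> s x\<close> treats the degenerate case
together with the others: it is \<open>s = 0\<close>.\<close>

lemma centered_gaussian_law:
  assumes "prob_space M" "gaussian_rv M X" "prob_space.expectation M X = 0"
  obtains s where "distr M borel X = centered_normal_law s"
proof -
  interpret prob_space M by fact
  from assms(2) obtain \<mu> \<sigma> where X[measurable]: "X \<in> borel_measurable M"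
    and *: "0 < \<sigma> \<and> distributed M lborel X (\<lambda>x. ennreal (normal_density \<mu> \<sigma> x)) \<or> (AE \<omega> in M. X \<omega> = \<mu>)"
    unfolding gaussian_rv_def by auto
  from * show ?thesis
  proof
    assume a: "0 < \<sigma> \<and> distributed M lborel X (\<lambda>x. ennreal (normal_density \<mu> \<sigma> x))"
    then have "\<mu> = 0" using normal_distributed_expectation[of \<sigma> X \<mu>] assms(3) by auto
    with a have d: "distributed M lborel (\<lambda>x. X x / \<sigma>) (\<lambda>x. ennreal (std_normal_density x))"
      using normal_standard_normal_convert[of \<sigma> X 0] by simp
    have "distr M borel X = distr (distr M lborel (\<lambda>x. X x / \<sigma>)) borel (\<lambda>x. \<sigma> * x)"
      using a by (subst distr_distr) (auto simp: comp_def)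
    then show ?thesis using that[of \<sigma>] distributed_distr_eq_density[OF d] by simp
  next
    assume a: "AE \<omega> in M. X \<omega> = \<mu>"
    have "expectation X = expectation (\<lambda>_. \<mu>)" by (rule integral_cong_AE) (use a in auto)
    then have "\<mu> = 0" using assms(3) by (simp add: prob_space)
    interpret N: prob_space std_normal_distribution by (rule prob_space_normal_density) simp
    have "distr M borel X = distr M borel (\<lambda>_. 0)"
      by (rule distr_cong_AE) (use a \<open>\<mu> = 0\<close> in auto)
    also have "\<dots> = return borel 0" by (rule distr_const) simp
    also have "\<dots> = distr std_normal_distribution borel (\<lambda>x. 0 * x)"
      using N.distr_const[of 0 borel] by simp
    finally show ?thesis using that[of 0] by simp
  qed
qed

lemma centered_gaussian_moments:
  assumes "prob_space M" and X: "gaussian_rv M X" "prob_space.expectation M X = 0"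
  shows "integrable M (\<lambda>\<omega>. (X \<omega>)\<^sup>2)"
    and "(CLINT \<omega>|M. iexp (X \<omega>)) = exp (- (prob_space.expectation M (\<lambda>\<omega>. (X \<omega>)\<^sup>2)) / 2)"
    and "(\<integral>\<^sup>+\<omega>. ennreal (exp (X \<omega>)) \<partial>M) = ennreal (exp (prob_space.expectation M (\<lambda>\<omega>. (X \<omega>)\<^sup>2) / 2))"
    and "\<exists>s. distr M borel X = centered_normal_law s \<and> prob_space.expectation M (\<lambda>\<omega>. (X \<omega>)\<^sup>2) = s\<^sup>2"
proof -
  interpret prob_space M by fact
  have [measurable]: "X \<in> borel_measurable M" using X by (simp add: gaussian_rv_def)
  obtain s where s: "distr M borel X = centered_normal_law s"
    using centered_gaussian_law[OF assms] .
  have sq: "has_bochner_integral std_normal_distribution (\<lambda>x. (s * x)\<^sup>2) (s\<^sup>2)"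
    using has_bochner_integral_mult_right[OF std_normal_moment_even[of 1], of "s\<^sup>2"]
    by (subst has_bochner_integral_density) (auto simp: power2_eq_square fact_numeral ac_simps)
  have "has_bochner_integral (distr M borel X) (\<lambda>x. x\<^sup>2) (s\<^sup>2)"
    unfolding s by (rule has_bochner_integral_distr) (use sq in auto)
  then have X2: "has_bochner_integral M (\<lambda>\<omega>. (X \<omega>)\<^sup>2) (s\<^sup>2)"
    by (simp add: has_bochner_integral_iff integrable_distr_eq integral_distr)
  then show "integrable M (\<lambda>\<omega>. (X \<omega>)\<^sup>2)" by (rule integrable.intros)
  have e: "expectation (\<lambda>\<omega>. (X \<omega>)\<^sup>2) = s\<^sup>2" using X2 by (rule has_bochner_integral_integral_eq)
  show "\<exists>s. distr M borel X = centered_normal_law s \<and> expectation (\<lambda>\<omega>. (X \<omega>)\<^sup>2) = s\<^sup>2"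
    using s e by blast
  have "(CLINT \<omega>|M. iexp (X \<omega>)) = (CLINT x|distr M borel X. iexp x)"
    by (subst integral_distr) auto
  also have "\<dots> = char std_normal_distribution s"
    unfolding s char_def by (subst integral_distr) auto
  finally show "(CLINT \<omega>|M. iexp (X \<omega>)) = exp (- (expectation (\<lambda>\<omega>. (X \<omega>)\<^sup>2)) / 2)"
    by (simp add: e char_std_normal_distribution exp_of_real)
  have "(\<integral>\<^sup>+\<omega>. ennreal (exp (X \<omega>)) \<partial>M) = (\<integral>\<^sup>+x. ennreal (exp x) \<partial>distr M borel X)"
    by (subst nn_integral_distr) auto
  also have "\<dots> = (\<integral>\<^sup>+x. ennreal (exp (s * x)) \<partial>std_normal_distribution)"
    unfolding s by (subst nn_integral_distr) auto
  \<comment> \<open>completing the square\<close>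
  also have "\<dots> = (\<integral>\<^sup>+x. ennreal (exp (s\<^sup>2 / 2)) * ennreal (normal_density s 1 x) \<partial>lborel)"
    by (subst nn_integral_density) (auto intro!: nn_integral_cong
      simp: normal_density_def ennreal_mult[symmetric] exp_add[symmetric] power2_eq_square field_simps)
  also have "\<dots> = ennreal (exp (s\<^sup>2 / 2)) * (\<integral>\<^sup>+x. ennreal (normal_density s 1 x) \<partial>lborel)"
    by (rule nn_integral_cmult) auto
  also have "(\<integral>\<^sup>+x. ennreal (normal_density s 1 x) \<partial>lborel) = 1"
    by (subst nn_integral_eq_integral) auto
  finally show "(\<integral>\<^sup>+\<omega>. ennreal (exp (X \<omega>)) \<partial>M) = ennreal (exp (expectation (\<lambda>\<omega>. (X \<omega>)\<^sup>2) / 2))"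
    by (simp add: e)
qed

section \<open>Joint laws and characteristic functions\<close>

text \<open>Dividing by the total mass, which is the characteristic function at 0, reduces this to Levy's
uniqueness theorem for probability measures.\<close>

lemma finite_measure_eqI_char:
  assumes "finite_measure M" "finite_measure N" "sets M = sets borel" "sets N = sets borel"
    and eq: "\<And>t. char M t = char N t"
  shows "M = N"
proof -
  interpret M: finite_measure M by fact
  interpret N: finite_measure N by fact
  have sp: "space M = UNIV" "space N = UNIV" using assms(3,4)[THEN sets_eq_imp_space_eq] by auto
  define m where "m = measure M UNIV"
  have mN: "measure N UNIV = m" using eq[of 0] by (simp add: char_def sp m_def)
  show ?thesis
  proof (cases "m = 0")
    case True
    have "emeasure M A = 0 \<and> emeasure N A = 0" for A
      using True mN M.bounded_measure[of A] N.bounded_measure[of A] unfolding m_def sp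
      by (simp add: M.emeasure_eq_measure N.emeasure_eq_measure measure_le_0_iff)
    then show ?thesis using assms by (intro measure_eqI) auto
  next
    case False
    then have m: "m > 0" by (simp add: m_def order_less_le)
    have rd: "real_distribution (scale_measure (ennreal (1/m)) K) \<and>
        char (scale_measure (ennreal (1/m)) K) t = char K t / m"
      if "finite_measure K" "sets K = sets borel" "measure K UNIV = m" for K t
    proof -
      interpret K: finite_measure K by fact
      have spK: "space K = UNIV" using that(2)[THEN sets_eq_imp_space_eq] by auto
      have "prob_space (scale_measure (ennreal (1/m)) K)"
        using that(3) m by (intro prob_spaceI)
          (simp add: spK space_scale_measure K.emeasure_eq_measure ennreal_mult[symmetric])
      moreover have "scale_measure (ennreal (1/m)) K = density K (\<lambda>_. ennreal (1/m))"
        by (rule measure_eqI) (auto simp: emeasure_density nn_integral_cmult)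
      ultimately show ?thesis
        using that m by (auto simp: char_def real_distribution_def real_distribution_axioms_def
            spK space_scale_measure integral_density scaleR_conv_of_real divide_inverse mult.commute measurable_cong_sets[OF that(2) refl] cong: measurable_cong_sets)
    qed
    have "scale_measure (ennreal (1/m)) M = scale_measure (ennreal (1/m)) N"
      using rd[of M] rd[of N] assms mN m_def by (intro Levy_uniqueness) (auto intro!: ext)
    then have "scale_measure (ennreal m) (scale_measure (ennreal (1/m)) M) =
               scale_measure (ennreal m) (scale_measure (ennreal (1/m)) N)" by simp
    then show ?thesis using m by (simp add: ennreal_mult[symmetric])
  qed
qed

text \<open>The weights \<open>1 + cos(X + \<theta>)\<close> are nonnegative, so they define measures, and they are rich enough to
recover every \<open>exp(itX)\<close>. Under such a weight, a characteristic function becomes a combination of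
three values of the joint characteristic function of \<open>S\<close> and \<open>X\<close>.\<close>

lemma (in finite_measure) weighted_iexp_integral:
  fixes X S :: "'a \<Rightarrow> real" and \<theta> :: real
  assumes [measurable]: "X \<in> borel_measurable M" "S \<in> borel_measurable M"
  defines "M' \<equiv> density M (\<lambda>\<omega>. ennreal (1 + cos (X \<omega> + \<theta>)))"
  shows "finite_measure M'"
    and "(CLINT \<omega>|M'. iexp (S \<omega>)) = (CLINT \<omega>|M. iexp (S \<omega>))
        + iexp \<theta> / 2 * (CLINT \<omega>|M. iexp (S \<omega> + X \<omega>)) + iexp (-\<theta>) / 2 * (CLINT \<omega>|M. iexp (S \<omega> - X \<omega>))"
proof -
  have w0: "0 \<le> 1 + cos u" for u :: real using cos_ge_minus_one[of u] by linarith
  have "emeasure M' (space M') = (\<integral>\<^sup>+\<omega>. ennreal (1 + cos (X \<omega> + \<theta>)) \<partial>M)"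
    unfolding M'_def by (simp add: emeasure_density cong: nn_integral_cong)
  also have "\<dots> \<le> (\<integral>\<^sup>+\<omega>. 2 \<partial>M)"
    by (intro nn_integral_mono) (use cos_le_one in \<open>simp flip: ennreal_numeral add: ennreal_le_iff\<close>)
  also have "\<dots> < \<infinity>" by (simp add: emeasure_eq_measure ennreal_mult_less_top)
  finally show "finite_measure M'" by (intro finite_measureI) auto
  have int: "integrable M (\<lambda>\<omega>. iexp (F \<omega>))" if "F \<in> borel_measurable M" for F :: "'a \<Rightarrow> real"
    using that by (intro integrable_const_bound[of _ 1]) auto
  have "(CLINT \<omega>|M'. iexp (S \<omega>)) = (CLINT \<omega>|M. (1 + cos (X \<omega> + \<theta>)) *\<^sub>R iexp (S \<omega>))"
    unfolding M'_def using w0 by (intro integral_density) auto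
  also have "\<dots> = (CLINT \<omega>|M. iexp (S \<omega>) + iexp \<theta> / 2 * iexp (S \<omega> + X \<omega>)
       + iexp (-\<theta>) / 2 * iexp (S \<omega> - X \<omega>))"
  proof (rule Bochner_Integration.integral_cong[OF refl])
    fix \<omega>
    have c: "complex_of_real (cos u) = (iexp u + iexp (-u)) / 2" for u
      by (simp add: complex_eq_iff Re_exp Im_exp)
    show "(1 + cos (X \<omega> + \<theta>)) *\<^sub>R iexp (S \<omega>) = iexp (S \<omega>) + iexp \<theta> / 2 * iexp (S \<omega> + X \<omega>)
       + iexp (-\<theta>) / 2 * iexp (S \<omega> - X \<omega>)"
      unfolding scaleR_conv_of_real of_real_add c of_real_1
      by (simp add: algebra_simps add_divide_distrib flip: exp_add)
  qed
  also have "\<dots> = (CLINT \<omega>|M. iexp (S \<omega>)) + iexp \<theta> / 2 * (CLINT \<omega>|M. iexp (S \<omega> + X \<omega>))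
       + iexp (-\<theta>) / 2 * (CLINT \<omega>|M. iexp (S \<omega> - X \<omega>))"
    using int[of S] int[of "\<lambda>\<omega>. S \<omega> + X \<omega>"] int[of "\<lambda>\<omega>. S \<omega> - X \<omega>"]
    by (subst Bochner_Integration.integral_add, simp_all)+
  finally show "(CLINT \<omega>|M'. iexp (S \<omega>)) = (CLINT \<omega>|M. iexp (S \<omega>))
        + iexp \<theta> / 2 * (CLINT \<omega>|M. iexp (S \<omega> + X \<omega>)) + iexp (-\<theta>) / 2 * (CLINT \<omega>|M. iexp (S \<omega> - X \<omega>))" .
qed

lemma (in finite_measure) measure_weighted:
  fixes X :: "'a \<Rightarrow> real" and \<theta> :: real
  assumes [measurable]: "X \<in> borel_measurable M" "R \<in> sets M"
  shows "measure (density M (\<lambda>\<omega>. ennreal (1 + cos (X \<omega> + \<theta>)))) R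
     = measure M R + (LINT \<omega>|M. indicator R \<omega> * cos (X \<omega> + \<theta>))"
proof -
  have w0: "0 \<le> 1 + cos u" for u :: real using cos_ge_minus_one[of u] by linarith
  have int: "integrable M (\<lambda>\<omega>. indicator R \<omega> * cos (X \<omega> + \<theta>))"
    by (intro integrable_const_bound[of _ 1]) (auto simp: indicator_def)
  have int2: "integrable M (indicator R :: 'a \<Rightarrow> real)"
    by (intro integrable_real_indicator) (auto simp: emeasure_eq_measure)
  have "measure (density M (\<lambda>\<omega>. ennreal (1 + cos (X \<omega> + \<theta>)))) R
     = enn2real (\<integral>\<^sup>+\<omega>. ennreal (indicator R \<omega> + indicator R \<omega> * cos (X \<omega> + \<theta>)) \<partial>M)"
    unfolding measure_def
    by (subst emeasure_density) (auto intro!: arg_cong[where f=enn2real] nn_integral_cong split: split_indicator)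
  also have "\<dots> = (LINT \<omega>|M. indicator R \<omega> + indicator R \<omega> * cos (X \<omega> + \<theta>))"
    using w0 by (subst integral_eq_nn_integral) (auto split: split_indicator)
  also have "\<dots> = measure M R + (LINT \<omega>|M. indicator R \<omega> * cos (X \<omega> + \<theta>))"
    by (subst Bochner_Integration.integral_add[OF int2 int]) simp
  finally show ?thesis .
qed

lemma (in finite_measure) char_restricted:
  fixes X :: "'a \<Rightarrow> real"
  assumes [measurable]: "X \<in> borel_measurable M" "R \<in> sets M"
  shows "char (distr (density M (indicator R)) borel X) t =
    Complex (LINT \<omega>|M. indicator R \<omega> * cos (t * X \<omega> + 0)) (LINT \<omega>|M. indicator R \<omega> * cos (t * X \<omega> + (- pi / 2)))"
proof -
  have "char (distr (density M (indicator R)) borel X) t = (CLINT \<omega>|density M (indicator R). iexp (t * X \<omega>))"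
    unfolding char_def by (subst integral_distr) auto
  also have "\<dots> = (CLINT \<omega>|M. indicator R \<omega> *\<^sub>R iexp (t * X \<omega>))"
    unfolding ennreal_indicator[symmetric] by (intro integral_density) auto
  finally have *: "char (distr (density M (indicator R)) borel X) t = (CLINT \<omega>|M. indicator R \<omega> *\<^sub>R iexp (t * X \<omega>))" .
  have int: "complex_integrable M (\<lambda>\<omega>. indicator R \<omega> *\<^sub>R iexp (t * X \<omega>))"
    by (intro integrable_const_bound[of _ 1]) (auto simp: indicator_def)
  have s: "cos (u - pi / 2) = sin u" for u :: real by (simp add: cos_diff)
  show ?thesis unfolding *
    using integral_Re[OF int] integral_Im[OF int] by (simp add: complex_eq_iff Re_exp Im_exp s)
qed

text \<open>Induction over the index set. The induction hypothesis, applied to the measures weighted by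
\<open>1 + cos(t X\<^sub>k + \<theta>)\<close>, shows that \<open>X\<^sub>k\<close> has the same characteristic function on the rectangle in the
other coordinates, and one-dimensional uniqueness then adds the coordinate \<open>k\<close>.\<close>

lemma char_determines_rectangles:
  fixes X :: "'i \<Rightarrow> 'a \<Rightarrow> real" and Y :: "'i \<Rightarrow> 'b \<Rightarrow> real"
  assumes "finite J" "finite_measure M" "finite_measure N"
    and "\<And>j. j \<in> J \<Longrightarrow> X j \<in> borel_measurable M" "\<And>j. j \<in> J \<Longrightarrow> Y j \<in> borel_measurable N"
    and "\<And>c. (CLINT \<omega>|M. iexp (\<Sum>j\<in>J. c j * X j \<omega>)) = (CLINT \<omega>|N. iexp (\<Sum>j\<in>J. c j * Y j \<omega>))"
    and "\<And>j. j \<in> J \<Longrightarrow> A j \<in> sets borel"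
  shows "measure M {\<omega>\<in>space M. \<forall>j\<in>J. X j \<omega> \<in> A j} = measure N {\<omega>\<in>space N. \<forall>j\<in>J. Y j \<omega> \<in> A j}"
  using assms
proof (induction J arbitrary: M N rule: finite_induct)
  case empty
  then show ?case by (simp del: of_real_eq_iff add: of_real_eq_iff[symmetric, where 'a=complex])
next
  case (insert k J)
  interpret M: finite_measure M by fact
  interpret N: finite_measure N by fact
  have [measurable]: "X j \<in> borel_measurable M" "Y j \<in> borel_measurable N" "A j \<in> sets borel"
    if "j \<in> insert k J" for j using insert.prems that by auto
  have [measurable]: "X k \<in> borel_measurable M" "Y k \<in> borel_measurable N" "A k \<in> sets borel" by auto
  define R where "R = {\<omega>\<in>space M. \<forall>j\<in>J. X j \<omega> \<in> A j}"
  define R' where "R' = {\<omega>\<in>space N. \<forall>j\<in>J. Y j \<omega> \<in> A j}"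
  have [measurable]: "R \<in> sets M" "R' \<in> sets N"
    unfolding R_def R'_def using \<open>finite J\<close> by (auto intro!: sets.sets_Collect_finite_All' measurable_sets_Collect[OF _ _] simp: pred_def[symmetric])
  have cc: "(CLINT \<omega>|M. iexp ((\<Sum>j\<in>J. c j * X j \<omega>) + t * X k \<omega>)) =
      (CLINT \<omega>|N. iexp ((\<Sum>j\<in>J. c j * Y j \<omega>) + t * Y k \<omega>))" for c t
  proof -
    have "(\<Sum>j\<in>insert k J. (c(k:=t)) j * Z j) = (\<Sum>j\<in>J. c j * Z j) + t * Z k" for Z :: "'i \<Rightarrow> real"
    proof -
      have "(\<Sum>j\<in>J. (c(k:=t)) j * Z j) = (\<Sum>j\<in>J. c j * Z j)"
        by (rule sum.cong) (use insert.hyps in auto)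
      then show ?thesis using insert.hyps by simp
    qed
    then show ?thesis using insert.prems(5)[of "c(k:=t)"] by simp
  qed
  have eq0: "(CLINT \<omega>|M. iexp (\<Sum>j\<in>J. c j * X j \<omega>)) = (CLINT \<omega>|N. iexp (\<Sum>j\<in>J. c j * Y j \<omega>))" for c
    using cc[of c 0] by simp
  have base: "measure M R = measure N R'"
    unfolding R_def R'_def by (rule insert.IH) (use eq0 insert.prems in auto)
  have cosint: "(LINT \<omega>|M. indicator R \<omega> * cos (t * X k \<omega> + \<theta>)) = (LINT \<omega>|N. indicator R' \<omega> * cos (t * Y k \<omega> + \<theta>))" for t \<theta>
  proof -
    let ?M = "density M (\<lambda>\<omega>. ennreal (1 + cos (t * X k \<omega> + \<theta>)))"
    let ?N = "density N (\<lambda>\<omega>. ennreal (1 + cos (t * Y k \<omega> + \<theta>)))"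
    have m: "(\<lambda>\<omega>. \<Sum>j\<in>J. c j * X j \<omega>) \<in> borel_measurable M" "(\<lambda>\<omega>. \<Sum>j\<in>J. c j * Y j \<omega>) \<in> borel_measurable N" for c
      by (auto intro!: borel_measurable_sum)
    have tX: "(\<lambda>\<omega>. t * X k \<omega>) \<in> borel_measurable M" "(\<lambda>\<omega>. t * Y k \<omega>) \<in> borel_measurable N" by auto
    have "measure ?M {\<omega>\<in>space ?M. \<forall>j\<in>J. X j \<omega> \<in> A j} = measure ?N {\<omega>\<in>space ?N. \<forall>j\<in>J. Y j \<omega> \<in> A j}"
    proof (rule insert.IH)
      fix c
      show "(CLINT \<omega>|?M. iexp (\<Sum>j\<in>J. c j * X j \<omega>)) = (CLINT \<omega>|?N. iexp (\<Sum>j\<in>J. c j * Y j \<omega>))"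
        using cc[of c t] cc[of c "-t"] eq0[of c]
        unfolding M.weighted_iexp_integral(2)[OF tX(1) m(1)] N.weighted_iexp_integral(2)[OF tX(2) m(2)] by simp
    qed (use insert.prems M.weighted_iexp_integral(1)[OF tX(1) tX(1)] N.weighted_iexp_integral(1)[OF tX(2) tX(2)] in auto)
    then have "measure ?M R = measure ?N R'" by (simp add: R_def R'_def)
    then show ?thesis using base by (simp add: M.measure_weighted N.measure_weighted)
  qed
  have "distr (density M (indicator R)) borel (X k) = distr (density N (indicator R')) borel (Y k)"
  proof (rule finite_measure_eqI_char)
    have "finite_measure (density M (indicator R))"
      by (intro finite_measureI) (simp add: emeasure_density M.emeasure_eq_measure)
    then show "finite_measure (distr (density M (indicator R)) borel (X k))"
      by (rule finite_measure.finite_measure_distr) simp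
    have "finite_measure (density N (indicator R'))"
      by (intro finite_measureI) (simp add: emeasure_density N.emeasure_eq_measure)
    then show "finite_measure (distr (density N (indicator R')) borel (Y k))"
      by (rule finite_measure.finite_measure_distr) simp
    fix t
    show "char (distr (density M (indicator R)) borel (X k)) t = char (distr (density N (indicator R')) borel (Y k)) t"
      using cosint[of t 0] cosint[of t "- pi / 2"] by (simp add: M.char_restricted N.char_restricted)
  qed simp_all
  then have "emeasure (distr (density M (indicator R)) borel (X k)) (A k) =
      emeasure (distr (density N (indicator R')) borel (Y k)) (A k)" by simp
  then have "emeasure M (R \<inter> (X k -` A k \<inter> space M)) = emeasure N (R' \<inter> (Y k -` A k \<inter> space N))"
    by (simp add: emeasure_distr emeasure_density nn_integral_indicator flip: indicator_inter_arith)
  moreover have "R \<inter> (X k -` A k \<inter> space M) = {\<omega>\<in>space M. \<forall>j\<in>insert k J. X j \<omega> \<in> A j}"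
    "R' \<inter> (Y k -` A k \<inter> space N) = {\<omega>\<in>space N. \<forall>j\<in>insert k J. Y j \<omega> \<in> A j}"
    by (auto simp: R_def R'_def)
  ultimately show ?case by (simp add: measure_def)
qed

section \<open>Gaussian fields and the exponential change of measure\<close>

locale gaussian_field = prob_space M for M :: "'a measure" +
  fixes V :: "'t :: ab_group_add \<Rightarrow> 'a \<Rightarrow> real"
  assumes gaussian: "centered_gaussian_field M V"
    and stationary: "stationary_increments M V"
    and var_0: "var_fn M V 0 = 0"
begin

text \<open>The closure under linear combinations makes any two elements jointly Gaussian, not only each of them Gaussian.\<close>

definition gspan :: "('a \<Rightarrow> real) set" where
  "gspan = {X. \<exists>J c. finite J \<and> X = (\<lambda>\<omega>. \<Sum>t\<in>J. c t * V t \<omega>)}"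

abbreviation E2 :: "('a \<Rightarrow> real) \<Rightarrow> real" where "E2 X \<equiv> expectation (\<lambda>\<omega>. (X \<omega>)\<^sup>2)"

lemma gspan_V: "V t \<in> gspan"
  unfolding gspan_def by (rule CollectI, rule exI[of _ "{t}"], rule exI[of _ "\<lambda>_. 1"]) auto

lemma gspan_scale: "X \<in> gspan \<Longrightarrow> (\<lambda>\<omega>. a * X \<omega>) \<in> gspan"
proof -
  assume "X \<in> gspan"
  then obtain J c where "finite J" "X = (\<lambda>\<omega>. \<Sum>t\<in>J. c t * V t \<omega>)" unfolding gspan_def by auto
  then show ?thesis unfolding gspan_def
    by (intro CollectI exI[of _ J] exI[of _ "\<lambda>t. a * c t"]) (auto simp: sum_distrib_left mult.assoc)
qed

lemma gspan_add:
  assumes "X \<in> gspan" "Y \<in> gspan" shows "(\<lambda>\<omega>. X \<omega> + Y \<omega>) \<in> gspan"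
proof -
  obtain J c where X: "finite J" "X = (\<lambda>\<omega>. \<Sum>t\<in>J. c t * V t \<omega>)" using assms unfolding gspan_def by auto
  obtain I d where Y: "finite I" "Y = (\<lambda>\<omega>. \<Sum>t\<in>I. d t * V t \<omega>)" using assms unfolding gspan_def by auto
  have a: "(\<Sum>t\<in>J. c t * V t \<omega>) = (\<Sum>t\<in>J \<union> I. (if t \<in> J then c t else 0) * V t \<omega>)" for \<omega>
    by (rule sum.mono_neutral_cong_left) (use X Y in auto)
  have b: "(\<Sum>t\<in>I. d t * V t \<omega>) = (\<Sum>t\<in>J \<union> I. (if t \<in> I then d t else 0) * V t \<omega>)" for \<omega>
    by (rule sum.mono_neutral_cong_left) (use X Y in auto)
  show ?thesis unfolding gspan_def X(2) Y(2) a b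
    by (intro CollectI exI[of _ "J \<union> I"] exI[of _ "\<lambda>t. (if t \<in> J then c t else 0) + (if t \<in> I then d t else 0)"])
      (use X Y in \<open>auto simp: distrib_right sum.distrib\<close>)
qed

lemma gspan_diff: "X \<in> gspan \<Longrightarrow> Y \<in> gspan \<Longrightarrow> (\<lambda>\<omega>. X \<omega> - Y \<omega>) \<in> gspan"
  using gspan_add[of X "\<lambda>\<omega>. -1 * Y \<omega>"] gspan_scale[of Y "-1"] by simp

lemma gspan_sum:
  assumes "finite I" "\<And>i. i \<in> I \<Longrightarrow> X i \<in> gspan"
  shows "(\<lambda>\<omega>. \<Sum>i\<in>I. c i * X i \<omega>) \<in> gspan"
  using assms
proof (induction I rule: finite_induct)
  case empty
  then show ?case using gspan_scale[OF gspan_V, of 0] by simp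
next
  case (insert i I)
  then show ?case using gspan_add[OF gspan_scale[of "X i" "c i"], of "\<lambda>\<omega>. \<Sum>i\<in>I. c i * X i \<omega>"] by simp
qed

lemma gspan_gaussian: "X \<in> gspan \<Longrightarrow> gaussian_rv M X"
  using gaussian unfolding centered_gaussian_field_def gspan_def by blast

lemma expectation_V: "expectation (V t) = 0"
  using gaussian unfolding centered_gaussian_field_def by blast

lemma integrable_V: "integrable M (V t)"
proof (rule square_integrable_imp_integrable)
  have g: "gaussian_rv M (V t)" by (rule gspan_gaussian[OF gspan_V])
  then show "V t \<in> borel_measurable M" by (simp add: gaussian_rv_def)
  show "integrable M (\<lambda>x. (V t x)\<^sup>2)"
    by (rule centered_gaussian_moments(1)[OF prob_space_axioms g expectation_V])
qed

lemma gspan_expectation: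
  assumes "X \<in> gspan" shows "expectation X = 0"
proof -
  obtain J c where J: "finite J" and X: "X = (\<lambda>\<omega>. \<Sum>t\<in>J. c t * V t \<omega>)" using assms unfolding gspan_def by auto
  show ?thesis unfolding X using integrable_V expectation_V
    by (subst Bochner_Integration.integral_sum) auto
qed

lemmas gspan_rv = gspan_gaussian gspan_expectation

lemma gspan_measurable: "X \<in> gspan \<Longrightarrow> X \<in> borel_measurable M"
  using gspan_rv(1) by (simp add: gaussian_rv_def)

lemma gspan_moments:
  assumes "X \<in> gspan"
  shows "integrable M (\<lambda>\<omega>. (X \<omega>)\<^sup>2)"
    and "(CLINT \<omega>|M. iexp (X \<omega>)) = exp (- E2 X / 2)"
    and "(\<integral>\<^sup>+\<omega>. ennreal (exp (X \<omega>)) \<partial>M) = ennreal (exp (E2 X / 2))"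
    and "\<exists>s. distr M borel X = centered_normal_law s \<and> E2 X = s\<^sup>2"
  using centered_gaussian_moments[OF prob_space_axioms gspan_rv(1)[OF assms] gspan_rv(2)[OF assms]] by auto

lemma measurable_V[measurable]: "V t \<in> borel_measurable M"
  by (rule gspan_measurable[OF gspan_V])

lemma gspan_integrable_mult:
  assumes X: "X \<in> gspan" and Y: "Y \<in> gspan" shows "integrable M (\<lambda>\<omega>. X \<omega> * Y \<omega>)"
proof -
  have "(\<lambda>\<omega>. X \<omega> * Y \<omega>) = (\<lambda>\<omega>. ((X \<omega> + Y \<omega>)\<^sup>2 - (X \<omega>)\<^sup>2 - (Y \<omega>)\<^sup>2) / 2)"
    by (auto simp: power2_eq_square algebra_simps)
  then show ?thesis using gspan_moments(1)[OF assms(1)] gspan_moments(1)[OF assms(2)] gspan_moments(1)[OF gspan_add[OF assms]] by simp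
qed

lemma E2_add:
  assumes "X \<in> gspan" "Y \<in> gspan"
  shows "E2 (\<lambda>\<omega>. X \<omega> + Y \<omega>) = E2 X + 2 * expectation (\<lambda>\<omega>. X \<omega> * Y \<omega>) + E2 Y"
proof -
  have "E2 (\<lambda>\<omega>. X \<omega> + Y \<omega>) = expectation (\<lambda>\<omega>. ((X \<omega>)\<^sup>2 + 2 * (X \<omega> * Y \<omega>)) + (Y \<omega>)\<^sup>2)"
    by (auto simp: power2_eq_square algebra_simps intro!: Bochner_Integration.integral_cong)
  also have "\<dots> = E2 X + 2 * expectation (\<lambda>\<omega>. X \<omega> * Y \<omega>) + E2 Y"
    using gspan_integrable_mult[OF assms] gspan_moments(1)[OF assms(1)] gspan_moments(1)[OF assms(2)]
    by simp
  finally show ?thesis .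
qed

lemma E2_scale: "E2 (\<lambda>\<omega>. a * X \<omega>) = a\<^sup>2 * E2 X" by (simp add: power_mult_distrib)

text \<open>For uncorrelated \<open>X\<close> and \<open>Y\<close> the variance of \<open>a X + b Y\<close> is \<open>a\<^sup>2 E X\<^sup>2 + b\<^sup>2 E Y\<^sup>2\<close>. So the joint
characteristic function is that of an independent pair, which is realised here by the two
coordinates of the product of the probability space with itself.\<close>

lemma gspan_indep:
  assumes X: "X \<in> gspan" and Y: "Y \<in> gspan" and 0: "expectation (\<lambda>\<omega>. X \<omega> * Y \<omega>) = 0"
  shows "indep_var borel X borel Y"
proof -
  note [measurable] = gspan_measurable[OF X] gspan_measurable[OF Y]
  interpret MM: pair_prob_space M M ..
  define P where "P = (\<lambda>b \<omega>. if b then X \<omega> else Y \<omega>)"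
  define Q where "Q = (\<lambda>b (\<omega>::'a \<times> 'a). if b then X (fst \<omega>) else Y (snd \<omega>))"
  have int: "complex_integrable M (\<lambda>\<omega>. iexp (c * F \<omega>))" if "F \<in> borel_measurable M" for F c
    using that by (intro integrable_const_bound[of _ 1]) auto
  have char: "(CLINT \<omega>|M. iexp (\<Sum>b\<in>UNIV. c b * P b \<omega>)) = (CLINT \<omega>|M \<Otimes>\<^sub>M M. iexp (\<Sum>b\<in>UNIV. c b * Q b \<omega>))" for c
  proof -
    have "E2 (\<lambda>\<omega>. c True * X \<omega> + c False * Y \<omega>) = (c True)\<^sup>2 * E2 X + (c False)\<^sup>2 * E2 Y"
      using E2_add[OF gspan_scale[OF X] gspan_scale[OF Y], of "c True" "c False"] 0 by (simp add: E2_scale mult.assoc mult.left_commute[of _ "c False"])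
    then have "(CLINT \<omega>|M. iexp (\<Sum>b\<in>UNIV. c b * P b \<omega>)) = exp (- ((c True)\<^sup>2 * E2 X + (c False)\<^sup>2 * E2 Y) / 2)"
      using gspan_moments(2)[OF gspan_add[OF gspan_scale[OF X] gspan_scale[OF Y]], of "c True" "c False"]
      by (simp add: P_def UNIV_bool add.commute)
    also have "\<dots> = (CLINT \<omega>|M. iexp (c True * X \<omega>)) * (CLINT \<omega>|M. iexp (c False * Y \<omega>))"
      unfolding gspan_moments(2)[OF gspan_scale[OF X]] gspan_moments(2)[OF gspan_scale[OF Y]] E2_scale
      by (simp flip: of_real_mult exp_add add: field_simps)
    also have "\<dots> = (CLINT \<omega>|M \<Otimes>\<^sub>M M. iexp (c True * X (fst \<omega>)) * iexp (c False * Y (snd \<omega>)))"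
    proof -
      have "complex_integrable (M \<Otimes>\<^sub>M M) (\<lambda>\<omega>. iexp (c True * X (fst \<omega>)) * iexp (c False * Y (snd \<omega>)))"
        by (intro MM.P.integrable_const_bound[of _ 1]) (auto simp: norm_mult)
      from MM.integral_fst'[OF this] show ?thesis by simp
    qed
    also have "\<dots> = (CLINT \<omega>|M \<Otimes>\<^sub>M M. iexp (\<Sum>b\<in>UNIV. c b * Q b \<omega>))"
      by (intro Bochner_Integration.integral_cong) (auto simp: Q_def UNIV_bool exp_add[symmetric] algebra_simps)
    finally show ?thesis .
  qed
  have "distr M borel X \<Otimes>\<^sub>M distr M borel Y = distr M (borel \<Otimes>\<^sub>M borel) (\<lambda>\<omega>. (X \<omega>, Y \<omega>))"
  proof (rule pair_measure_eqI)
    interpret X: prob_space "distr M borel X" by (rule prob_space_distr) simp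
    interpret Y: prob_space "distr M borel Y" by (rule prob_space_distr) simp
    show "sigma_finite_measure (distr M borel X)" "sigma_finite_measure (distr M borel Y)" ..
    fix A B :: "real set" assume "A \<in> sets (distr M borel X)" "B \<in> sets (distr M borel Y)"
    then have [measurable]: "A \<in> sets borel" "B \<in> sets borel" by auto
    define D where "D = (\<lambda>b. if b then A else B)"
    have "measure M {\<omega>\<in>space M. \<forall>b\<in>UNIV. P b \<omega> \<in> D b} = measure (M \<Otimes>\<^sub>M M) {\<omega>\<in>space (M \<Otimes>\<^sub>M M). \<forall>b\<in>UNIV. Q b \<omega> \<in> D b}"
      by (rule char_determines_rectangles[OF _ _ _ _ _ char])
         (auto simp: P_def Q_def D_def finite_measure_axioms MM.P.finite_measure_axioms)
    moreover have "{\<omega>\<in>space M. \<forall>b\<in>UNIV. P b \<omega> \<in> D b} = (\<lambda>\<omega>. (X \<omega>, Y \<omega>)) -` (A \<times> B) \<inter> space M"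
      by (auto simp: P_def D_def all_bool_eq)
    moreover have "{\<omega>\<in>space (M \<Otimes>\<^sub>M M). \<forall>b\<in>UNIV. Q b \<omega> \<in> D b} = (X -` A \<inter> space M) \<times> (Y -` B \<inter> space M)"
      by (auto simp: Q_def D_def all_bool_eq space_pair_measure)
    moreover have "emeasure (M \<Otimes>\<^sub>M M) ((X -` A \<inter> space M) \<times> (Y -` B \<inter> space M)) =
        emeasure M (X -` A \<inter> space M) * emeasure M (Y -` B \<inter> space M)"
      by (rule emeasure_pair_measure_Times) auto
    ultimately show "emeasure (distr M borel X) A * emeasure (distr M borel Y) B =
        emeasure (distr M (borel \<Otimes>\<^sub>M borel) (\<lambda>\<omega>. (X \<omega>, Y \<omega>))) (A \<times> B)"
      by (simp add: emeasure_distr emeasure_eq_measure MM.P.emeasure_eq_measure)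
  qed (auto intro: sets_pair_measure_cong)
  then show ?thesis by (subst indep_var_distribution_eq) auto
qed


lemma exp_gspan_integrable:
  assumes X: "X \<in> gspan" shows "integrable M (\<lambda>\<omega>. exp (X \<omega>))"
  using gspan_moments(3)[OF X] gspan_measurable[OF X] by (intro integrableI_nonneg) auto

text \<open>The density \<open>exp(s x)\<close> shifts the standard normal law by \<open>s\<close>, up to the factor \<open>exp(s\<^sup>2/2)\<close>; so the
integral is the characteristic function of a shifted normal law.\<close>

lemma exp_complex_gspan:
  assumes X: "X \<in> gspan"
  shows "(CLINT \<omega>|M. exp (X \<omega>) *\<^sub>R iexp (c * X \<omega>)) = exp ((1 - c\<^sup>2) * E2 X / 2) *\<^sub>R iexp (c * E2 X)"
proof -
  have [measurable]: "X \<in> borel_measurable M" by (rule gspan_measurable[OF X])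
  obtain s where s: "distr M borel X = centered_normal_law s" "E2 X = s\<^sup>2" using gspan_moments(4)[OF X] by auto
  have "(CLINT \<omega>|M. exp (X \<omega>) *\<^sub>R iexp (c * X \<omega>)) = (CLINT x|distr M borel X. exp x *\<^sub>R iexp (c * x))"
    by (subst integral_distr) auto
  also have "\<dots> = (CLINT x|std_normal_distribution. exp (s * x) *\<^sub>R iexp (c * (s * x)))"
    unfolding s by (subst integral_distr) auto
  also have "\<dots> = (CLINT x|lborel. std_normal_density x *\<^sub>R (exp (s * x) *\<^sub>R iexp (c * (s * x))))"
    by (subst integral_density) auto
  also have "\<dots> = (CLINT x|lborel. std_normal_density (s + 1 * x) *\<^sub>R (exp (s * (s + 1 * x)) *\<^sub>R iexp (c * (s * (s + 1 * x)))))"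
    by (subst lborel_integral_real_affine[of 1 _ s]) auto
  also have "\<dots> = (CLINT x|lborel. (exp (s\<^sup>2 / 2) *\<^sub>R iexp (c * s\<^sup>2)) * (std_normal_density x *\<^sub>R iexp (c * s * x)))"
  proof (rule Bochner_Integration.integral_cong[OF refl])
    fix x
    have r: "std_normal_density (s + x) * exp (s * (s + x)) = exp (s\<^sup>2 / 2) * std_normal_density x"
      unfolding std_normal_density_def
      by (simp add: exp_add[symmetric] power2_eq_square field_simps flip: exp_add)
    have c: "iexp (c * (s * (s + x))) = iexp (c * s\<^sup>2) * iexp (c * s * x)"
      by (simp add: exp_add[symmetric] power2_eq_square algebra_simps)
    show "std_normal_density (s + 1 * x) *\<^sub>R (exp (s * (s + 1 * x)) *\<^sub>R iexp (c * (s * (s + 1 * x))))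
      = (exp (s\<^sup>2 / 2) *\<^sub>R iexp (c * s\<^sup>2)) * (std_normal_density x *\<^sub>R iexp (c * s * x))"
      using r c by (simp add: scaleR_scaleR)
  qed
  also have "\<dots> = (exp (s\<^sup>2 / 2) *\<^sub>R iexp (c * s\<^sup>2)) * char std_normal_distribution (c * s)"
  proof -
    have "char std_normal_distribution (c * s) = (CLINT x|lborel. std_normal_density x *\<^sub>R iexp (c * s * x))"
      unfolding char_def by (subst integral_density) auto
    then show ?thesis by (simp only: integral_mult_right_zero)
  qed
  also have "\<dots> = exp ((1 - c\<^sup>2) * E2 X / 2) *\<^sub>R iexp (c * E2 X)"
    by (simp add: char_std_normal_distribution s scaleR_conv_of_real exp_of_real[symmetric] flip: exp_add)
       (rule arg_cong[where f=exp], simp add: field_simps)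
  finally show ?thesis .
qed

text \<open>Split \<open>X = c H + Y\<close> with \<open>Y\<close> uncorrelated with \<open>H\<close>, hence independent of it. The formula says that
the density \<open>exp(H - E H\<^sup>2/2)\<close> shifts the mean of every \<open>X\<close> by its covariance with \<open>H\<close>.\<close>

lemma exp_gspan_char:
  assumes H: "H \<in> gspan" and X: "X \<in> gspan"
  shows "(CLINT \<omega>|M. exp (H \<omega>) *\<^sub>R iexp (X \<omega>)) =
    exp (E2 H / 2 - E2 X / 2) *\<^sub>R iexp (expectation (\<lambda>\<omega>. X \<omega> * H \<omega>))"
proof -
  note [measurable] = gspan_measurable[OF X] gspan_measurable[OF H]
  define c where "c = expectation (\<lambda>\<omega>. X \<omega> * H \<omega>) / E2 H"
  define Y where "Y = (\<lambda>\<omega>. X \<omega> - c * H \<omega>)"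
  have Y: "Y \<in> gspan" unfolding Y_def by (rule gspan_diff[OF X gspan_scale[OF H]])
  note [measurable] = gspan_measurable[OF Y]
  \<comment> \<open>if \<open>E2 H = 0\<close>, then \<open>c = 0\<close> by the convention for division, and \<open>H\<close> vanishes almost surely\<close>
  have XH: "expectation (\<lambda>\<omega>. X \<omega> * H \<omega>) = c * E2 H"
  proof (cases "E2 H = 0")
    case True
    then have "AE \<omega> in M. (H \<omega>)\<^sup>2 = 0"
      using integral_nonneg_eq_0_iff_AE[OF gspan_moments(1)[OF H]] by auto
    then have "expectation (\<lambda>\<omega>. X \<omega> * H \<omega>) = expectation (\<lambda>_. 0)"
      by (intro integral_cong_AE) auto
    then show ?thesis using True by simp
  qed (simp add: c_def)
  have HY: "expectation (\<lambda>\<omega>. H \<omega> * Y \<omega>) = 0"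
  proof -
    have "expectation (\<lambda>\<omega>. H \<omega> * Y \<omega>) = expectation (\<lambda>\<omega>. X \<omega> * H \<omega> - c * (H \<omega>)\<^sup>2)"
      by (intro Bochner_Integration.integral_cong) (auto simp: Y_def power2_eq_square algebra_simps)
    also have "\<dots> = 0" using gspan_integrable_mult[OF X H] gspan_moments(1)[OF H] XH by simp
    finally show ?thesis .
  qed
  have X_eq: "X = (\<lambda>\<omega>. c * H \<omega> + Y \<omega>)" by (auto simp: Y_def)
  have "E2 (\<lambda>\<omega>. c * H \<omega> + Y \<omega>) = c\<^sup>2 * E2 H + E2 Y"
    using E2_add[OF gspan_scale[OF H] Y, of c] HY by (simp add: E2_scale mult.assoc)
  then have E2X: "E2 X = c\<^sup>2 * E2 H + E2 Y" using X_eq by simp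
  have "indep_var borel ((\<lambda>x. exp x *\<^sub>R iexp (c * x)) \<circ> H) borel (iexp \<circ> Y)"
    by (rule indep_var_compose[OF gspan_indep[OF H Y HY]]) auto
  then have "(CLINT \<omega>|M. (exp (H \<omega>) *\<^sub>R iexp (c * H \<omega>)) * iexp (Y \<omega>)) =
      (CLINT \<omega>|M. exp (H \<omega>) *\<^sub>R iexp (c * H \<omega>)) * (CLINT \<omega>|M. iexp (Y \<omega>))"
    unfolding comp_def
  proof (rule indep_var_lebesgue_integral)
    show "complex_integrable M (\<lambda>\<omega>. exp (H \<omega>) *\<^sub>R iexp (c * H \<omega>))"
      by (rule Bochner_Integration.integrable_bound[OF exp_gspan_integrable[OF H]]) auto
    show "complex_integrable M (\<lambda>\<omega>. iexp (Y \<omega>))"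
      by (intro integrable_const_bound[of _ 1]) auto
  qed
  moreover have "(CLINT \<omega>|M. exp (H \<omega>) *\<^sub>R iexp (X \<omega>)) = (CLINT \<omega>|M. (exp (H \<omega>) *\<^sub>R iexp (c * H \<omega>)) * iexp (Y \<omega>))"
    by (intro Bochner_Integration.integral_cong refl) (simp add: X_eq exp_add[symmetric] algebra_simps)
  ultimately show ?thesis
    unfolding exp_complex_gspan[OF H] gspan_moments(2)[OF Y]
    by (simp add: E2X XH scaleR_conv_of_real exp_of_real[symmetric] flip: exp_add)
       (rule arg_cong[where f=exp], simp add: field_simps)
qed


lemma V_0: "AE \<omega> in M. V 0 \<omega> = 0"
proof -
  have "E2 (V 0) = 0" using var_0 by (simp add: var_fn_def expectation_V)
  then show ?thesis using integral_nonneg_eq_0_iff_AE[OF gspan_moments(1)[OF gspan_V]] by auto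
qed

lemma var_fn_eq: "var_fn M V t = E2 (V t)"
  by (simp add: var_fn_def expectation_V)

lemma var_fn_nonneg: "0 \<le> var_fn M V t"
  unfolding var_fn_eq by (rule integral_nonneg_AE) auto

lemma E2_increments:
  assumes "finite J"
  shows "E2 (\<lambda>\<omega>. \<Sum>t\<in>J. c t * (V (t + h) \<omega> - V h \<omega>)) = E2 (\<lambda>\<omega>. \<Sum>t\<in>J. c t * V t \<omega>)"
proof -
  let ?g = "\<lambda>x. (\<Sum>t\<in>J. c t * x t)\<^sup>2"
  have [measurable]: "?g \<in> borel_measurable (Pi\<^sub>M J (\<lambda>_. borel))" by measurable
  have r: "?g (restrict f J) = (\<Sum>t\<in>J. c t * f t)\<^sup>2" for f by simp
  have *: "integral\<^sup>L (distr M (Pi\<^sub>M J (\<lambda>_. borel)) (\<lambda>\<omega>. \<lambda>t\<in>J. V (t + h) \<omega> - V h \<omega>)) ?g =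
     E2 (\<lambda>\<omega>. \<Sum>t\<in>J. c t * (V (t + h) \<omega> - V h \<omega>))" for h
    by (subst integral_distr) (auto intro!: measurable_restrict)
  have "E2 (\<lambda>\<omega>. \<Sum>t\<in>J. c t * (V (t + h) \<omega> - V h \<omega>)) = E2 (\<lambda>\<omega>. \<Sum>t\<in>J. c t * (V (t + 0) \<omega> - V 0 \<omega>))"
    using stationary assms unfolding stationary_increments_def *[symmetric] by simp
  also have "\<dots> = E2 (\<lambda>\<omega>. \<Sum>t\<in>J. c t * V t \<omega>)"
    by (rule integral_cong_AE) (use V_0 in auto)
  finally show ?thesis .
qed

lemma E2_increment: "E2 (\<lambda>\<omega>. V (t + h) \<omega> - V h \<omega>) = var_fn M V t"
  using E2_increments[of "{t}" "\<lambda>_. 1" h] by (simp add: var_fn_eq)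

text \<open>The polarisation identity for \<open>V (t + h) = (V (t + h) - V h) + V h\<close>, with stationarity of the
increments.\<close>

lemma covariance_increment:
  "expectation (\<lambda>\<omega>. (V (t + h) \<omega> - V h \<omega>) * V h \<omega>) = (var_fn M V (t + h) - var_fn M V t - var_fn M V h) / 2"
  using E2_add[OF gspan_diff[OF gspan_V gspan_V] gspan_V, of "t + h" h h]
  by (simp add: E2_increment var_fn_eq[symmetric])

definition logZ :: "'t \<Rightarrow> 'a \<Rightarrow> real" where
  "logZ t \<omega> = V t \<omega> - var_fn M V t / 2"

lemma measurable_logZ[measurable]: "logZ t \<in> borel_measurable M"
  unfolding logZ_def[abs_def] by measurable

text \<open>The tilt with density \<open>exp(logZ h)\<close> adds to the mean of \<open>V (t + h) - V h\<close> its covariance with \<open>V h\<close>,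
namely \<open>(\<sigma>\<^sup>2(t + h) - \<sigma>\<^sup>2(t) - \<sigma>\<^sup>2(h))/2\<close>. Together with the centring terms in
\<open>logZ (t + h) - logZ h\<close> this leaves the mean \<open>-\<sigma>\<^sup>2(t)/2\<close> of \<open>logZ t\<close>, and the covariances agree by
stationarity of the increments.\<close>

lemma tilt_char:
  assumes "finite J"
  shows "(CLINT \<omega>|M. exp (logZ h \<omega>) *\<^sub>R iexp (\<Sum>t\<in>J. c t * (logZ (t + h) \<omega> - logZ h \<omega>)))
    = (CLINT \<omega>|M. iexp (\<Sum>t\<in>J. c t * logZ t \<omega>))"
proof -
  let ?v = "var_fn M V"
  define X where "X = (\<lambda>\<omega>. \<Sum>t\<in>J. c t * (V (t + h) \<omega> - V h \<omega>))"
  \<comment> \<open>\<open>m\<close> and \<open>m'\<close> are the deterministic parts of the two exponents\<close>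
  define m where "m = (\<Sum>t\<in>J. c t * (- ?v t / 2))"
  define m' where "m' = (\<Sum>t\<in>J. c t * (- (?v (t + h) - ?v h) / 2))"
  have X: "X \<in> gspan" unfolding X_def by (rule gspan_sum[OF assms gspan_diff[OF gspan_V gspan_V]])
  have W: "(\<lambda>\<omega>. \<Sum>t\<in>J. c t * V t \<omega>) \<in> gspan" by (rule gspan_sum[OF assms gspan_V])
  have E2X: "E2 X = E2 (\<lambda>\<omega>. \<Sum>t\<in>J. c t * V t \<omega>)"
    unfolding X_def by (rule E2_increments[OF assms])
  have "expectation (\<lambda>\<omega>. X \<omega> * V h \<omega>) = expectation (\<lambda>\<omega>. \<Sum>t\<in>J. c t * ((V (t + h) \<omega> - V h \<omega>) * V h \<omega>))"
    by (simp add: X_def sum_distrib_right mult.assoc)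
  also have "\<dots> = (\<Sum>t\<in>J. c t * ((?v (t + h) - ?v t - ?v h) / 2))"
    using gspan_integrable_mult[OF gspan_diff[OF gspan_V gspan_V] gspan_V]
    by (subst Bochner_Integration.integral_sum) (auto simp: covariance_increment)
  also have "\<dots> = m - m'" unfolding m_def m'_def sum_subtractf[symmetric]
    by (intro sum.cong) (auto simp: field_simps)
  finally have cov: "expectation (\<lambda>\<omega>. X \<omega> * V h \<omega>) = m - m'" .
  have a: "(\<Sum>t\<in>J. c t * (logZ (t + h) \<omega> - logZ h \<omega>)) = X \<omega> + m'" for \<omega>
    unfolding X_def m'_def logZ_def sum.distrib[symmetric] by (intro sum.cong) (auto simp: field_simps)
  have b: "(\<Sum>t\<in>J. c t * logZ t \<omega>) = (\<Sum>t\<in>J. c t * V t \<omega>) + m" for \<omega>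
    unfolding m_def logZ_def sum.distrib[symmetric] by (intro sum.cong) (auto simp: field_simps)
  have "(CLINT \<omega>|M. exp (logZ h \<omega>) *\<^sub>R iexp (X \<omega> + m')) =
    (CLINT \<omega>|M. (exp (- ?v h / 2) *\<^sub>R iexp m') * (exp (V h \<omega>) *\<^sub>R iexp (X \<omega>)))"
    by (intro Bochner_Integration.integral_cong refl)
       (simp add: logZ_def scaleR_conv_of_real exp_of_real[symmetric] algebra_simps flip: exp_add)
  also have "\<dots> = (exp (- ?v h / 2) *\<^sub>R iexp m') * (exp (E2 (V h) / 2 - E2 X / 2) *\<^sub>R iexp (m - m'))"
    by (simp only: integral_mult_right_zero exp_gspan_char[OF gspan_V X] cov)
  also have "\<dots> = iexp m * exp (- E2 (\<lambda>\<omega>. \<Sum>t\<in>J. c t * V t \<omega>) / 2)"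
    by (simp add: E2X var_fn_eq scaleR_conv_of_real exp_of_real[symmetric] algebra_simps flip: exp_add)
  also have "\<dots> = (CLINT \<omega>|M. iexp m * iexp (\<Sum>t\<in>J. c t * V t \<omega>))"
    by (simp only: integral_mult_right_zero gspan_moments(2)[OF W])
  also have "\<dots> = (CLINT \<omega>|M. iexp ((\<Sum>t\<in>J. c t * V t \<omega>) + m))"
    by (intro Bochner_Integration.integral_cong refl) (simp add: algebra_simps flip: exp_add)
  finally show ?thesis unfolding a b .
qed

text \<open>Equality of the finite-dimensional laws extends to the law of the whole path.\<close>

lemma tilt_law:
  "distr (density M (\<lambda>\<omega>. ennreal (exp (logZ h \<omega>)))) (Pi\<^sub>M D (\<lambda>_. borel)) (\<lambda>\<omega>. \<lambda>t\<in>D. logZ (t + h) \<omega> - logZ h \<omega>)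
    = distr M (Pi\<^sub>M D (\<lambda>_. borel)) (\<lambda>\<omega>. \<lambda>t\<in>D. logZ t \<omega>)" (is "?P = ?Q")
proof (rule measure_eqI_PiM_infinite)
  let ?M = "density M (\<lambda>\<omega>. ennreal (exp (logZ h \<omega>)))"
  have "emeasure ?M (space ?M) = (\<integral>\<^sup>+\<omega>. ennreal (exp (logZ h \<omega>)) \<partial>M)"
    by (simp add: emeasure_density cong: nn_integral_cong)
  also have "\<dots> = (\<integral>\<^sup>+\<omega>. ennreal (exp (- var_fn M V h / 2)) * ennreal (exp (V h \<omega>)) \<partial>M)"
    by (intro nn_integral_cong) (simp add: logZ_def flip: ennreal_mult exp_add)
  also have "\<dots> < \<infinity>"
    by (subst nn_integral_cmult) (auto simp: gspan_moments(3)[OF gspan_V] ennreal_mult_less_top)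
  finally have fin: "finite_measure ?M" by (intro finite_measureI) auto
  have m1: "(\<lambda>\<omega>. \<lambda>t\<in>D. logZ (t + h) \<omega> - logZ h \<omega>) \<in> measurable ?M (Pi\<^sub>M D (\<lambda>_. borel))"
    by (intro measurable_restrict) simp
  have m2: "(\<lambda>\<omega>. \<lambda>t\<in>D. logZ t \<omega>) \<in> measurable M (Pi\<^sub>M D (\<lambda>_. borel))"
    by (intro measurable_restrict) simp
  show "finite_measure ?P" by (rule finite_measure.finite_measure_distr[OF fin m1])
  fix A J assume J: "finite J" "J \<subseteq> D" and A: "\<And>i. i \<in> J \<Longrightarrow> A i \<in> sets (borel :: real measure)"
  have "measure ?M {\<omega>\<in>space ?M. \<forall>t\<in>J. logZ (t + h) \<omega> - logZ h \<omega> \<in> A t} = measure M {\<omega>\<in>space M. \<forall>t\<in>J. logZ t \<omega> \<in> A t}"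
  proof (rule char_determines_rectangles[OF J(1) fin finite_measure_axioms])
    fix c
    show "(CLINT \<omega>|?M. iexp (\<Sum>t\<in>J. c t * (logZ (t + h) \<omega> - logZ h \<omega>))) = (CLINT \<omega>|M. iexp (\<Sum>t\<in>J. c t * logZ t \<omega>))"
      unfolding tilt_char[OF J(1), symmetric, of c h] by (rule integral_density) auto
  qed (use A in auto)
  moreover have cyl: "prod_emb D (\<lambda>_. borel) J (Pi\<^sub>E J A) \<in> sets (Pi\<^sub>M D (\<lambda>_. borel))"
    using J A by (intro sets_PiM_I) auto
  have mem: "(\<lambda>t\<in>D. f t) \<in> prod_emb D (\<lambda>_. borel) J (Pi\<^sub>E J A) \<longleftrightarrow> (\<forall>t\<in>J. f t \<in> A t)" for f
    using J by (subst prod_emb_iff) (auto simp: Int_absorb1 PiE_iff subset_iff)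
  have "emeasure ?P (prod_emb D (\<lambda>_. borel) J (Pi\<^sub>E J A)) = emeasure ?M {\<omega>\<in>space ?M. \<forall>t\<in>J. logZ (t + h) \<omega> - logZ h \<omega> \<in> A t}"
    unfolding emeasure_distr[OF m1 cyl] by (rule arg_cong2[where f=emeasure, OF refl]) (auto simp del: restrict_apply simp: mem)
  moreover have "emeasure ?Q (prod_emb D (\<lambda>_. borel) J (Pi\<^sub>E J A)) = emeasure M {\<omega>\<in>space M. \<forall>t\<in>J. logZ t \<omega> \<in> A t}"
    unfolding emeasure_distr[OF m2 cyl] by (rule arg_cong2[where f=emeasure, OF refl]) (auto simp del: restrict_apply simp: mem)
  ultimately show "emeasure ?P (prod_emb D (\<lambda>_. borel) J (Pi\<^sub>E J A)) = emeasure ?Q (prod_emb D (\<lambda>_. borel) J (Pi\<^sub>E J A))"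
    by (simp add: emeasure_eq_measure finite_measure.emeasure_eq_measure[OF fin])
qed simp_all

lemma tilt_nn_integral:
  assumes [measurable]: "F \<in> borel_measurable (Pi\<^sub>M D (\<lambda>_. borel))"
  shows "(\<integral>\<^sup>+\<omega>. ennreal (exp (logZ h \<omega>)) * F (\<lambda>t\<in>D. logZ (t + h) \<omega> - logZ h \<omega>) \<partial>M) = (\<integral>\<^sup>+\<omega>. F (\<lambda>t\<in>D. logZ t \<omega>) \<partial>M)"
proof -
  let ?M = "density M (\<lambda>\<omega>. ennreal (exp (logZ h \<omega>)))"
  have m1: "(\<lambda>\<omega>. \<lambda>t\<in>D. logZ (t + h) \<omega> - logZ h \<omega>) \<in> measurable M (Pi\<^sub>M D (\<lambda>_. borel))"
    by (intro measurable_restrict) simp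
  have m2: "(\<lambda>\<omega>. \<lambda>t\<in>D. logZ t \<omega>) \<in> measurable M (Pi\<^sub>M D (\<lambda>_. borel))"
    by (intro measurable_restrict) simp
  have "(\<integral>\<^sup>+\<omega>. ennreal (exp (logZ h \<omega>)) * F (\<lambda>t\<in>D. logZ (t + h) \<omega> - logZ h \<omega>) \<partial>M) = (\<integral>\<^sup>+\<omega>. F (\<lambda>t\<in>D. logZ (t + h) \<omega> - logZ h \<omega>) \<partial>?M)"
    by (rule nn_integral_density[symmetric]) (use measurable_compose[OF m1 assms] in auto)
  also have "\<dots> = (\<integral>\<^sup>+y. F y \<partial>distr ?M (Pi\<^sub>M D (\<lambda>_. borel)) (\<lambda>\<omega>. \<lambda>t\<in>D. logZ (t + h) \<omega> - logZ h \<omega>))"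
    by (rule nn_integral_distr[symmetric]) (intro measurable_restrict, simp, simp)
  also have "\<dots> = (\<integral>\<^sup>+\<omega>. F (\<lambda>t\<in>D. logZ t \<omega>) \<partial>M)"
    unfolding tilt_law by (rule nn_integral_distr[OF m2]) (use assms in simp)
  finally show ?thesis .
qed

end

section \<open>The level functional of a path cut into cells\<close>

text \<open>The finite measure \<open>\<kappa>\<close> lives on the cell at the origin. In the applications \<open>P\<close> is a countable
dense part of that cell, and the maps \<open>\<pi> n\<close> into \<open>P\<close> converge to the identity on the cell. The
functionals below read a path \<open>y\<close> only at the points \<open>k + p\<close> with \<open>p \<in> P\<close>; this is what makes them
measurable on the product space of paths.\<close>

locale cell = finite_measure \<kappa> for \<kappa> :: "('t :: ab_group_add) measure" +
  fixes P :: "'t set" and \<pi> :: "nat \<Rightarrow> 't \<Rightarrow> 't" and x :: real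
  assumes countable_P: "countable P" and zero_in_P: "0 \<in> P"
    and \<pi>_measurable[measurable]: "\<And>n. \<pi> n \<in> measurable \<kappa> (count_space P)"
begin

definition cell_sup :: "('t \<Rightarrow> real) \<Rightarrow> 't \<Rightarrow> ennreal" where
  "cell_sup y k = (SUP p\<in>P. ennreal (exp (y (k + p))))"

text \<open>When \<open>y\<close> is continuous and \<open>\<pi> n t\<close> converges to \<open>t\<close>, this is the value of \<open>exp y\<close> at \<open>k + t\<close>. The
upper limit makes sense for every path.\<close>

definition cell_val :: "('t \<Rightarrow> real) \<Rightarrow> 't \<Rightarrow> 't \<Rightarrow> ennreal" where
  "cell_val y k t = limsup (\<lambda>n. ennreal (exp (y (k + \<pi> n t))))"

definition occupation :: "('t \<Rightarrow> real) \<Rightarrow> 't \<Rightarrow> real \<Rightarrow> ennreal" where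
  "occupation y k s = (\<integral>\<^sup>+t. indicator {ennreal s<..} (cell_val y k t) \<partial>\<kappa>)"

definition level :: "'t set \<Rightarrow> ('t \<Rightarrow> real) \<Rightarrow> ennreal" where
  "level K y = (\<integral>\<^sup>+s. indicator {0..} s * (if (\<Sum>k\<in>K. occupation y k s) > ennreal x then 1 else 0) \<partial>lborel)"

abbreviation supsum :: "'t set \<Rightarrow> ('t \<Rightarrow> real) \<Rightarrow> ennreal" where
  "supsum K y \<equiv> (\<Sum>k\<in>K. cell_sup y k)"

lemma cell_sup_shift:
  "cell_sup (\<lambda>t. y (t + h) - c) k = ennreal (exp (- c)) * cell_sup y (k + h)"
  unfolding cell_sup_def SUP_mult_left_ennreal
  by (intro SUP_cong refl) (simp add: ac_simps flip: ennreal_mult exp_add)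

lemma cell_val_shift:
  "cell_val (\<lambda>t. y (t + h) - c) k t = ennreal (exp (- c)) * cell_val y (k + h) t"
proof -
  have "limsup (\<lambda>n. ennreal (exp (- c)) * ennreal (exp (y (k + h + \<pi> n t)))) =
      ennreal (exp (- c)) * limsup (\<lambda>n. ennreal (exp (y (k + h + \<pi> n t))))"
    by (rule Limsup_compose_continuous_mono)
       (auto intro!: ennreal_continuous_on_cmult continuous_on_id monoI mult_left_mono)
  then show ?thesis unfolding cell_val_def by (simp add: ac_simps flip: ennreal_mult exp_add)
qed

lemma occupation_shift:
  "occupation (\<lambda>t. y (t + h) - c) k s = occupation y (k + h) (exp c * s)"
proof -
  have e: "(ennreal s < ennreal (exp (- c)) * u) \<longleftrightarrow> (ennreal (exp c * s) < u)" for u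
  proof -
    have 1: "ennreal (exp c) * (ennreal (exp (- c)) * w) = w" "ennreal (exp (- c)) * (ennreal (exp c) * w) = w" for w :: ennreal
      by (simp_all flip: mult.assoc ennreal_mult exp_add)
    have 2: "ennreal (exp c * s) = ennreal (exp c) * ennreal s" by (simp add: ennreal_mult')
    have "ennreal (exp (- c)) * u \<le> ennreal s \<longleftrightarrow> u \<le> ennreal (exp c) * ennreal s"
      using mult_left_mono[of "ennreal (exp (- c)) * u" "ennreal s" "ennreal (exp c)"]
        mult_left_mono[of u "ennreal (exp c) * ennreal s" "ennreal (exp (- c))"] unfolding 1 by auto
    then show ?thesis unfolding 2 by (simp flip: not_le)
  qed
  show ?thesis unfolding occupation_def cell_val_shift indicator_def by (simp add: e)
qed

text \<open>Evaluation of a path at the point \<open>\<pi> n t\<close>, which depends on \<open>t\<close>, is jointly measurable because this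
point ranges over a countable set.\<close>

lemma cell_val_measurable[measurable]:
  assumes D: "\<And>p. p \<in> P \<Longrightarrow> k + p \<in> D"
  shows "(\<lambda>(y, t). cell_val y k t) \<in> borel_measurable (Pi\<^sub>M D (\<lambda>_. borel) \<Otimes>\<^sub>M \<kappa>)"
proof -
  have "(\<lambda>z. (\<lambda>p z. fst z (k + p)) (\<pi> n (snd z)) z) \<in> borel_measurable (Pi\<^sub>M D (\<lambda>_. borel :: real measure) \<Otimes>\<^sub>M \<kappa>)" for n
  proof (rule measurable_compose_countable'[OF _ _ countable_P, where f="\<lambda>p z. fst z (k + p)" and g="\<lambda>z. \<pi> n (snd z)"])
    fix p assume "p \<in> P"
    have [measurable]: "(\<lambda>y. y (k + p)) \<in> borel_measurable (Pi\<^sub>M D (\<lambda>_. borel :: real measure))"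
      by (rule measurable_component_singleton) (rule D[OF \<open>p \<in> P\<close>])
    show "(\<lambda>z. fst z (k + p)) \<in> borel_measurable (Pi\<^sub>M D (\<lambda>_. borel :: real measure) \<Otimes>\<^sub>M \<kappa>)"
      by measurable
  qed measurable
  then have [measurable]: "(\<lambda>z. fst z (k + \<pi> n (snd z))) \<in> borel_measurable (Pi\<^sub>M D (\<lambda>_. borel :: real measure) \<Otimes>\<^sub>M \<kappa>)" for n
    by simp
  show ?thesis unfolding cell_val_def split_beta by measurable
qed

lemma cell_sup_measurable[measurable]:
  assumes D: "\<And>p. p \<in> P \<Longrightarrow> k + p \<in> D"
  shows "(\<lambda>y. cell_sup y k) \<in> borel_measurable (Pi\<^sub>M D (\<lambda>_. borel))"
  unfolding cell_sup_def
proof (rule borel_measurable_SUP[OF countable_P])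
  fix p assume "p \<in> P"
  have [measurable]: "(\<lambda>y. y (k + p)) \<in> borel_measurable (Pi\<^sub>M D (\<lambda>_. borel :: real measure))"
    by (rule measurable_component_singleton) (rule D[OF \<open>p \<in> P\<close>])
  show "(\<lambda>y. ennreal (exp (y (k + p)))) \<in> borel_measurable (Pi\<^sub>M D (\<lambda>_. borel :: real measure))" by measurable
qed

lemma occupation_measurable[measurable]:
  assumes D: "\<And>p. p \<in> P \<Longrightarrow> k + p \<in> D"
  shows "(\<lambda>(y, s). occupation y k s) \<in> borel_measurable (Pi\<^sub>M D (\<lambda>_. borel) \<Otimes>\<^sub>M lborel)"
proof -
  have [measurable]: "(\<lambda>z. cell_val (fst (fst z)) k (snd z)) \<in> borel_measurable ((Pi\<^sub>M D (\<lambda>_. borel) \<Otimes>\<^sub>M (lborel :: real measure)) \<Otimes>\<^sub>M \<kappa>)"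
    using measurable_compose[OF _ cell_val_measurable[OF D], of "\<lambda>z. (fst (fst z), snd z)" "(Pi\<^sub>M D (\<lambda>_. borel) \<Otimes>\<^sub>M (lborel :: real measure)) \<Otimes>\<^sub>M \<kappa>"]
    by simp
  have "(\<lambda>z. \<integral>\<^sup>+t. (if ennreal (snd z) < cell_val (fst z) k t then 1 else 0) \<partial>\<kappa>)
      \<in> borel_measurable (Pi\<^sub>M D (\<lambda>_. borel) \<Otimes>\<^sub>M lborel)"
    by measurable
  then show ?thesis unfolding occupation_def split_beta indicator_def by simp
qed

lemma level_integrand_measurable:
  assumes D: "\<And>k p. k \<in> K \<Longrightarrow> p \<in> P \<Longrightarrow> k + p \<in> D"
  shows "(\<lambda>(y, s). if (\<Sum>k\<in>K. occupation y k s) > ennreal x then 1 else 0 :: ennreal)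
    \<in> borel_measurable (Pi\<^sub>M D (\<lambda>_. borel) \<Otimes>\<^sub>M lborel)"
proof -
  have [measurable]: "(\<lambda>z. \<Sum>k\<in>K. occupation (fst z) k (snd z)) \<in> borel_measurable (Pi\<^sub>M D (\<lambda>_. borel) \<Otimes>\<^sub>M lborel)"
    using occupation_measurable[OF D] by (intro borel_measurable_sum) (simp add: split_beta)
  show ?thesis unfolding split_beta by measurable
qed

lemma level_measurable[measurable]:
  assumes D: "\<And>k p. k \<in> K \<Longrightarrow> p \<in> P \<Longrightarrow> k + p \<in> D"
  shows "level K \<in> borel_measurable (Pi\<^sub>M D (\<lambda>_. borel))"
proof -
  have [measurable]: "(\<lambda>z. if (\<Sum>k\<in>K. occupation (fst z) k (snd z)) > ennreal x then 1 else 0 :: ennreal)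
    \<in> borel_measurable (Pi\<^sub>M D (\<lambda>_. borel) \<Otimes>\<^sub>M lborel)"
    using level_integrand_measurable[of K D, OF D] by (simp add: split_beta)
  show ?thesis unfolding level_def[abs_def] by measurable
qed

text \<open>
For a single path, joint measurability is used at the point \<open>y\<close> of the product space over all indices.\<close>

lemma occupation_section_measurable:
  "(\<lambda>s. occupation y k s) \<in> borel_measurable borel"
proof -
  have "(\<lambda>s. (\<lambda>(y, s). occupation y k s) (restrict y UNIV, s)) \<in> borel_measurable lborel"
    by (rule measurable_compose[OF _ occupation_measurable[of k UNIV]]) (auto simp: space_PiM intro!: measurable_Pair)
  then show ?thesis by (simp add: restrict_UNIV)
qed

lemma level_section_measurable:
  "(\<lambda>s. if (\<Sum>k\<in>K. occupation y k s) > ennreal x then 1 else 0 :: ennreal) \<in> borel_measurable borel"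
proof -
  note [measurable] = occupation_section_measurable
  show ?thesis by measurable
qed

text \<open>Homogeneity and covariance under translation at once: adding a constant to \<open>y\<close> rescales the levels
\<open>s\<close>, and the substitution in the integral over \<open>s\<close> produces the factor.\<close>

lemma level_shift:
  assumes "finite K"
  shows "level K (\<lambda>t. y (t + h) - c) = ennreal (exp (- c)) * level ((\<lambda>k. k + h) ` K) y"
proof -
  note [measurable] = level_section_measurable
  have "(\<Sum>k\<in>(\<lambda>k. k + h) ` K. occupation y k s) = (\<Sum>k\<in>K. occupation y (k + h) s)" for s
    by (subst sum.reindex) (auto simp: inj_on_def)
  then have r: "level ((\<lambda>k. k + h) ` K) y =
     (\<integral>\<^sup>+s. indicator {0..} s * (if (\<Sum>k\<in>K. occupation y (k + h) s) > ennreal x then 1 else 0) \<partial>lborel)"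
    unfolding level_def by simp
  have m: "(\<lambda>s. indicator {0..} s * (if (\<Sum>k\<in>K. occupation y (k + h) s) > ennreal x then 1 else 0 :: ennreal)) \<in> borel_measurable borel"
  proof -
    note [measurable] = occupation_section_measurable
    show ?thesis by measurable
  qed
  have i: "indicator {0..} (exp c * s) = (indicator {0..} s :: ennreal)" for s
    by (simp add: indicator_def zero_le_mult_iff)
  have "level ((\<lambda>k. k + h) ` K) y = ennreal (exp c) * level K (\<lambda>t. y (t + h) - c)"
    unfolding r using nn_integral_real_affine[OF m, of "exp c" 0]
    unfolding level_def occupation_shift by (simp add: i)
  then show ?thesis by (simp flip: mult.assoc ennreal_mult exp_add)
qed

lemma cell_val_le_cell_sup: "t \<in> space \<kappa> \<Longrightarrow> cell_val y k t \<le> cell_sup y k"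
  unfolding cell_val_def cell_sup_def
  using measurable_space[OF \<pi>_measurable] by (intro Limsup_bounded always_eventually allI SUP_upper) auto

lemma occupation_eq_0: "cell_sup y k \<le> ennreal s \<Longrightarrow> occupation y k s = 0"
proof -
  assume a: "cell_sup y k \<le> ennreal s"
  have "occupation y k s = (\<integral>\<^sup>+t. 0 \<partial>\<kappa>)"
    unfolding occupation_def
  proof (rule nn_integral_cong)
    fix t assume "t \<in> space \<kappa>"
    then have "cell_val y k t \<le> ennreal s" using cell_val_le_cell_sup a order_trans by blast
    then show "indicator {ennreal s<..} (cell_val y k t) = (0 :: ennreal)" by (simp add: not_less)
  qed
  then show ?thesis by simp
qed

lemma level_empty: "level {} y = 0"
  by (simp add: level_def)

lemma level_mono: "finite K' \<Longrightarrow> K \<subseteq> K' \<Longrightarrow> level K y \<le> level K' y"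
proof -
  assume "finite K'" "K \<subseteq> K'"
  then have "(\<Sum>k\<in>K. occupation y k s) \<le> (\<Sum>k\<in>K'. occupation y k s)" for s by (intro sum_mono2) auto
  then show ?thesis unfolding level_def
    by (intro nn_integral_mono mult_left_mono) (auto dest: less_le_trans)
qed

lemma nn_integral_below: "(\<integral>\<^sup>+s. indicator {0..} s * (if ennreal s < b then 1 else 0) \<partial>lborel) \<le> b"
proof (cases b)
  case (real r)
  have "(\<integral>\<^sup>+s. indicator {0..} s * (if ennreal s < b then 1 else 0) \<partial>lborel) \<le> (\<integral>\<^sup>+s. indicator {0..r} s \<partial>lborel)"
    using real by (intro nn_integral_mono) (auto simp: indicator_def ennreal_less_iff)
  also have "\<dots> = b" using real by simp
  finally show ?thesis .
qed simp

text \<open>Cells whose supremum is at most \<open>s\<close> do not contribute to the occupation time above \<open>s\<close>.\<close>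

lemma level_le_level_add_supsum:
  assumes "finite K'" "K \<subseteq> K'"
  shows "level K' y \<le> level K y + supsum (K' - K) y"
proof -
  note [measurable] = occupation_section_measurable
  let ?N = "supsum (K' - K) y"
  have "level K' y \<le> (\<integral>\<^sup>+s. indicator {0..} s * (if (\<Sum>k\<in>K. occupation y k s) > ennreal x then 1 else 0)
      + indicator {0..} s * (if ennreal s < ?N then 1 else 0) \<partial>lborel)"
    unfolding level_def
  proof (rule nn_integral_mono)
    fix s
    show "indicator {0..} s * (if ennreal x < (\<Sum>k\<in>K'. occupation y k s) then 1 else 0) \<le>
      indicator {0..} s * (if ennreal x < (\<Sum>k\<in>K. occupation y k s) then 1 else 0) +
      indicator {0..} s * (if ennreal s < ?N then 1 else 0 :: ennreal)"
    proof (cases "ennreal s < ?N")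
      case False
      have "occupation y k s = 0" if "k \<in> K' - K" for k
      proof (rule occupation_eq_0)
        have "cell_sup y k \<le> ?N" using assms that by (intro member_le_sum) auto
        then show "cell_sup y k \<le> ennreal s" using False by simp
      qed
      then have "(\<Sum>k\<in>K'. occupation y k s) = (\<Sum>k\<in>K. occupation y k s)"
        using assms by (intro sum.mono_neutral_right) auto
      then show ?thesis by simp
    qed (auto simp: indicator_def)
  qed
  also have "\<dots> = level K y + (\<integral>\<^sup>+s. indicator {0..} s * (if ennreal s < ?N then 1 else 0) \<partial>lborel)"
    unfolding level_def by (rule nn_integral_add) measurable
  also have "\<dots> \<le> level K y + ?N" by (intro add_left_mono nn_integral_below)
  finally show ?thesis .
qed

lemma level_le_supsum: "finite K \<Longrightarrow> level K y \<le> supsum K y"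
  using level_le_level_add_supsum[of K "{}" y] by (simp add: level_empty)

lemma cell_sup_pos: "0 < cell_sup y k"
proof -
  have "ennreal (exp (y (k + 0))) \<le> cell_sup y k" unfolding cell_sup_def by (rule SUP_upper[OF zero_in_P])
  then show ?thesis by (rule less_le_trans[rotated]) simp
qed

end

section \<open>Sharing the level functional among the cells\<close>

text \<open>Here \<open>q / n\<close> is the quotient of the level functional by the sum of suprema. When cells with total
supremum \<open>r\<close> are added, the numerator grows by at most \<open>r\<close> and the denominator by exactly \<open>r\<close>;
because \<open>q \<le> n\<close>, both effects are at most \<open>r / (n + r)\<close>.\<close>

lemma ratio_increment:
  fixes a n q q' r :: real
  assumes "0 < a" "a \<le> n" "0 \<le> r" "0 \<le> q" "q \<le> n" "q \<le> q'" "q' \<le> q + r"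
  shows "a * q' / (n + r) \<le> a * q / n + a * r / (n + r)"
    and "a * q / n \<le> a * q' / (n + r) + a * r / (n + r)"
proof -
  have n: "0 < n" "0 < n + r" using assms by linarith+
  have "a * q' / (n + r) \<le> a * (q + r) / (n + r)" using assms n by (intro divide_right_mono mult_left_mono) auto
  also have "\<dots> = a * q / (n + r) + a * r / (n + r)" by (simp add: distrib_left add_divide_distrib)
  also have "a * q / (n + r) \<le> a * q / n" using assms n by (intro divide_left_mono) auto
  finally show "a * q' / (n + r) \<le> a * q / n + a * r / (n + r)" by simp
  have "a * q / n - a * q / (n + r) = (q / n) * (a * r / (n + r))" using n by (simp add: field_simps)
  also have "\<dots> \<le> 1 * (a * r / (n + r))" using assms n by (intro mult_right_mono) (auto simp: divide_simps)
  finally have "a * q / n \<le> a * q / (n + r) + a * r / (n + r)" by simp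
  also have "a * q / (n + r) \<le> a * q' / (n + r)" using assms n by (intro divide_right_mono mult_left_mono) auto
  finally show "a * q / n \<le> a * q' / (n + r) + a * r / (n + r)" by simp
qed

lemma ratio_increment_min:
  fixes a n :: real and s :: "'i \<Rightarrow> real"
  assumes "0 < a" "a \<le> n" "finite I" "\<And>i. i \<in> I \<Longrightarrow> 0 \<le> s i"
  shows "a * (\<Sum>i\<in>I. s i) / (n + (\<Sum>i\<in>I. s i)) \<le> (\<Sum>i\<in>I. min a (s i))"
proof -
  let ?r = "\<Sum>i\<in>I. s i"
  have r: "0 \<le> ?r" using assms by (intro sum_nonneg) auto
  have "a * ?r / (n + ?r) = (\<Sum>i\<in>I. a * s i / (n + ?r))" by (simp add: sum_distrib_left sum_divide_distrib)
  also have "\<dots> \<le> (\<Sum>i\<in>I. min a (s i))"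
  proof (rule sum_mono)
    fix i assume i: "i \<in> I"
    have "s i \<le> ?r" using assms i by (intro member_le_sum) auto
    then have "s i \<le> n + ?r" "a \<le> n + ?r" using assms r by linarith+
    then have "a * s i \<le> a * (n + ?r)" "s i * a \<le> s i * (n + ?r)"
      using assms(1) assms(4)[OF i] by (auto intro: mult_left_mono)
    then show "a * s i / (n + ?r) \<le> min a (s i)" using assms r by (simp add: pos_divide_le_eq mult.commute)
  qed
  finally show ?thesis .
qed

locale tilted_cells = gaussian_field M V + cell \<kappa> P \<pi> x
  for M :: "'a measure" and V :: "'t :: ab_group_add \<Rightarrow> 'a \<Rightarrow> real" and \<kappa> :: "'t measure" and P \<pi> x +
  assumes sup_integrable: "(\<integral>\<^sup>+\<omega>. cell_sup (\<lambda>t. logZ t \<omega>) 0 \<partial>M) < \<infinity>"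
begin

abbreviation path :: "'a \<Rightarrow> 't \<Rightarrow> real" where "path \<omega> \<equiv> (\<lambda>t. logZ t \<omega>)"

definition mean_level :: "'t set \<Rightarrow> ennreal" where
  "mean_level K = (\<integral>\<^sup>+\<omega>. level K (path \<omega>) \<partial>M)"

text \<open>The mean share of the cell at the origin when the level functional is distributed among the cells
in proportion to their suprema.\<close>

definition cell_share :: "'t set \<Rightarrow> ennreal" where
  "cell_share K = (\<integral>\<^sup>+\<omega>. cell_sup (path \<omega>) 0 * (level K (path \<omega>) / supsum K (path \<omega>)) \<partial>M)"

lemma path_measurable:
  assumes "F \<in> borel_measurable (Pi\<^sub>M UNIV (\<lambda>_. borel))"
  shows "(\<lambda>\<omega>. F (path \<omega>)) \<in> borel_measurable M"
proof (rule measurable_compose[OF _ assms])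
  show "path \<in> measurable M (Pi\<^sub>M UNIV (\<lambda>_. borel))"
    by (rule measurable_PiM_single') (auto simp: space_PiM)
qed

lemma cell_sup_path_measurable[measurable]: "(\<lambda>\<omega>. cell_sup (path \<omega>) k) \<in> borel_measurable M"
  by (rule path_measurable[OF cell_sup_measurable]) simp

lemma level_path_measurable[measurable]: "(\<lambda>\<omega>. level K (path \<omega>)) \<in> borel_measurable M"
  by (rule path_measurable[OF level_measurable]) simp

lemma tilt_path:
  assumes "F \<in> borel_measurable (Pi\<^sub>M UNIV (\<lambda>_. borel))"
  shows "(\<integral>\<^sup>+\<omega>. ennreal (exp (logZ h \<omega>)) * F (\<lambda>t. path \<omega> (t + h) - logZ h \<omega>) \<partial>M) = (\<integral>\<^sup>+\<omega>. F (path \<omega>) \<partial>M)"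
  using tilt_nn_integral[OF assms, of h] by (simp add: restrict_UNIV)

lemma cell_sup_mean: "(\<integral>\<^sup>+\<omega>. cell_sup (path \<omega>) h \<partial>M) = (\<integral>\<^sup>+\<omega>. cell_sup (path \<omega>) 0 \<partial>M)"
proof -
  have m: "(\<lambda>y. cell_sup y 0) \<in> borel_measurable (Pi\<^sub>M UNIV (\<lambda>_. borel))" by (rule cell_sup_measurable) simp
  have shift: "cell_sup (\<lambda>t. path \<omega> (t + h) - logZ h \<omega>) 0 = ennreal (exp (- logZ h \<omega>)) * cell_sup (path \<omega>) h" for \<omega>
    using cell_sup_shift[of "path \<omega>" h "logZ h \<omega>" 0] by simp
  show ?thesis
    unfolding tilt_path[OF m, of h, symmetric] shift
    by (simp flip: mult.assoc ennreal_mult exp_add)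
qed

lemma cell_sup_finite: "AE \<omega> in M. cell_sup (path \<omega>) k \<noteq> \<infinity>"
  using sup_integrable cell_sup_mean[of k] by (intro nn_integral_noteq_infinite) auto

lemma supsum_pos: "finite K \<Longrightarrow> K \<noteq> {} \<Longrightarrow> 0 < supsum K y"
  using cell_sup_pos by (simp add: zero_less_iff_neq_zero)

text \<open>By homogeneity, \<open>S\<^sub>h Q(K) / \<Sum>S\<^sub>k\<close> is \<open>exp(logZ h)\<close> times a functional of the recentred path
\<open>logZ (\<cdot> + h) - logZ h\<close>, and the tilt gives this path the law of \<open>logZ\<close>.\<close>

lemma cell_share_tilted:
  assumes "finite K"
  shows "(\<integral>\<^sup>+\<omega>. cell_sup (path \<omega>) h * (level K (path \<omega>) / supsum K (path \<omega>)) \<partial>M) = cell_share ((\<lambda>k. k - h) ` K)"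
proof -
  let ?K = "(\<lambda>k. k - h) ` K"
  let ?F = "\<lambda>y. cell_sup y 0 * (level ?K y / supsum ?K y)"
  have [measurable]: "(\<lambda>y. cell_sup y k) \<in> borel_measurable (Pi\<^sub>M UNIV (\<lambda>_. borel))" for k
    by (rule cell_sup_measurable) simp
  have [measurable]: "level K \<in> borel_measurable (Pi\<^sub>M UNIV (\<lambda>_. borel))" for K
    by (rule level_measurable) simp
  have m: "?F \<in> borel_measurable (Pi\<^sub>M UNIV (\<lambda>_. borel))" by measurable
  have K: "(\<lambda>k. k + h) ` ?K = K" by (simp add: image_image)
  have s: "supsum ?K (\<lambda>t. y (t + h) - c) = ennreal (exp (- c)) * supsum K y" for y c
    by (subst sum.reindex) (auto simp: inj_on_def cell_sup_shift sum_distrib_left)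
  have canc: "ennreal (exp c) * (ennreal (exp (- c)) * a * (ennreal (exp (- c)) * b / (ennreal (exp (- c)) * d))) = a * (b / d)" for a b c d
  proof -
    have "ennreal (exp (- c)) * b / (ennreal (exp (- c)) * d) = b / d"
      using divide_mult_eq[of "ennreal (exp (- c))" b d] by (simp add: mult.commute)
    then show ?thesis by (simp flip: mult.assoc ennreal_mult exp_add)
  qed
  have c: "cell_sup (\<lambda>t. path \<omega> (t + h) - logZ h \<omega>) 0 = ennreal (exp (- logZ h \<omega>)) * cell_sup (path \<omega>) h" for \<omega>
    using cell_sup_shift[of "path \<omega>" h "logZ h \<omega>" 0] by simp
  have l: "level ?K (\<lambda>t. path \<omega> (t + h) - logZ h \<omega>) = ennreal (exp (- logZ h \<omega>)) * level K (path \<omega>)" for \<omega>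
    using level_shift[of ?K "path \<omega>" h "logZ h \<omega>"] assms K by simp
  have "(\<integral>\<^sup>+\<omega>. ?F (path \<omega>) \<partial>M) = (\<integral>\<^sup>+\<omega>. cell_sup (path \<omega>) h * (level K (path \<omega>) / supsum K (path \<omega>)) \<partial>M)"
    unfolding tilt_path[OF m, of h, symmetric]
    by (intro nn_integral_cong) (simp only: c l s[of "path _"] canc)
  then show ?thesis unfolding cell_share_def by simp
qed

text \<open>The shares add up to the level functional because the sum of suprema is positive and almost surely
finite.\<close>

lemma mean_level_eq_sum:
  assumes "finite K"
  shows "mean_level K = (\<Sum>h\<in>K. cell_share ((\<lambda>k. k - h) ` K))"
proof (cases "K = {}")
  case True
  then show ?thesis by (simp add: mean_level_def level_empty)
next
  case False
  have "AE \<omega> in M. \<forall>k\<in>K. cell_sup (path \<omega>) k \<noteq> \<infinity>"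
    using assms cell_sup_finite by (simp add: AE_finite_all)
  then have "AE \<omega> in M. level K (path \<omega>) = (\<Sum>h\<in>K. cell_sup (path \<omega>) h * (level K (path \<omega>) / supsum K (path \<omega>)))"
  proof eventually_elim
    case (elim \<omega>)
    have "supsum K (path \<omega>) \<noteq> \<infinity>" using elim assms by simp
    moreover have "supsum K (path \<omega>) \<noteq> 0" using supsum_pos[OF assms False, of "path \<omega>"] by simp
    ultimately have "level K (path \<omega>) = supsum K (path \<omega>) * (level K (path \<omega>) / supsum K (path \<omega>))"
      by (subst ennreal_times_divide, subst mult.commute, subst mult_divide_eq_ennreal) auto
    then show ?case by (simp only: sum_distrib_right)
  qed
  then have "mean_level K = (\<integral>\<^sup>+\<omega>. (\<Sum>h\<in>K. cell_sup (path \<omega>) h * (level K (path \<omega>) / supsum K (path \<omega>))) \<partial>M)"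
    unfolding mean_level_def by (rule nn_integral_cong_AE)
  also have "\<dots> = (\<Sum>h\<in>K. \<integral>\<^sup>+\<omega>. cell_sup (path \<omega>) h * (level K (path \<omega>) / supsum K (path \<omega>)) \<partial>M)"
    by (rule nn_integral_sum) measurable
  finally show ?thesis using cell_share_tilted[OF assms] by simp
qed

text \<open>The level functional never exceeds the sum of suprema, so the quotient is at most 1.\<close>

lemma cell_share_le:
  assumes "finite K"
  shows "cell_share K \<le> (\<integral>\<^sup>+\<omega>. cell_sup (path \<omega>) 0 \<partial>M)"
  unfolding cell_share_def
proof (rule nn_integral_mono)
  fix \<omega>
  have "level K (path \<omega>) / supsum K (path \<omega>) \<le> 1"
  proof (cases "supsum K (path \<omega>) = 0")
    case True
    then have "level K (path \<omega>) = 0" using level_le_supsum[OF assms, of "path \<omega>"] by simp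
    then show ?thesis by simp
  next
    case False
    then show ?thesis using level_le_supsum[OF assms, of "path \<omega>"]
      by (intro divide_le_posI_ennreal) (simp_all only: zero_less_iff_neq_zero mult_1_right not_False_eq_True)
  qed
  from mult_left_mono[OF this, of "cell_sup (path \<omega>) 0"]
  show "cell_sup (path \<omega>) 0 * (level K (path \<omega>) / supsum K (path \<omega>)) \<le> cell_sup (path \<omega>) 0" by simp
qed

definition overlap :: "'t \<Rightarrow> ennreal" where
  "overlap k = (\<integral>\<^sup>+\<omega>. min (cell_sup (path \<omega>) 0) (cell_sup (path \<omega>) k) \<partial>M)"

text \<open>Pointwise, \<open>ratio_increment\<close> bounds the change by \<open>S\<^sub>0 r / (n + r)\<close> with \<open>r\<close> the sum of the new
suprema, and each summand \<open>S\<^sub>0 S\<^sub>k / (n + r)\<close> is at most \<open>min S\<^sub>0 S\<^sub>k\<close>. The suprema are almost surely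
finite, so the computation may be done in the reals.\<close>

lemma cell_share_compare:
  assumes "finite K'" "K \<subseteq> K'" "0 \<in> K"
  shows "cell_share K' \<le> cell_share K + (\<Sum>k\<in>K' - K. overlap k)"
    and "cell_share K \<le> cell_share K' + (\<Sum>k\<in>K' - K. overlap k)"
proof -
  have fK: "finite K" using assms finite_subset by auto
  define g where "g K \<omega> = cell_sup (path \<omega>) 0 * (level K (path \<omega>) / supsum K (path \<omega>))" for K \<omega>
  define m where "m k \<omega> = min (cell_sup (path \<omega>) 0) (cell_sup (path \<omega>) k)" for k \<omega>
  have [measurable]: "g K \<in> borel_measurable M" "m k \<in> borel_measurable M" for K k
    unfolding g_def m_def by measurable
  have "AE \<omega> in M. \<forall>k\<in>K'. cell_sup (path \<omega>) k \<noteq> \<infinity>"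
    using assms cell_sup_finite by (simp add: AE_finite_all)
  then have AE: "AE \<omega> in M. g K' \<omega> \<le> g K \<omega> + (\<Sum>k\<in>K' - K. m k \<omega>) \<and> g K \<omega> \<le> g K' \<omega> + (\<Sum>k\<in>K' - K. m k \<omega>)"
  proof eventually_elim
    case (elim \<omega>)
    define s where "s k = enn2real (cell_sup (path \<omega>) k)" for k
    have s: "cell_sup (path \<omega>) k = ennreal (s k)" if "k \<in> K'" for k
      using elim that unfolding s_def by (simp add: less_top)
    have s0: "0 \<le> s k" for k by (simp add: s_def)
    have a0: "0 < s 0" using s[of 0] cell_sup_pos[of "path \<omega>" 0] assms by auto
    have N: "supsum J (path \<omega>) = ennreal (\<Sum>k\<in>J. s k)" if "J \<subseteq> K'" for J
    proof -
      have "supsum J (path \<omega>) = (\<Sum>k\<in>J. ennreal (s k))" using that s by (intro sum.cong) auto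
      then show ?thesis using s0 by (simp only: sum_ennreal)
    qed
    define q where "q J = enn2real (level J (path \<omega>))" for J
    have q: "level J (path \<omega>) = ennreal (q J)" "q J \<le> (\<Sum>k\<in>J. s k)" if "J \<subseteq> K'" for J
    proof -
      have "level J (path \<omega>) \<le> ennreal (\<Sum>k\<in>J. s k)"
        using level_le_supsum[of J "path \<omega>"] N[OF that] finite_subset[OF that assms(1)] by simp
      moreover from this have "level J (path \<omega>) < top" by (rule le_less_trans) simp
      ultimately show "level J (path \<omega>) = ennreal (q J)" "q J \<le> (\<Sum>k\<in>J. s k)"
        using s0 unfolding q_def by (auto intro!: enn2real_leI sum_nonneg)
    qed
    have q0: "0 \<le> q J" for J by (simp add: q_def)
    define r where "r = (\<Sum>k\<in>K' - K. s k)"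
    have r0: "0 \<le> r" unfolding r_def using s0 by (intro sum_nonneg) auto
    define n where "n = (\<Sum>k\<in>K. s k)"
    have an: "s 0 \<le> n" unfolding n_def using assms fK s0 by (intro member_le_sum) auto
    have n': "(\<Sum>k\<in>K'. s k) = n + r" unfolding n_def r_def
      using sum.subset_diff[OF assms(2) assms(1), of s] by simp
    have qq: "q K \<le> q K'"
      using level_mono[OF assms(1,2), of "path \<omega>"] q(1)[of K] q(1)[of K'] assms q0 by simp
    have qr: "q K' \<le> q K + r"
    proof -
      have "ennreal (q K') \<le> ennreal (q K) + ennreal r"
        using level_le_level_add_supsum[OF assms(1,2), of "path \<omega>"] q(1)[of K] q(1)[of K'] N[of "K' - K"] assms
        by (simp add: r_def)
      then show ?thesis using q0 r0 by (simp flip: ennreal_plus)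
    qed
    have n0: "0 < n" "0 < n + r" using a0 an r0 by linarith+
    have gg: "g K \<omega> = ennreal (s 0 * q K / n)" "g K' \<omega> = ennreal (s 0 * q K' / (n + r))"
    proof -
      have "g J \<omega> = ennreal (s 0 * q J / d)" if "J \<subseteq> K'" "(\<Sum>k\<in>J. s k) = d" "0 < d" for J d
      proof -
        have "g J \<omega> = ennreal (s 0) * (ennreal (q J) / ennreal d)"
          unfolding g_def using s[of 0] q(1)[OF that(1)] N[OF that(1)] that(2) assms by auto
        then show ?thesis using that(3) q0[of J] s0 by (simp add: divide_ennreal flip: ennreal_mult)
      qed
      from this[of K n] this[of K' "n + r"] n0 n' assms(2) n_def show
        "g K \<omega> = ennreal (s 0 * q K / n)" "g K' \<omega> = ennreal (s 0 * q K' / (n + r))" by auto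
    qed
    have mm: "(\<Sum>k\<in>K' - K. m k \<omega>) = ennreal (\<Sum>k\<in>K' - K. min (s 0) (s k))"
    proof -
      have "(\<Sum>k\<in>K' - K. m k \<omega>) = (\<Sum>k\<in>K' - K. ennreal (min (s 0) (s k)))"
      proof (rule sum.cong[OF refl])
        fix k assume "k \<in> K' - K"
        then have "cell_sup (path \<omega>) k = ennreal (s k)" "cell_sup (path \<omega>) 0 = ennreal (s 0)" using s assms by auto
        then show "m k \<omega> = ennreal (min (s 0) (s k))" using s0 by (simp only: m_def min_ennreal)
      qed
      then show ?thesis using s0 by (simp add: sum_ennreal)
    qed
    have b: "s 0 * r / (n + r) \<le> (\<Sum>k\<in>K' - K. min (s 0) (s k))"
      unfolding r_def by (rule ratio_increment_min[OF a0 an]) (use assms s0 in auto)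
    have pos: "0 \<le> s 0 * q K / n" "0 \<le> s 0 * q K' / (n + r)" "0 \<le> (\<Sum>k\<in>K' - K. min (s 0) (s k))"
      using s0 q0 an a0 r0 by (auto intro!: sum_nonneg)
    show ?case
      unfolding gg mm ennreal_plus[OF pos(1,3), symmetric] ennreal_plus[OF pos(2,3), symmetric]
      using ratio_increment[OF a0 an r0 q0[of K] q(2)[OF assms(2), folded n_def] qq qr] b
      by (auto intro!: ennreal_leI)
  qed
  have "cell_share K' \<le> (\<integral>\<^sup>+\<omega>. g K \<omega> + (\<Sum>k\<in>K' - K. m k \<omega>) \<partial>M)"
    unfolding cell_share_def g_def[symmetric] by (rule nn_integral_mono_AE) (use AE in auto)
  also have "\<dots> = cell_share K + (\<Sum>k\<in>K' - K. overlap k)"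
    unfolding cell_share_def g_def[symmetric] overlap_def m_def[symmetric]
    by (subst nn_integral_add) (auto simp: nn_integral_sum)
  finally show "cell_share K' \<le> cell_share K + (\<Sum>k\<in>K' - K. overlap k)" .
  have "cell_share K \<le> (\<integral>\<^sup>+\<omega>. g K' \<omega> + (\<Sum>k\<in>K' - K. m k \<omega>) \<partial>M)"
    unfolding cell_share_def g_def[symmetric] by (rule nn_integral_mono_AE) (use AE in auto)
  also have "\<dots> = cell_share K' + (\<Sum>k\<in>K' - K. overlap k)"
    unfolding cell_share_def g_def[symmetric] overlap_def m_def[symmetric]
    by (subst nn_integral_add) (auto simp: nn_integral_sum)
  finally show "cell_share K \<le> cell_share K' + (\<Sum>k\<in>K' - K. overlap k)" .
qed

end

section \<open>Fluctuations inside a cell: chaining\<close>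

text \<open>Jensen's inequality for \<open>exp\<close> with the weights \<open>(1 - r) r^n\<close>; the missing weight \<open>r^N\<close> is put on 0.\<close>

lemma exp_weighted_sum_le:
  fixes r :: real and y :: "nat \<Rightarrow> real"
  assumes "0 < r" "r < 1"
  shows "exp (\<Sum>n<N. (1 - r) * r ^ n * y n) \<le> 1 + (\<Sum>n<N. (1 - r) * r ^ n * exp (y n))"
proof -
  define a where "a n = (if n < N then (1 - r) * r ^ n else r ^ N)" for n
  define z where "z n = (if n < N then y n else 0)" for n
  have ex: "{..N} = insert N {..<N}" by auto
  have s1: "sum a {..N} = 1"
  proof -
    have "sum a {..N} = r ^ N + (\<Sum>n<N. (1 - r) * r ^ n)" unfolding ex by (simp add: a_def)
    also have "(\<Sum>n<N. (1 - r) * r ^ n) = 1 - r ^ N"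
      by (induction N) (simp_all add: algebra_simps)
    finally show ?thesis by simp
  qed
  have "convex_on UNIV (exp :: real \<Rightarrow> real)" by (rule exp_convex)
  then have "exp (\<Sum>n\<le>N. a n *\<^sub>R z n) \<le> (\<Sum>n\<le>N. a n * exp (z n))"
    by (rule convex_on_sum[rotated 2]) (use assms s1 in \<open>auto simp: a_def\<close>)
  moreover have e: "(\<Sum>n\<le>N. a n *\<^sub>R z n) = (\<Sum>n<N. (1 - r) * r ^ n * y n)"
    "(\<Sum>n\<le>N. a n * exp (z n)) = r ^ N + (\<Sum>n<N. (1 - r) * r ^ n * exp (y n))"
    unfolding ex by (simp_all add: a_def z_def)
  moreover have "r ^ N \<le> 1" using assms by (simp add: power_le_one)
  ultimately show ?thesis unfolding e by simp
qed

lemma sum_geometric_mean_le: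
  fixes r :: real assumes "0 < r" "r < 1"
  shows "(\<Sum>n<N. (1 - r) * r ^ n * real n) \<le> 1 / (1 - r)"
proof -
  have s: "(\<lambda>n. real (Suc n) * r ^ n) sums (1 / (1 - r)\<^sup>2)" using geometric_deriv_sums[of r] assms by simp
  have "(\<Sum>n<N. (1 - r) * r ^ n * real n) \<le> (\<Sum>n<N. (1 - r) * (real (Suc n) * r ^ n))"
    using assms by (intro sum_mono) (simp add: algebra_simps)
  also have "\<dots> = (1 - r) * (\<Sum>n<N. real (Suc n) * r ^ n)" by (simp add: sum_distrib_left)
  also have "\<dots> \<le> (1 - r) * (1 / (1 - r)\<^sup>2)"
    using sum_le_suminf[OF sums_summable[OF s], of "{..<N}"] assms s by (intro mult_left_mono) (auto simp: sums_iff)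
  also have "\<dots> = 1 / (1 - r)" using assms by (simp add: power2_eq_square)
  finally show ?thesis .
qed

text \<open>The exponent is written as an average of \<open>q a\<^sub>n / \<theta>\<^sub>n\<close> with weights \<open>\<theta>\<^sub>n = (1 - r) r^n\<close>. Subtracting
\<open>n ln b\<close> from the \<open>n\<close>-th term costs only the constant \<open>exp(ln b / (1 - r))\<close>, and gains a factor
\<open>b^(-n)\<close> which will compensate the number of points in the \<open>n\<close>-th net.\<close>

lemma exp_chain_le:
  fixes r b q :: real and a :: "nat \<Rightarrow> real"
  assumes r: "0 < r" "r < 1" and b: "1 \<le> b"
  shows "exp (q * (\<Sum>n<N. a n)) \<le> exp (ln b / (1 - r)) *
    (1 + (\<Sum>n<N. (1 - r) * r ^ n / b ^ n * exp (q * a n / ((1 - r) * r ^ n))))"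
proof -
  define y where "y n = q * a n / ((1 - r) * r ^ n) - real n * ln b" for n
  have "q * (\<Sum>n<N. a n) = (\<Sum>n<N. (1 - r) * r ^ n * y n + ln b * ((1 - r) * r ^ n * real n))"
    unfolding sum_distrib_left y_def using r by (intro sum.cong refl) (simp add: field_simps)
  also have "\<dots> = (\<Sum>n<N. (1 - r) * r ^ n * y n) + ln b * (\<Sum>n<N. (1 - r) * r ^ n * real n)"
    by (simp add: sum.distrib sum_distrib_left)
  also have "ln b * (\<Sum>n<N. (1 - r) * r ^ n * real n) \<le> ln b * (1 / (1 - r))"
    using b by (intro mult_left_mono sum_geometric_mean_le r) auto
  finally have "exp (q * (\<Sum>n<N. a n)) \<le> exp (ln b / (1 - r)) * exp (\<Sum>n<N. (1 - r) * r ^ n * y n)"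
    by (simp flip: exp_add add: add.commute)
  also have "\<dots> \<le> exp (ln b / (1 - r)) * (1 + (\<Sum>n<N. (1 - r) * r ^ n * exp (y n)))"
    by (intro mult_left_mono exp_weighted_sum_le r) auto
  also have "(\<Sum>n<N. (1 - r) * r ^ n * exp (y n)) = (\<Sum>n<N. (1 - r) * r ^ n / b ^ n * exp (q * a n / ((1 - r) * r ^ n)))"
    using b by (intro sum.cong refl) (simp add: y_def exp_diff exp_of_nat_mult)
  finally show ?thesis .
qed

context gaussian_field
begin

text \<open>The increment from \<open>k\<close> to \<open>k + p\<close> is the sum of the increments between successive projections
\<open>\<rho> n p\<close> and \<open>\<rho> (n+1) p\<close>. The \<open>n\<close>-th of these has variance at most \<open>A r^(2n)\<close> and is one of at most
\<open>B b^n\<close> Gaussian variables, so after division by \<open>\<theta>\<^sub>n\<close> its exponential moments are bounded uniformly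
in \<open>n\<close>. Bounding the maximum over a net by the sum gives a series \<open>R\<close> that dominates all points at
once and has finite mean.\<close>

lemma chaining:
  fixes \<rho> :: "nat \<Rightarrow> 't \<Rightarrow> 't" and Q :: "nat \<Rightarrow> 't set"
  assumes r: "0 < r" "r < 1" and b: "1 \<le> b" and B: "0 \<le> B" and q: "0 \<le> q"
    and fin: "\<And>n. finite (Q n)" and card: "\<And>n. real (card (Q (Suc n))) \<le> B * b ^ n"
    and 0: "\<And>p. p \<in> P \<Longrightarrow> \<rho> 0 p = 0" and stab: "\<And>p. p \<in> P \<Longrightarrow> \<exists>N. \<rho> N p = p"
    and net: "\<And>p n. p \<in> P \<Longrightarrow> \<rho> (Suc n) p \<in> Q (Suc n)"
    and proj: "\<And>p n. p \<in> P \<Longrightarrow> \<rho> n (\<rho> (Suc n) p) = \<rho> n p"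
    and var: "\<And>n t. t \<in> Q (Suc n) \<Longrightarrow> var_fn M V (t - \<rho> n t) \<le> A * (r ^ n)\<^sup>2"
  shows "(\<integral>\<^sup>+\<omega>. (SUP p\<in>P. ennreal (exp (q * \<bar>V (k + p) \<omega> - V k \<omega>\<bar>))) \<partial>M)
    \<le> ennreal (exp (ln b / (1 - r)) * (1 + 2 * B * exp (q\<^sup>2 * A / (2 * (1 - r)\<^sup>2))))"
proof -
  define \<theta> where "\<theta> n = (1 - r) * r ^ n" for n
  have \<theta>: "0 < \<theta> n" for n using r by (simp add: \<theta>_def)
  define D where "D n t \<omega> = V (k + t) \<omega> - V (k + \<rho> n t) \<omega>" for n t \<omega>
  define E where "E n t \<omega> = exp (q / \<theta> n * D n t \<omega>) + exp (- q / \<theta> n * D n t \<omega>)" for n t \<omega>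
  have D: "D n t \<in> gspan" for n t unfolding D_def[abs_def] by (rule gspan_diff[OF gspan_V gspan_V])
  note [measurable] = gspan_measurable[OF D]
  have [measurable]: "E n t \<in> borel_measurable M" for n t unfolding E_def[abs_def] by measurable
  have E0: "0 \<le> E n t \<omega>" for n t \<omega> by (simp add: E_def add_nonneg_nonneg)
  define R where "R \<omega> = ennreal (exp (ln b / (1 - r))) *
     (1 + (\<Sum>n. ennreal (\<theta> n / b ^ n) * (\<Sum>t\<in>Q (Suc n). ennreal (E n t \<omega>))))" for \<omega>
  have point: "ennreal (exp (q * \<bar>V (k + p) \<omega> - V k \<omega>\<bar>)) \<le> R \<omega>" if p: "p \<in> P" for p \<omega>
  proof -
    obtain N where N: "\<rho> N p = p" using stab[OF p] by auto
    define a where "a n = \<bar>V (k + \<rho> (Suc n) p) \<omega> - V (k + \<rho> n p) \<omega>\<bar>" for n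
    have "V (k + p) \<omega> - V k \<omega> = (\<Sum>n<N. V (k + \<rho> (Suc n) p) \<omega> - V (k + \<rho> n p) \<omega>)"
      using N 0[OF p] sum_lessThan_telescope[of "\<lambda>n. V (k + \<rho> n p) \<omega>" N] by simp
    then have "\<bar>V (k + p) \<omega> - V k \<omega>\<bar> \<le> (\<Sum>n<N. a n)" unfolding a_def by simp
    then have "exp (q * \<bar>V (k + p) \<omega> - V k \<omega>\<bar>) \<le> exp (q * (\<Sum>n<N. a n))"
      using q by (simp add: mult_left_mono)
    also have "\<dots> \<le> exp (ln b / (1 - r)) * (1 + (\<Sum>n<N. \<theta> n / b ^ n * exp (q * a n / \<theta> n)))"
      using exp_chain_le[OF r b] unfolding \<theta>_def .
    also have "\<dots> \<le> exp (ln b / (1 - r)) * (1 + (\<Sum>n<N. \<theta> n / b ^ n * (\<Sum>t\<in>Q (Suc n). E n t \<omega>)))"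
    proof (intro mult_left_mono add_left_mono sum_mono)
      fix n
      have "a n = \<bar>D n (\<rho> (Suc n) p) \<omega>\<bar>" unfolding a_def D_def proj[OF p] ..
      then have "exp (q * a n / \<theta> n) \<le> E n (\<rho> (Suc n) p) \<omega>"
        by (simp add: E_def abs_if add_increasing add_increasing2)
      also have "\<dots> \<le> (\<Sum>t\<in>Q (Suc n). E n t \<omega>)"
        by (rule member_le_sum[OF net[OF p]]) (use E0 fin in auto)
      finally show "exp (q * a n / \<theta> n) \<le> (\<Sum>t\<in>Q (Suc n). E n t \<omega>)" .
    qed (use \<theta> b in \<open>auto simp: less_imp_le\<close>)
    finally have "ennreal (exp (q * \<bar>V (k + p) \<omega> - V k \<omega>\<bar>)) \<le>
      ennreal (exp (ln b / (1 - r)) * (1 + (\<Sum>n<N. \<theta> n / b ^ n * (\<Sum>t\<in>Q (Suc n). E n t \<omega>))))"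
      by (rule ennreal_leI)
    also have "\<dots> = ennreal (exp (ln b / (1 - r))) *
       (1 + (\<Sum>n<N. ennreal (\<theta> n / b ^ n) * (\<Sum>t\<in>Q (Suc n). ennreal (E n t \<omega>))))"
    proof -
      have S: "(\<Sum>t\<in>Q (Suc n). ennreal (E n t \<omega>)) = ennreal (\<Sum>t\<in>Q (Suc n). E n t \<omega>)"
        "0 \<le> (\<Sum>t\<in>Q (Suc n). E n t \<omega>)" for n
        using E0 by (auto intro: sum_ennreal sum_nonneg)
      have c0: "0 \<le> \<theta> n / b ^ n" for n using \<theta>[of n] b by simp
      have "(\<Sum>n<N. ennreal (\<theta> n / b ^ n) * (\<Sum>t\<in>Q (Suc n). ennreal (E n t \<omega>)))
        = (\<Sum>n<N. ennreal (\<theta> n / b ^ n * (\<Sum>t\<in>Q (Suc n). E n t \<omega>)))"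
        using S c0 by (intro sum.cong refl) (simp only: ennreal_mult)
      also have "\<dots> = ennreal (\<Sum>n<N. \<theta> n / b ^ n * (\<Sum>t\<in>Q (Suc n). E n t \<omega>))"
        using S(2) c0 by (intro sum_ennreal mult_nonneg_nonneg)
      finally have e: "(\<Sum>n<N. ennreal (\<theta> n / b ^ n) * (\<Sum>t\<in>Q (Suc n). ennreal (E n t \<omega>)))
        = ennreal (\<Sum>n<N. \<theta> n / b ^ n * (\<Sum>t\<in>Q (Suc n). E n t \<omega>))" .
      have "0 \<le> (\<Sum>n<N. \<theta> n / b ^ n * (\<Sum>t\<in>Q (Suc n). E n t \<omega>))"
        using E0 c0 by (intro sum_nonneg mult_nonneg_nonneg)
      then show ?thesis unfolding e by (simp only: ennreal_mult exp_ge_zero add_nonneg_nonneg zero_le_one ennreal_plus ennreal_1)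
    qed
    also have "\<dots> \<le> R \<omega>" unfolding R_def
      by (intro mult_left_mono add_left_mono sum_le_suminf) auto
    finally show ?thesis .
  qed
  define H where "H = exp (q\<^sup>2 * A / (2 * (1 - r)\<^sup>2))"
  have mgf: "(\<integral>\<^sup>+\<omega>. ennreal (exp (c / \<theta> n * D n t \<omega>)) \<partial>M) \<le> ennreal H" if t: "t \<in> Q (Suc n)" and c: "c\<^sup>2 = q\<^sup>2" for n t c
  proof -
    have "E2 (D n t) = var_fn M V (t - \<rho> n t)"
      using E2_increment[of "t - \<rho> n t" "k + \<rho> n t"] unfolding D_def by (simp add: algebra_simps)
    then have "(c / \<theta> n)\<^sup>2 * E2 (D n t) / 2 \<le> (c / \<theta> n)\<^sup>2 * (A * (r ^ n)\<^sup>2) / 2"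
      using var[OF t] by (intro divide_right_mono mult_left_mono) auto
    also have "\<dots> = q\<^sup>2 * A / (2 * (1 - r)\<^sup>2)"
      using r c by (simp add: \<theta>_def power_divide power_mult_distrib)
    finally show ?thesis
      unfolding gspan_moments(3)[OF gspan_scale[OF D]] E2_scale H_def by (intro ennreal_leI) simp
  qed
  have EH: "(\<integral>\<^sup>+\<omega>. ennreal (E n t \<omega>) \<partial>M) \<le> ennreal (2 * H)" if t: "t \<in> Q (Suc n)" for n t
  proof -
    have "(\<integral>\<^sup>+\<omega>. ennreal (E n t \<omega>) \<partial>M) =
      (\<integral>\<^sup>+\<omega>. ennreal (exp (q / \<theta> n * D n t \<omega>)) \<partial>M) + (\<integral>\<^sup>+\<omega>. ennreal (exp (- q / \<theta> n * D n t \<omega>)) \<partial>M)"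
      unfolding E_def by (subst nn_integral_add[symmetric]) auto
    also have "\<dots> \<le> ennreal H + ennreal H" by (intro add_mono mgf t) auto
    also have "\<dots> = ennreal (2 * H)" by (simp add: H_def flip: ennreal_plus)
    finally show ?thesis .
  qed
  have "(\<integral>\<^sup>+\<omega>. (SUP p\<in>P. ennreal (exp (q * \<bar>V (k + p) \<omega> - V k \<omega>\<bar>))) \<partial>M) \<le> (\<integral>\<^sup>+\<omega>. R \<omega> \<partial>M)"
    by (intro nn_integral_mono SUP_least point)
  also have "\<dots> = ennreal (exp (ln b / (1 - r))) *
      (1 + (\<Sum>n. ennreal (\<theta> n / b ^ n) * (\<Sum>t\<in>Q (Suc n). \<integral>\<^sup>+\<omega>. ennreal (E n t \<omega>) \<partial>M)))"
    unfolding R_def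
    by (simp add: nn_integral_cmult nn_integral_add nn_integral_suminf nn_integral_sum emeasure_space_1)
  also have "\<dots> \<le> ennreal (exp (ln b / (1 - r))) * (1 + (\<Sum>n. ennreal (\<theta> n) * ennreal (2 * B * H)))"
  proof (intro mult_left_mono add_left_mono suminf_le)
    fix n
    have "(\<Sum>t\<in>Q (Suc n). \<integral>\<^sup>+\<omega>. ennreal (E n t \<omega>) \<partial>M) \<le> of_nat (card (Q (Suc n))) * ennreal (2 * H)"
      by (rule sum_bounded_above) (rule EH)
    also have "\<dots> = ennreal (real (card (Q (Suc n))) * (2 * H))"
      by (simp add: ennreal_mult H_def ennreal_of_nat_eq_real_of_nat)
    also have "\<dots> \<le> ennreal (B * b ^ n * (2 * H))"
      using card[of n] by (intro ennreal_leI mult_right_mono) (auto simp: H_def)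
    finally have "ennreal (\<theta> n / b ^ n) * (\<Sum>t\<in>Q (Suc n). \<integral>\<^sup>+\<omega>. ennreal (E n t \<omega>) \<partial>M) \<le>
      ennreal (\<theta> n / b ^ n) * ennreal (B * b ^ n * (2 * H))" by (intro mult_left_mono) auto
    also have "\<dots> = ennreal (\<theta> n) * ennreal (2 * B * H)"
      using \<theta>[of n] b B by (simp add: H_def less_imp_le flip: ennreal_mult)
    finally show "ennreal (\<theta> n / b ^ n) * (\<Sum>t\<in>Q (Suc n). \<integral>\<^sup>+\<omega>. ennreal (E n t \<omega>) \<partial>M) \<le> ennreal (\<theta> n) * ennreal (2 * B * H)" .
  qed auto
  also have "(\<Sum>n. ennreal (\<theta> n) * ennreal (2 * B * H)) = ennreal (2 * B * H)"
  proof -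
    have "\<theta> sums 1" using sums_mult[OF geometric_sums[of r], of "1 - r"] r by (simp add: \<theta>_def[abs_def])
    then have "(\<Sum>n. ennreal (\<theta> n)) = ennreal 1"
      by (rule suminf_ennreal_eq[rotated]) (rule less_imp_le[OF \<theta>])
    then show ?thesis by (simp only: ennreal_suminf_multc ennreal_1 mult_1_left)
  qed
  also have "ennreal (exp (ln b / (1 - r))) * (1 + ennreal (2 * B * H)) = ennreal (exp (ln b / (1 - r)) * (1 + 2 * B * H))"
  proof -
    have "0 \<le> 2 * B * H" using B by (simp add: H_def)
    then show ?thesis by (simp only: ennreal_mult exp_ge_zero add_nonneg_nonneg zero_le_one ennreal_plus ennreal_1)
  qed
  finally show ?thesis unfolding H_def .
qed

text \<open>With \<open>D = V (k + p) - V k\<close>, the inequality \<open>E (V k / 2 + 2 D)\<^sup>2 \<ge> 0\<close> bounds the covariance of \<open>V k\<close> and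
\<open>D\<close> from below.\<close>

lemma var_fn_add_lower: "var_fn M V (k + p) \<ge> 3 / 4 * var_fn M V k - 3 * var_fn M V p"
proof -
  let ?D = "\<lambda>\<omega>. V (k + p) \<omega> - V k \<omega>"
  have D: "?D \<in> gspan" by (rule gspan_diff[OF gspan_V gspan_V])
  have d: "E2 ?D = var_fn M V p" using E2_increment[of p k] by (simp add: add.commute)
  have "0 \<le> E2 (\<lambda>\<omega>. 1 / 2 * V k \<omega> + 2 * ?D \<omega>)" by (rule integral_nonneg_AE) auto
  also have "\<dots> = 1 / 4 * var_fn M V k + 2 * expectation (\<lambda>\<omega>. V k \<omega> * ?D \<omega>) + 4 * var_fn M V p"
  proof -
    have c: "(\<lambda>\<omega>. 1 / 2 * V k \<omega> * (2 * ?D \<omega>)) = (\<lambda>\<omega>. V k \<omega> * ?D \<omega>)" by auto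
    show ?thesis
      unfolding E2_add[OF gspan_scale[OF gspan_V] gspan_scale[OF D]] E2_scale d var_fn_eq[symmetric] c
      by (simp add: power2_eq_square)
  qed
  finally have a: "0 \<le> 1 / 4 * var_fn M V k + 2 * expectation (\<lambda>\<omega>. V k \<omega> * ?D \<omega>) + 4 * var_fn M V p" .
  have "var_fn M V (k + p) = var_fn M V k + 2 * expectation (\<lambda>\<omega>. V k \<omega> * ?D \<omega>) + var_fn M V p"
    using E2_add[OF gspan_V D, of k] unfolding d var_fn_eq[symmetric] by (simp add: var_fn_eq)
  then show ?thesis using a by simp
qed

end

section \<open>Overlap of distant cells\<close>

text \<open>Here \<open>g\<close> is the value \<open>V k\<close>, \<open>v\<close> its variance, and \<open>w0\<close>, \<open>wk\<close> are the fourth powers of the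
fluctuations in the two cells. With \<open>u\<close> the product of the two fluctuations, the minimum is at most
\<open>u min(1, exp \<beta>)\<close> and hence at most \<open>u exp(\<beta>/4)\<close> for the exponent \<open>\<beta> = g - 3v/8 + c\<close>. The power
\<open>1/4\<close> is small enough that the mean \<open>exp(v/8)\<close> of \<open>exp(g/2)\<close>, which enters after separating
\<open>exp(g/4)\<close> from \<open>u\<close> by \<open>2ab \<le> a\<^sup>2 + b\<^sup>2\<close>, is outweighed: the factor \<open>exp(-v/32)\<close> remains.\<close>

lemma min_le_exp_fluctuation:
  fixes w0 wk s0 sk g v c :: real
  assumes w: "1 \<le> w0" "1 \<le> wk" and s: "0 \<le> s0" "0 \<le> sk" "s0 \<le> sqrt (sqrt w0)" "sk \<le> exp (g - 3 * v / 8 + c) * sqrt (sqrt wk)"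
  shows "min s0 sk \<le> exp (c / 4 - v / 32) * (exp (- v / 8) * exp (g / 2) + (w0 + wk) / 2) / 2"
proof -
  define u where "u = sqrt (sqrt w0) * sqrt (sqrt wk)"
  have u1: "sqrt (sqrt w0) \<le> u" "sqrt (sqrt wk) \<le> u" using w by (auto simp: u_def mult_le_cancel_left1 mult_le_cancel_right1)
  have u0: "0 \<le> u" using w by (simp add: u_def)
  define e where "e = exp ((g - 3 * v / 8 + c) / 4)"
  have "min s0 sk \<le> u * e"
  proof (cases "g - 3 * v / 8 + c \<le> 0")
    case True
    then have "exp (g - 3 * v / 8 + c) \<le> e" by (simp add: e_def)
    then have "exp (g - 3 * v / 8 + c) * sqrt (sqrt wk) \<le> e * u" using u1 w by (intro mult_mono) (auto simp: e_def)
    then show ?thesis using s by (simp add: mult.commute)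
  next
    case False
    then have "1 \<le> e" by (simp add: e_def)
    then have "u * 1 \<le> u * e" using u0 by (intro mult_left_mono) auto
    then show ?thesis using s u1 by linarith
  qed
  also have "\<dots> = exp (c / 4 - v / 32) * ((exp (- v / 16) * exp (g / 4)) * u)"
    by (simp add: e_def field_simps flip: exp_add)
  also have "\<dots> \<le> exp (c / 4 - v / 32) * (((exp (- v / 16) * exp (g / 4))\<^sup>2 + u\<^sup>2) / 2)"
  proof (rule mult_left_mono)
    have "0 \<le> (exp (- v / 16) * exp (g / 4) - u)\<^sup>2" by simp
    then show "exp (- v / 16) * exp (g / 4) * u \<le> ((exp (- v / 16) * exp (g / 4))\<^sup>2 + u\<^sup>2) / 2"
      by (simp add: power2_eq_square algebra_simps)
  qed simp
  also have "(exp (- v / 16) * exp (g / 4))\<^sup>2 = exp (- v / 8) * exp (g / 2)"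
    by (simp add: power2_eq_square flip: exp_add)
  also have "u\<^sup>2 = sqrt w0 * sqrt wk" using w by (simp add: u_def power_mult_distrib)
  also have "\<dots> \<le> (w0 + wk) / 2"
    using arith_geo_mean_sqrt[of w0 wk] w by (simp add: real_sqrt_mult)
  finally show ?thesis by (simp add: mult_left_mono)
qed

text \<open>Uniform control of the field inside the cells: the fourth exponential moment of the fluctuation is
bounded uniformly in the cell. The supremum is over a countable set, so its mean makes sense.\<close>

locale controlled_cells = gaussian_field M V + cell \<kappa> P \<pi> x
  for M :: "'a measure" and V :: "'t :: ab_group_add \<Rightarrow> 'a \<Rightarrow> real" and \<kappa> :: "'t measure" and P \<pi> x +
  fixes C vm :: real
  assumes fluctuation: "\<And>k. (\<integral>\<^sup>+\<omega>. (SUP p\<in>P. ennreal (exp (4 * \<bar>V (k + p) \<omega> - V k \<omega>\<bar>))) \<partial>M) \<le> ennreal C"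
    and C_nonneg: "0 \<le> C"
    and var_cell: "\<And>p. p \<in> P \<Longrightarrow> var_fn M V p \<le> vm"
begin

definition fluct :: "'t \<Rightarrow> 'a \<Rightarrow> ennreal" where
  "fluct k \<omega> = (SUP p\<in>P. ennreal (exp (4 * \<bar>V (k + p) \<omega> - V k \<omega>\<bar>)))"

lemma fluct_measurable[measurable]: "fluct k \<in> borel_measurable M"
  unfolding fluct_def[abs_def] by (rule borel_measurable_SUP[OF countable_P]) measurable

lemma fluct_le: "(\<integral>\<^sup>+\<omega>. fluct k \<omega> \<partial>M) \<le> ennreal C"
  using fluctuation[of k] by (simp add: fluct_def)

lemma fluct_finite: "AE \<omega> in M. fluct k \<omega> \<noteq> \<infinity>"
proof (rule nn_integral_noteq_infinite)
  show "(\<integral>\<^sup>+\<omega>. fluct k \<omega> \<partial>M) \<noteq> \<infinity>" using fluct_le[of k] by (auto simp: top_unique)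
qed simp

lemma fluct_ge_1: "1 \<le> fluct k \<omega>"
  unfolding fluct_def by (rule SUP_upper2[OF zero_in_P]) simp

lemma fluct_upper: "p \<in> P \<Longrightarrow> ennreal (exp (4 * \<bar>V (k + p) \<omega> - V k \<omega>\<bar>)) \<le> fluct k \<omega>"
  unfolding fluct_def by (rule SUP_upper)

lemma exp_increment_le:
  assumes "p \<in> P" "fluct k \<omega> \<noteq> \<infinity>"
  shows "exp \<bar>V (k + p) \<omega> - V k \<omega>\<bar> \<le> sqrt (sqrt (enn2real (fluct k \<omega>)))"
proof -
  have "ennreal (exp (4 * \<bar>V (k + p) \<omega> - V k \<omega>\<bar>)) \<le> ennreal (enn2real (fluct k \<omega>))"
    using fluct_upper[OF assms(1)] assms(2) by (simp add: less_top)
  then have "exp (4 * \<bar>V (k + p) \<omega> - V k \<omega>\<bar>) \<le> enn2real (fluct k \<omega>)" by simp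
  then have "((exp \<bar>V (k + p) \<omega> - V k \<omega>\<bar>)\<^sup>2)\<^sup>2 \<le> enn2real (fluct k \<omega>)"
    by (simp add: exp_of_nat_mult[of 4, simplified] power_mult[symmetric])
  then show ?thesis by (intro real_le_rsqrt)
qed

text \<open>By \<open>var_fn_add_lower\<close> the centring \<open>\<sigma>\<^sup>2/2\<close> is at least \<open>3 \<sigma>\<^sup>2(k)/8\<close> up to a constant throughout the
cell at \<open>k\<close>.\<close>

lemma cell_sup_le:
  assumes "fluct k \<omega> \<noteq> \<infinity>"
  shows "cell_sup (\<lambda>t. logZ t \<omega>) k \<le> ennreal (exp (V k \<omega> - 3 * var_fn M V k / 8 + 3 * vm / 2) * sqrt (sqrt (enn2real (fluct k \<omega>))))"
  unfolding cell_sup_def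
proof (intro SUP_least ennreal_leI)
  fix p assume p: "p \<in> P"
  have "logZ (k + p) \<omega> \<le> (V k \<omega> - 3 * var_fn M V k / 8 + 3 * vm / 2) + \<bar>V (k + p) \<omega> - V k \<omega>\<bar>"
    using var_fn_add_lower[of k p] var_cell[OF p] unfolding logZ_def by simp
  then have "exp (logZ (k + p) \<omega>) \<le> exp (V k \<omega> - 3 * var_fn M V k / 8 + 3 * vm / 2) * exp \<bar>V (k + p) \<omega> - V k \<omega>\<bar>"
    by (simp flip: exp_add)
  also have "\<dots> \<le> exp (V k \<omega> - 3 * var_fn M V k / 8 + 3 * vm / 2) * sqrt (sqrt (enn2real (fluct k \<omega>)))"
    by (intro mult_left_mono exp_increment_le p assms) auto
  finally show "exp (logZ (k + p) \<omega>) \<le> \<dots>" .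
qed

lemma cell_sup_0_le:
  assumes "fluct 0 \<omega> \<noteq> \<infinity>" "V 0 \<omega> = 0"
  shows "cell_sup (\<lambda>t. logZ t \<omega>) 0 \<le> ennreal (sqrt (sqrt (enn2real (fluct 0 \<omega>))))"
  unfolding cell_sup_def
proof (intro SUP_least ennreal_leI)
  fix p assume p: "p \<in> P"
  have "logZ (0 + p) \<omega> \<le> \<bar>V (0 + p) \<omega> - V 0 \<omega>\<bar>"
    using var_fn_nonneg[of p] assms(2) unfolding logZ_def by simp
  then have "exp (logZ (0 + p) \<omega>) \<le> exp \<bar>V (0 + p) \<omega> - V 0 \<omega>\<bar>" by (simp only: exp_le_cancel_iff)
  also have "\<dots> \<le> sqrt (sqrt (enn2real (fluct 0 \<omega>)))" by (intro exp_increment_le p assms)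
  finally show "exp (logZ (0 + p) \<omega>) \<le> \<dots>" .
qed

lemma sup_cell_integrable: "(\<integral>\<^sup>+\<omega>. cell_sup (\<lambda>t. logZ t \<omega>) 0 \<partial>M) < \<infinity>"
proof -
  have "AE \<omega> in M. cell_sup (\<lambda>t. logZ t \<omega>) 0 \<le> fluct 0 \<omega>"
    using fluct_finite[of 0] V_0
  proof eventually_elim
    case (elim \<omega>)
    define w where "w = enn2real (fluct 0 \<omega>)"
    have fw: "fluct 0 \<omega> = ennreal w" using elim by (simp add: w_def less_top)
    have w1: "1 \<le> w" using fluct_ge_1[of 0 \<omega>] unfolding fw by simp
    then have "sqrt w \<le> w" using real_sqrt_le_iff[of w "w * w"] by (simp add: real_sqrt_mult mult_le_cancel_left1)
    then have "sqrt (sqrt w) \<le> w" using real_sqrt_le_mono[of "sqrt w" w] by linarith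
    have "cell_sup (\<lambda>t. logZ t \<omega>) 0 \<le> ennreal (sqrt (sqrt w))" unfolding w_def by (rule cell_sup_0_le[OF elim])
    also have "\<dots> \<le> ennreal w" by (rule ennreal_leI) fact
    finally show ?case unfolding fw .
  qed
  then have "(\<integral>\<^sup>+\<omega>. cell_sup (\<lambda>t. logZ t \<omega>) 0 \<partial>M) \<le> ennreal C"
    using fluct_le[of 0] by (rule order_trans[OF nn_integral_mono_AE])
  then show ?thesis by (rule le_less_trans) simp
qed

sublocale tilted_cells M V \<kappa> P \<pi> x
  by unfold_locales (rule sup_cell_integrable)

lemma overlap_le:
  "overlap k \<le> ennreal (exp (3 * vm / 8) * ((1 + C) / 2) * exp (- var_fn M V k / 32))"
proof -
  let ?v = "var_fn M V k"
  let ?c = "exp (3 * vm / 8 - ?v / 32)"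
  have [simp]: "3 * vm / 2 / 4 = 3 * vm / 8" by simp
  have AE: "AE \<omega> in M. min (cell_sup (path \<omega>) 0) (cell_sup (path \<omega>) k) \<le>
     ennreal (?c / 2 * exp (- ?v / 8)) * ennreal (exp (1 / 2 * V k \<omega>)) + ennreal (?c / 4) * (fluct 0 \<omega> + fluct k \<omega>)"
    using fluct_finite[of 0] fluct_finite[of k] V_0 cell_sup_finite[of 0] cell_sup_finite[of k]
  proof eventually_elim
    case (elim \<omega>)
    define w0 where "w0 = enn2real (fluct 0 \<omega>)"
    define wk where "wk = enn2real (fluct k \<omega>)"
    have f: "fluct 0 \<omega> = ennreal w0" "fluct k \<omega> = ennreal wk" using elim by (simp_all add: w0_def wk_def less_top)
    have w1: "1 \<le> w0" "1 \<le> wk" using fluct_ge_1[of 0 \<omega>] fluct_ge_1[of k \<omega>] unfolding f by simp_all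
    define s0 where "s0 = enn2real (cell_sup (path \<omega>) 0)"
    define sk where "sk = enn2real (cell_sup (path \<omega>) k)"
    have s: "cell_sup (path \<omega>) 0 = ennreal s0" "cell_sup (path \<omega>) k = ennreal sk"
      using elim by (simp_all add: s0_def sk_def less_top)
    have sn: "0 \<le> s0" "0 \<le> sk" by (simp_all add: s0_def sk_def)
    have a: "s0 \<le> sqrt (sqrt w0)" using cell_sup_0_le[of \<omega>] elim w1 unfolding w0_def[symmetric] s by simp
    have b: "sk \<le> exp (V k \<omega> - 3 * ?v / 8 + 3 * vm / 2) * sqrt (sqrt wk)"
      using cell_sup_le[of k \<omega>] elim w1 unfolding wk_def[symmetric] s by simp
    have "min s0 sk \<le> exp (3 * vm / 2 / 4 - ?v / 32) * (exp (- ?v / 8) * exp (V k \<omega> / 2) + (w0 + wk) / 2) / 2"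
      by (rule min_le_exp_fluctuation[OF w1 sn a b])
    also have "\<dots> = ?c / 2 * exp (- ?v / 8) * exp (1 / 2 * V k \<omega>) + ?c / 4 * (w0 + wk)"
      by (simp add: field_simps)
    finally have "ennreal (min s0 sk) \<le> ennreal (?c / 2 * exp (- ?v / 8) * exp (1 / 2 * V k \<omega>) + ?c / 4 * (w0 + wk))"
      by (rule ennreal_leI)
    also have "\<dots> = ennreal (?c / 2 * exp (- ?v / 8)) * ennreal (exp (1 / 2 * V k \<omega>)) + ennreal (?c / 4) * (ennreal w0 + ennreal wk)"
      using w1 by (simp add: ennreal_mult[symmetric] flip: ennreal_plus)
    finally show ?case using sn unfolding s f by (simp only: min_ennreal)
  qed
  have "overlap k \<le> (\<integral>\<^sup>+\<omega>. ennreal (?c / 2 * exp (- ?v / 8)) * ennreal (exp (1 / 2 * V k \<omega>))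
      + ennreal (?c / 4) * (fluct 0 \<omega> + fluct k \<omega>) \<partial>M)"
    unfolding overlap_def by (rule nn_integral_mono_AE[OF AE])
  also have "\<dots> = ennreal (?c / 2 * exp (- ?v / 8)) * ennreal (exp (?v / 8))
      + ennreal (?c / 4) * ((\<integral>\<^sup>+\<omega>. fluct 0 \<omega> \<partial>M) + (\<integral>\<^sup>+\<omega>. fluct k \<omega> \<partial>M))"
  proof -
    have e: "(\<integral>\<^sup>+\<omega>. ennreal (exp (1 / 2 * V k \<omega>)) \<partial>M) = ennreal (exp (?v / 8))"
      unfolding gspan_moments(3)[OF gspan_scale[OF gspan_V]] E2_scale var_fn_eq[symmetric] by (simp add: power2_eq_square)
    show ?thesis
      by (subst nn_integral_add, simp, simp, subst nn_integral_cmult, simp, subst nn_integral_cmult, simp,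
        subst nn_integral_add, simp, simp, simp only: e)
  qed
  also have "\<dots> \<le> ennreal (?c / 2 * exp (- ?v / 8)) * ennreal (exp (?v / 8)) + ennreal (?c / 4) * (ennreal C + ennreal C)"
    by (intro add_left_mono mult_left_mono add_mono fluct_le) auto
  also have "\<dots> = ennreal (?c / 2 * (exp (- ?v / 8) * exp (?v / 8)) + ?c / 4 * (C + C))"
    using C_nonneg by (simp add: ennreal_mult[symmetric] mult.assoc flip: ennreal_plus)
  also have "?c / 2 * (exp (- ?v / 8) * exp (?v / 8)) + ?c / 4 * (C + C) = exp (3 * vm / 8) * ((1 + C) / 2) * exp (- ?v / 32)"
  proof -
    have 1: "exp (- ?v / 8) * exp (?v / 8) = 1" by (simp flip: exp_add)
    have 2: "?c = exp (3 * vm / 8) * exp (- ?v / 32)" by (simp flip: exp_add)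
    show ?thesis unfolding 1 2 by (simp add: field_simps)
  qed
  finally show ?thesis .
qed

end

section \<open>Boxes in a cubic lattice\<close>

definition lattice_point :: "real \<Rightarrow> ('n \<Rightarrow> int) \<Rightarrow> real ^ 'n" where
  "lattice_point a j = (\<chi> i. a * of_int (j i))"

definition lattice_box :: "real \<Rightarrow> ('n \<Rightarrow> int set) \<Rightarrow> (real ^ 'n) set" where
  "lattice_box a A = lattice_point a ` Pi UNIV A"

lemma inj_lattice_point: "a \<noteq> 0 \<Longrightarrow> inj (lattice_point a)"
  by (auto simp: inj_def lattice_point_def vec_eq_iff)

lemma finite_lattice_box: "(\<And>i::'n::finite. finite (A i)) \<Longrightarrow> finite (lattice_box a A)"
  using finite_PiE[of UNIV A] by (auto simp: lattice_box_def PiE_UNIV_domain)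

lemma sum_lattice_box:
  "a \<noteq> 0 \<Longrightarrow> sum f (lattice_box a A) = (\<Sum>j\<in>Pi UNIV A. f (lattice_point a j))"
  unfolding lattice_box_def by (rule sum.reindex_cong[OF inj_on_subset[OF inj_lattice_point]]) auto

lemma lattice_box_mono: "(\<And>i. A i \<subseteq> B i) \<Longrightarrow> lattice_box a A \<subseteq> lattice_box a B"
  unfolding lattice_box_def by (intro image_mono Pi_mono) auto

lemma lattice_box_shift:
  "(\<lambda>k. k - lattice_point a j) ` lattice_box a A = lattice_box a (\<lambda>i. (\<lambda>z. z - j i) ` A i)"
proof -
  have "(\<lambda>k i. k i - j i) ` Pi UNIV A = Pi UNIV (\<lambda>i. (\<lambda>z. z - j i) ` A i)"
  proof (intro equalityI subsetI)
    fix l assume "l \<in> Pi UNIV (\<lambda>i. (\<lambda>z. z - j i) ` A i)"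
    then have "l i \<in> (\<lambda>z. z - j i) ` A i" for i by (simp add: Pi_iff)
    then have "l i + j i \<in> A i" for i by (metis diff_add_cancel imageE)
    then have "(\<lambda>i. l i + j i) \<in> Pi UNIV A" by auto
    then show "l \<in> (\<lambda>k i. k i - j i) ` Pi UNIV A" by (intro image_eqI[of _ _ "\<lambda>i. l i + j i"]) auto
  qed auto
  then have "lattice_box a (\<lambda>i. (\<lambda>z. z - j i) ` A i) = lattice_point a ` (\<lambda>k i. k i - j i) ` Pi UNIV A"
    by (simp add: lattice_box_def)
  also have "\<dots> = (\<lambda>k. k - lattice_point a j) ` lattice_box a A"
    by (auto simp: lattice_box_def image_image lattice_point_def vec_eq_iff algebra_simps intro!: image_cong)
  finally show ?thesis by simp
qed

lemma card_int_box: "card (Pi (UNIV :: 'n::finite set) (\<lambda>_. {l..<u})) = nat (u - l) ^ CARD('n)"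
  by (simp add: card_PiE flip: PiE_UNIV_domain)

lemma zero_in_lattice_box: "(\<And>i. 0 \<in> A i) \<Longrightarrow> 0 \<in> lattice_box a A"
  unfolding lattice_box_def by (intro image_eqI[of _ _ "\<lambda>_. 0"]) (auto simp: lattice_point_def vec_eq_iff)

text \<open>The subtracted term telescopes and makes the induction work.\<close>

lemma sum_inverse_square_int: "(\<Sum>z\<in>{- int N..int N}. 1 / (1 + real_of_int \<bar>z\<bar>)\<^sup>2) \<le> 4 - 2 / (real N + 1)"
proof (induction N)
  case (Suc N)
  have "{- int (Suc N)..int (Suc N)} = insert (int (Suc N)) (insert (- int (Suc N)) {- int N..int N})" by auto
  then have "(\<Sum>z\<in>{- int (Suc N)..int (Suc N)}. 1 / (1 + real_of_int \<bar>z\<bar>)\<^sup>2) =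
     (\<Sum>z\<in>{- int N..int N}. 1 / (1 + real_of_int \<bar>z\<bar>)\<^sup>2) + 2 / (real N + 2)\<^sup>2" by simp
  also have "\<dots> \<le> 4 - 2 / (real N + 1) + 2 / (real N + 2)\<^sup>2" using Suc by simp
  also have "2 / (real N + 2)\<^sup>2 \<le> 2 / ((real N + 1) * (real N + 2))"
    by (intro divide_left_mono) (auto simp: power2_eq_square)
  also have "2 / ((real N + 1) * (real N + 2)) = 2 / (real N + 1) - 2 / (real (Suc N) + 1)"
    by (simp add: divide_simps)
  finally show ?case by simp
qed simp

text \<open>Of the decay exponent \<open>2d + m\<close>, the part \<open>2d\<close> is spent on a product of the summable weights
\<open>1/(1 + |j\<^sub>i|)\<^sup>2\<close>, one for each coordinate, and the part \<open>m\<close> gives the factor \<open>w^(-m)\<close> because some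
coordinate exceeds \<open>w\<close> outside the box.\<close>

lemma lattice_tail_sum:
  fixes ov :: "real ^ 'n \<Rightarrow> real"
  assumes a: "0 < a" and D: "0 \<le> D"
    and ov: "\<And>k. ov k \<le> D / (1 + norm k) ^ (2 * CARD('n) + m)"
    and K: "finite K" "K \<subseteq> range (lattice_point a)" and w: "0 < w"
  shows "(\<Sum>k\<in>K - lattice_box a (\<lambda>_. {- int w..int w}). ov k)
    \<le> D * 4 ^ CARD('n) / (min a 1) ^ (2 * CARD('n) + m) / real w ^ m"
proof -
  let ?d = "CARD('n)"
  define c where "c = min a 1"
  have c: "0 < c" "c \<le> 1" "c \<le> a" using a by (auto simp: c_def)
  let ?B = "Pi UNIV (\<lambda>_::'n. {- int w..int w})"
  define J where "J = {j. lattice_point a j \<in> K - lattice_box a (\<lambda>_. {- int w..int w})}"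
  have inj: "inj (lattice_point a)" using a by (intro inj_lattice_point) auto
  have Jimg: "lattice_point a ` J = K - lattice_box a (\<lambda>_. {- int w..int w})" using K by (auto simp: J_def)
  then have "finite (lattice_point a ` J)" using K by simp
  then have fJ: "finite J" by (rule finite_imageD) (rule inj_on_subset[OF inj subset_UNIV])
  define b where "b j = (\<Prod>i\<in>UNIV. 1 / (1 + real_of_int \<bar>j i\<bar>)\<^sup>2)" for j :: "'n \<Rightarrow> int"
  have b0: "0 \<le> b j" for j by (simp add: b_def prod_nonneg)
  have each: "ov (lattice_point a j) \<le> D / c ^ (2 * ?d + m) / real w ^ m * b j" if "j \<in> J" for j
  proof -
    let ?r = "1 + norm (lattice_point a j)"
    have ni: "c * (1 + real_of_int \<bar>j i\<bar>) \<le> ?r" for i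
    proof -
      have "a * real_of_int \<bar>j i\<bar> \<le> norm (lattice_point a j)"
        using component_le_norm_cart[of "lattice_point a j" i] a by (simp add: lattice_point_def abs_mult)
      moreover have "c * real_of_int \<bar>j i\<bar> \<le> a * real_of_int \<bar>j i\<bar>" using c by (intro mult_right_mono) auto
      ultimately show ?thesis using c by (simp add: distrib_left)
    qed
    have "j \<notin> ?B" using that by (auto simp: J_def lattice_box_def)
    then obtain i where "j i \<notin> {- int w..int w}" by (auto simp: Pi_iff simp del: atLeastAtMost_iff)
    then have "int w \<le> \<bar>j i\<bar>" by auto
    then have "real w \<le> 1 + real_of_int \<bar>j i\<bar>" by linarith
    then have "c * real w \<le> ?r" using ni[of i] c mult_left_mono[of "real w" "1 + real_of_int \<bar>j i\<bar>" c] by linarith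
    then have 1: "(c * real w) ^ m \<le> ?r ^ m" using c by (intro power_mono) auto
    have "(\<Prod>i\<in>(UNIV::'n set). (c * (1 + real_of_int \<bar>j i\<bar>))\<^sup>2) \<le> (\<Prod>i\<in>(UNIV::'n set). ?r\<^sup>2)"
      using ni c by (intro prod_mono conjI power_mono) auto
    also have "\<dots> = ?r ^ (2 * ?d)" by (simp add: power_mult)
    also have "(\<Prod>i\<in>(UNIV::'n set). (c * (1 + real_of_int \<bar>j i\<bar>))\<^sup>2) = c ^ (2 * ?d) / b j"
      by (simp add: b_def power_mult_distrib prod.distrib power_mult prod_dividef)
    finally have 2: "c ^ (2 * ?d) / b j \<le> ?r ^ (2 * ?d)" .
    have bp: "0 < b j" unfolding b_def by (intro prod_pos) (auto simp: add_pos_nonneg)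
    have cc: "c ^ (2 * ?d) / b j * (c * real w) ^ m \<le> ?r ^ (2 * ?d) * ?r ^ m"
      using 1 2 c bp by (intro mult_mono) auto
    have "D / ?r ^ (2 * ?d + m) \<le> D / (c ^ (2 * ?d) / b j * (c * real w) ^ m)"
    proof (rule divide_left_mono)
      have p1: "0 < c ^ (2 * ?d) / b j * (c * real w) ^ m" using c bp w by simp
      have p2: "0 < ?r" by (simp add: add_pos_nonneg)
      show "0 < ?r ^ (2 * ?d + m) * (c ^ (2 * ?d) / b j * (c * real w) ^ m)"
        by (rule mult_pos_pos[OF zero_less_power[OF p2] p1])
    qed (use D cc in \<open>simp_all only: power_add\<close>)
    also have "\<dots> = D / c ^ (2 * ?d + m) / real w ^ m * b j"
      by (simp add: power_add power_mult_distrib)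
    finally show ?thesis using ov[of "lattice_point a j"] by linarith
  qed
  obtain N where N: "J \<subseteq> Pi UNIV (\<lambda>_. {- int N..int N})"
  proof -
    have "finite (\<Union>j\<in>J. range j)" using fJ by auto
    then have "finite ((\<lambda>z. nat \<bar>z\<bar>) ` (\<Union>j\<in>J. range j))" by simp
    then obtain N where "\<forall>z\<in>(\<Union>j\<in>J. range j). nat \<bar>z\<bar> \<le> N" unfolding finite_nat_set_iff_bounded_le by auto
    then have b: "nat \<bar>j i\<bar> \<le> N" if "j \<in> J" for j i using that by blast
    have "J \<subseteq> Pi UNIV (\<lambda>_. {- int N..int N})"
    proof (intro subsetI Pi_I)
      fix j :: "'n \<Rightarrow> int" and i assume "j \<in> J"
      from b[OF this, of i] show "j i \<in> {- int N..int N}" by auto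
    qed
    then show ?thesis by (rule that)
  qed
  have "(\<Sum>k\<in>K - lattice_box a (\<lambda>_. {- int w..int w}). ov k) = (\<Sum>j\<in>J. ov (lattice_point a j))"
    unfolding Jimg[symmetric] by (rule sum.reindex_cong[OF inj_on_subset[OF inj]]) auto
  also have "\<dots> \<le> (\<Sum>j\<in>J. D / c ^ (2 * ?d + m) / real w ^ m * b j)" by (intro sum_mono each)
  also have "\<dots> = D / c ^ (2 * ?d + m) / real w ^ m * (\<Sum>j\<in>J. b j)" by (simp add: sum_distrib_left)
  also have "\<dots> \<le> D / c ^ (2 * ?d + m) / real w ^ m * 4 ^ ?d"
  proof (rule mult_left_mono)
    have "(\<Sum>j\<in>J. b j) \<le> (\<Sum>j\<in>Pi UNIV (\<lambda>_. {- int N..int N}). b j)"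
      using N b0 by (intro sum_mono2) (auto simp flip: PiE_UNIV_domain intro!: finite_PiE)
    also have "\<dots> = (\<Prod>i\<in>(UNIV::'n set). \<Sum>z\<in>{- int N..int N}. 1 / (1 + real_of_int \<bar>z\<bar>)\<^sup>2)"
      unfolding b_def by (subst prod_sum_PiE) (auto simp: PiE_UNIV_domain)
    also have "\<dots> \<le> (\<Prod>i\<in>(UNIV::'n set). 4)"
    proof (intro prod_mono conjI sum_nonneg)
      fix i
      have "0 \<le> 2 / (real N + 1)" by simp
      then show "(\<Sum>z\<in>{- int N..int N}. 1 / (1 + real_of_int \<bar>z\<bar>)\<^sup>2) \<le> 4" using sum_inverse_square_int[of N] by linarith
    qed auto
    finally show "(\<Sum>j\<in>J. b j) \<le> 4 ^ ?d" by simp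
  qed (use D c in simp)
  finally show ?thesis by (simp add: c_def)
qed


section \<open>Averages over growing boxes\<close>

text \<open>The abstract form of the averaging argument, with \<open>f\<close> the mean level functional, \<open>g\<close> the mean share of
the cell at the origin and \<open>ov\<close> the overlap. The values of \<open>g\<close> at centred boxes are a Cauchy sequence
with limit \<open>G\<close>. In the box of side \<open>n\<close>, the points \<open>h\<close> whose \<open>w\<close>-neighbourhood stays inside have
\<open>g (K - h)\<close> close to \<open>G\<close>; Bernoulli's inequality counts the others.\<close>

lemma box_average_rate:
  fixes f g :: "(real ^ 'n) set \<Rightarrow> real" and ov :: "real ^ 'n \<Rightarrow> real"
  assumes a: "0 < a" and \<epsilon>: "0 < \<epsilon>" "\<epsilon> < 1"
    and f: "\<And>K. finite K \<Longrightarrow> f K = (\<Sum>h\<in>K. g ((\<lambda>k. k - h) ` K))"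
    and g: "\<And>K. finite K \<Longrightarrow> 0 \<le> g K" "\<And>K. finite K \<Longrightarrow> g K \<le> C0"
    and cmp: "\<And>K K'. finite K' \<Longrightarrow> K \<subseteq> K' \<Longrightarrow> 0 \<in> K \<Longrightarrow> \<bar>g K' - g K\<bar> \<le> (\<Sum>k\<in>K' - K. ov k)"
    and decay: "\<And>q. \<exists>D\<ge>0. \<forall>k. ov k \<le> D / (1 + norm k) ^ q"
  shows "\<exists>G C. 0 \<le> G \<and> 0 \<le> C \<and> (\<forall>\<^sub>F n in sequentially.
    \<bar>f (lattice_box a (\<lambda>_. {0..<int n})) - G * real n ^ CARD('n)\<bar> \<le> C * real n powr (\<epsilon> - 1) * real n ^ CARD('n))"
proof -
  let ?d = "CARD('n)"
  \<comment> \<open>with \<open>w = n^\<epsilon>\<close> this makes \<open>w^(-m)\<close> of order at most \<open>1/n\<close>\<close>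
  obtain m :: nat where m: "1 / \<epsilon> \<le> real m" using real_arch_simple by blast
  have m0: "0 < m" using m \<epsilon> by (cases m) (auto simp: divide_le_0_iff)
  obtain D where D: "0 \<le> D" "\<And>k. ov k \<le> D / (1 + norm k) ^ (2 * ?d + m)" using decay[of "2 * ?d + m"] by auto
  define R where "R = D * 4 ^ ?d / (min a 1) ^ (2 * ?d + m)"
  have R0: "0 \<le> R" using D a by (simp add: R_def)
  define B where "B w = (lattice_box a (\<lambda>_. {- int w..int w}) :: (real ^ 'n) set)" for w
  have zB: "0 \<in> B w" for w unfolding B_def by (rule zero_in_lattice_box) auto
  have fB: "finite (B w)" for w unfolding B_def by (rule finite_lattice_box) auto
  have near: "\<bar>g K - g (B w)\<bar> \<le> R / real w ^ m"
    if "finite K" "K \<subseteq> range (lattice_point a)" "B w \<subseteq> K" "0 < w" for K w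
    using cmp[OF that(1,3) zB] lattice_tail_sum[OF a D that(1,2,4)] unfolding B_def R_def by linarith
  have nearB: "\<bar>g (B w') - g (B w)\<bar> \<le> R / real w ^ m" if "0 < w" "w \<le> w'" for w w'
  proof (rule near[OF fB _ _ that(1)])
    show "B w' \<subseteq> range (lattice_point a)" unfolding B_def lattice_box_def by auto
    show "B w \<subseteq> B w'" unfolding B_def by (rule lattice_box_mono) (use that in auto)
  qed
  have R_lim: "(\<lambda>w. R / real w ^ m) \<longlonglongrightarrow> 0"
    using m0 by (intro real_tendsto_divide_at_top[OF tendsto_const] filterlim_pow_at_top filterlim_real_sequentially)
  have "Cauchy (\<lambda>w. g (B w))"
  proof (rule metric_CauchyI)
    fix e :: real assume e: "0 < e"
    from order_tendstoD(2)[OF R_lim e] obtain N where N: "\<And>w. N \<le> w \<Longrightarrow> R / real w ^ m < e"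
      unfolding eventually_sequentially by auto
    show "\<exists>M. \<forall>p\<ge>M. \<forall>q\<ge>M. dist (g (B p)) (g (B q)) < e"
    proof (intro exI[of _ "Suc N"] allI impI)
      fix p q assume pq: "Suc N \<le> p" "Suc N \<le> q"
      show "dist (g (B p)) (g (B q)) < e"
      proof (cases "p \<le> q")
        case True
        then show ?thesis using nearB[of p q] N[of p] pq by (simp add: dist_real_def abs_minus_commute)
      next
        case False
        then show ?thesis using nearB[of q p] N[of q] pq by (simp add: dist_real_def abs_minus_commute)
      qed
    qed
  qed
  then obtain G where G: "(\<lambda>w. g (B w)) \<longlonglongrightarrow> G" using real_Cauchy_convergent convergent_def by blast
  have G0: "0 \<le> G" using G by (rule LIMSEQ_le_const) (use g fB in auto)
  have GC: "G \<le> C0" using G by (rule LIMSEQ_le_const2) (use g fB in auto)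
  have nearG: "\<bar>G - g (B w)\<bar> \<le> R / real w ^ m" if "0 < w" for w
  proof (rule LIMSEQ_le_const2)
    show "(\<lambda>w'. \<bar>g (B w') - g (B w)\<bar>) \<longlonglongrightarrow> \<bar>G - g (B w)\<bar>" by (intro tendsto_intros G)
    show "\<exists>N. \<forall>n\<ge>N. \<bar>g (B n) - g (B w)\<bar> \<le> R / real w ^ m" using nearB[OF that] by blast
  qed
  have C0: "0 \<le> C0" using g[of "{}"] by simp
  have key: "\<bar>f (lattice_box a (\<lambda>_. {0..<int n})) - G * real n ^ ?d\<bar>
      \<le> (2 * R / real w ^ m + C0 * (real ?d * (2 * real w / real n))) * real n ^ ?d"
    if w: "0 < w" "2 * w \<le> n" for n w
  proof -
    define I where "I = Pi (UNIV :: 'n set) (\<lambda>_. {0..<int n})"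
    define I' where "I' = Pi (UNIV :: 'n set) (\<lambda>_. {int w..<int n - int w})"
    define K where "K = (lattice_box a (\<lambda>_. {0..<int n}) :: (real ^ 'n) set)"
    have fK: "finite K" unfolding K_def by (rule finite_lattice_box) auto
    have fI: "finite I" unfolding I_def by (simp flip: PiE_UNIV_domain add: finite_PiE)
    have sub: "I' \<subseteq> I" unfolding I_def I'_def by (rule Pi_mono) auto
    have cI: "real (card I) = real n ^ ?d" unfolding I_def card_int_box by simp
    have cI': "real (card I') = (real n - 2 * real w) ^ ?d" unfolding I'_def card_int_box using w by simp
    define e where "e j = g ((\<lambda>k. k - lattice_point a j) ` K) - G" for j
    have "f K = (\<Sum>j\<in>I. g ((\<lambda>k. k - lattice_point a j) ` K))"
      unfolding f[OF fK] by (subst (1) K_def, subst sum_lattice_box) (use a in \<open>auto simp: I_def\<close>)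
    then have "f K - G * real n ^ ?d = (\<Sum>j\<in>I. e j)" by (simp add: e_def sum_subtractf cI)
    also have "\<dots> = (\<Sum>j\<in>I'. e j) + (\<Sum>j\<in>I - I'. e j)" using sum.subset_diff[OF sub fI, of e] by simp
    finally have "\<bar>f K - G * real n ^ ?d\<bar> \<le> \<bar>\<Sum>j\<in>I'. e j\<bar> + \<bar>\<Sum>j\<in>I - I'. e j\<bar>" by linarith
    also have "\<dots> \<le> real (card I') * (2 * R / real w ^ m) + real (card (I - I')) * C0"
    proof (rule add_mono)
      have "\<bar>e j\<bar> \<le> 2 * R / real w ^ m" if j: "j \<in> I'" for j
      proof -
        let ?K = "(\<lambda>k. k - lattice_point a j) ` K"
        have eq: "?K = lattice_box a (\<lambda>i. (\<lambda>z. z - j i) ` {0..<int n})" unfolding K_def by (rule lattice_box_shift)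
        have "B w \<subseteq> ?K" unfolding B_def eq
        proof (rule lattice_box_mono)
          fix i
          have "int w \<le> j i" "j i < int n - int w" using j by (auto simp: I'_def)
          then show "{- int w..int w} \<subseteq> (\<lambda>z. z - j i) ` {0..<int n}"
            by (intro subsetI image_eqI[of _ _ "_ + j i"]) auto
        qed
        moreover have "?K \<subseteq> range (lattice_point a)" unfolding eq lattice_box_def by auto
        ultimately have "\<bar>g ?K - g (B w)\<bar> \<le> R / real w ^ m" using near[of ?K w] fK w by simp
        then show ?thesis using nearG[OF w(1)] unfolding e_def by (simp add: abs_le_iff)
      qed
      then show "\<bar>\<Sum>j\<in>I'. e j\<bar> \<le> real (card I') * (2 * R / real w ^ m)"
        by (intro order_trans[OF sum_abs] sum_bounded_above)
      have "\<bar>e j\<bar> \<le> C0" for j using g[of "(\<lambda>k. k - lattice_point a j) ` K"] fK G0 GC unfolding e_def by (simp add: abs_le_iff)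
      then show "\<bar>\<Sum>j\<in>I - I'. e j\<bar> \<le> real (card (I - I')) * C0"
        by (intro order_trans[OF sum_abs] sum_bounded_above)
    qed
    finally have *: "\<bar>f K - G * real n ^ ?d\<bar> \<le> real (card I') * (2 * R / real w ^ m) + real (card (I - I')) * C0" .
    have "real (card (I - I')) = real n ^ ?d - (real n - 2 * real w) ^ ?d"
      using card_Diff_subset[OF finite_subset[OF sub fI] sub] card_mono[OF fI sub] cI cI' by (simp add: of_nat_diff)
    also have "\<dots> \<le> real ?d * (2 * real w / real n) * real n ^ ?d"
    proof -
      have n: "0 < real n" using w by simp
      have "1 + real ?d * (- (2 * real w / real n)) \<le> (1 + - (2 * real w / real n)) ^ ?d"
        by (rule Bernoulli_inequality) (use w n in \<open>simp add: divide_simps\<close>)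
      then have "(1 - real ?d * (2 * real w / real n)) * real n ^ ?d \<le> (1 - 2 * real w / real n) ^ ?d * real n ^ ?d"
        by (intro mult_right_mono) auto
      also have "\<dots> = (real n - 2 * real w) ^ ?d" using n by (simp flip: power_mult_distrib add: left_diff_distrib)
      finally show ?thesis by (simp add: left_diff_distrib)
    qed
    finally have "real (card (I - I')) * C0 \<le> real ?d * (2 * real w / real n) * real n ^ ?d * C0"
      using C0 by (rule mult_right_mono)
    moreover have "real (card I') * (2 * R / real w ^ m) \<le> real n ^ ?d * (2 * R / real w ^ m)"
      using card_mono[OF fI sub] cI R0 by (intro mult_right_mono) auto
    moreover have "(2 * R / real w ^ m + C0 * (real ?d * (2 * real w / real n))) * real n ^ ?d
      = real n ^ ?d * (2 * R / real w ^ m) + real ?d * (2 * real w / real n) * real n ^ ?d * C0"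
      by (simp only: distrib_right distrib_left mult_ac)
    ultimately show ?thesis using * unfolding K_def by linarith
  qed
  define C where "C = 2 * R * 2 ^ m + 2 * C0 * real ?d"
  have "\<forall>\<^sub>F n in sequentially. real n powr \<epsilon> \<le> real n / 2" using \<epsilon> by real_asymp
  then have "\<forall>\<^sub>F n in sequentially. \<bar>f (lattice_box a (\<lambda>_. {0..<int n})) - G * real n ^ ?d\<bar>
      \<le> C * real n powr (\<epsilon> - 1) * real n ^ ?d"
    using eventually_ge_at_top[of 1]
  proof eventually_elim
    case (elim n)
    define w where "w = nat \<lfloor>real n powr \<epsilon>\<rfloor>"
    have n1: "1 \<le> real n" using elim by simp
    have ge1: "1 \<le> real n powr \<epsilon>" using n1 \<epsilon> by (simp add: ge_one_powr_ge_zero)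
    then have w0: "0 < w" unfolding w_def by (simp add: le_floor_iff)
    have wle: "real w \<le> real n powr \<epsilon>" unfolding w_def using ge1 by simp
    have wge: "real n powr \<epsilon> / 2 \<le> real w"
    proof -
      have "real n powr \<epsilon> < real w + 1" unfolding w_def using ge1 by linarith
      moreover have "1 \<le> real w" using w0 by simp
      ultimately show ?thesis by linarith
    qed
    have "2 * real w \<le> real n" using wle elim by linarith
    then have w2: "2 * w \<le> n" by linarith
    have "real n = real n powr 1" using n1 by simp
    also have "\<dots> \<le> real n powr (\<epsilon> * real m)"
      using m \<epsilon> n1 by (intro powr_mono) (auto simp: divide_simps mult.commute)
    also have "\<dots> = (real n powr \<epsilon>) ^ m" using n1 by (simp add: powr_powr[symmetric] powr_realpow)
    also have "\<dots> \<le> (2 * real w) ^ m" using wge by (intro power_mono) auto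
    finally have nm: "real n \<le> 2 ^ m * real w ^ m" by (simp add: power_mult_distrib)
    have i: "1 / real n \<le> real n powr (\<epsilon> - 1)"
      using n1 \<epsilon> powr_mono[of "-1" "\<epsilon> - 1" "real n"] by (simp add: powr_minus_divide)
    have "2 * R / real w ^ m \<le> 2 * R * 2 ^ m * (1 / real n)"
    proof -
      have "2 * R * real n \<le> 2 * R * (2 ^ m * real w ^ m)" using nm R0 by (intro mult_left_mono) auto
      then show ?thesis using w0 n1 by (simp add: field_simps)
    qed
    also have "\<dots> \<le> 2 * R * 2 ^ m * real n powr (\<epsilon> - 1)" using i R0 by (intro mult_left_mono) auto
    finally have 1: "2 * R / real w ^ m \<le> 2 * R * 2 ^ m * real n powr (\<epsilon> - 1)" .
    have "real w / real n \<le> real n powr (\<epsilon> - 1)"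
      using wle n1 by (simp add: powr_diff divide_right_mono)
    then have "2 * C0 * real ?d * (real w / real n) \<le> 2 * C0 * real ?d * real n powr (\<epsilon> - 1)"
      using C0 by (intro mult_left_mono) auto
    then have "2 * R / real w ^ m + C0 * (real ?d * (2 * real w / real n)) \<le> C * real n powr (\<epsilon> - 1)"
      using 1 unfolding C_def by (simp add: algebra_simps)
    then have "(2 * R / real w ^ m + C0 * (real ?d * (2 * real w / real n))) * real n ^ ?d \<le> C * real n powr (\<epsilon> - 1) * real n ^ ?d"
      by (intro mult_right_mono) auto
    then show ?case using key[OF w0 w2] by linarith
  qed
  moreover have "0 \<le> C" using R0 C0 by (simp add: C_def)
  ultimately show ?thesis using G0 by blast
qed

section \<open>The mean level functional over lattice boxes\<close>

lemma exp_minus_le_power: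
  fixes z :: real
  assumes "0 < z" "0 < N"
  shows "exp (- z) \<le> (real N / z) ^ N"
proof -
  have "(z / real N) ^ N \<le> exp (z / real N) ^ N"
  proof (rule power_mono)
    show "z / real N \<le> exp (z / real N)" using exp_ge_add_one_self[of "z / real N"] by linarith
  qed (use assms in simp)
  also have "\<dots> = exp z" using assms by (simp flip: exp_of_nat_mult)
  finally have *: "(z / real N) ^ N \<le> exp z" .
  have "0 < (z / real N) ^ N" using assms by simp
  then have "1 / exp z \<le> 1 / (z / real N) ^ N" using * by (intro divide_left_mono) auto
  then show ?thesis by (simp add: exp_minus divide_inverse power_inverse[symmetric] power_mult_distrib mult.commute)
qed

lemma exp_growth_decay:
  fixes v :: "'b::real_normed_vector \<Rightarrow> real"
  assumes c: "0 < c" and \<alpha>: "0 < \<alpha>" and v0: "\<And>t. 0 \<le> v t" and v: "\<And>t. R \<le> norm t \<Longrightarrow> c * norm t powr \<alpha> \<le> v t"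
  shows "\<exists>D\<ge>0. \<forall>t. exp (- v t / 32) \<le> D / (1 + norm t) ^ q"
proof -
  obtain N0 :: nat where N0: "real q / \<alpha> \<le> real N0" using real_arch_simple by blast
  define N where "N = Suc N0"
  have N: "real q \<le> \<alpha> * real N" "0 < N"
    using N0 \<alpha> by (auto simp: N_def divide_simps algebra_simps intro: order_trans)
  define R' where "R' = max R 1"
  define D where "D = (1 + R') ^ q + (32 * real N / c) ^ N * 2 ^ q"
  have D0: "0 \<le> D" using c by (simp add: D_def R'_def)
  have "exp (- v t / 32) \<le> D / (1 + norm t) ^ q" for t
  proof (cases "R' \<le> norm t")
    case False
    have "exp (- v t / 32) * (1 + norm t) ^ q \<le> 1 * (1 + R') ^ q"
      using v0[of t] False by (intro mult_mono power_mono) auto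
    also have "\<dots> \<le> D" using c by (simp add: D_def)
    finally show ?thesis by (subst pos_le_divide_eq) (auto simp: add_pos_nonneg)
  next
    case True
    define n where "n = norm t"
    have n: "1 \<le> n" "R \<le> n" using True by (auto simp: R'_def n_def)
    have "exp (- v t / 32) \<le> exp (- (c * n powr \<alpha> / 32))" using v[of t] n by (simp add: n_def)
    also have "\<dots> \<le> (real N / (c * n powr \<alpha> / 32)) ^ N" using c n N by (intro exp_minus_le_power) auto
    also have "\<dots> = (32 * real N / c) ^ N / (n powr (\<alpha> * real N))"
      using n c by (simp add: power_divide power_mult_distrib powr_powr[symmetric] powr_realpow field_simps)
    also have "\<dots> \<le> (32 * real N / c) ^ N / n ^ q"
    proof (rule divide_left_mono)
      show "n ^ q \<le> n powr (\<alpha> * real N)"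
        using n N powr_mono[of "real q" "\<alpha> * real N" n] by (simp add: powr_realpow)
    qed (use c n in auto)
    finally have 1: "exp (- v t / 32) * n ^ q \<le> (32 * real N / c) ^ N" using n by (simp add: pos_le_divide_eq)
    have "exp (- v t / 32) * (1 + n) ^ q \<le> exp (- v t / 32) * (2 * n) ^ q" using n by (intro mult_left_mono power_mono) auto
    also have "\<dots> = exp (- v t / 32) * n ^ q * 2 ^ q" by (simp add: power_mult_distrib)
    also have "\<dots> \<le> (32 * real N / c) ^ N * 2 ^ q" using 1 by (intro mult_right_mono) auto
    also have "\<dots> \<le> D" by (simp add: D_def R'_def)
    finally show ?thesis using n unfolding n_def[symmetric] by (subst pos_le_divide_eq) auto
  qed
  then show ?thesis using D0 by blast
qed

lemma completion_event_cong:
  assumes B: "B \<in> sets M" and A: "A \<subseteq> space M" and AE: "AE \<omega> in M. \<omega> \<in> A \<longleftrightarrow> \<omega> \<in> B"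
  shows "A \<in> sets (completion M)" and "emeasure (completion M) A = emeasure M B"
proof -
  have "Measurable.pred (completion M) (\<lambda>\<omega>. \<not> (\<omega> \<in> A \<longleftrightarrow> \<omega> \<in> B))"
    by (rule sets_completion_AE) (use AE in auto)
  moreover have "Measurable.pred (completion M) (\<lambda>\<omega>. \<omega> \<in> B)"
    using B by (intro measurable_completion) simp
  ultimately have "Measurable.pred (completion M) (\<lambda>\<omega>. (\<omega> \<in> B) \<noteq> (\<not> (\<omega> \<in> A \<longleftrightarrow> \<omega> \<in> B)))" by measurable
  then have "{\<omega>\<in>space (completion M). (\<omega> \<in> B) \<noteq> (\<not> (\<omega> \<in> A \<longleftrightarrow> \<omega> \<in> B))} \<in> sets (completion M)"
    by (simp only: pred_def)
  moreover have "{\<omega>\<in>space (completion M). (\<omega> \<in> B) \<noteq> (\<not> (\<omega> \<in> A \<longleftrightarrow> \<omega> \<in> B))} = A" using A by auto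
  ultimately show As: "A \<in> sets (completion M)" by simp
  have "emeasure (completion M) A = emeasure (completion M) B"
    by (rule emeasure_eq_AE) (use AE_completion[OF AE] As B in auto)
  then show "emeasure (completion M) A = emeasure M B" using B by simp
qed

context tilted_cells
begin

lemma mean_level_finite: "finite K \<Longrightarrow> mean_level K < \<infinity>"
proof -
  assume K: "finite K"
  have "cell_share ((\<lambda>k. k - h) ` K) < \<infinity>" for h
    using cell_share_le[of "(\<lambda>k. k - h) ` K"] sup_integrable K by (auto intro: le_less_trans)
  then show ?thesis unfolding mean_level_eq_sum[OF K] using K by simp
qed

lemma mean_level_mono: "finite K' \<Longrightarrow> K \<subseteq> K' \<Longrightarrow> mean_level K \<le> mean_level K'"
  unfolding mean_level_def by (intro nn_integral_mono level_mono)

lemma level_integrand_path_measurable: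
  "(\<lambda>(\<omega>, s). if (\<Sum>k\<in>K. occupation (path \<omega>) k s) > ennreal x then 1 else 0 :: ennreal)
    \<in> borel_measurable (M \<Otimes>\<^sub>M lborel)"
proof -
  have "path \<in> measurable M (Pi\<^sub>M UNIV (\<lambda>_. borel))"
    by (rule measurable_PiM_single') (auto simp: space_PiM)
  then have "(\<lambda>z. (path (fst z), snd z)) \<in> measurable (M \<Otimes>\<^sub>M lborel) (Pi\<^sub>M UNIV (\<lambda>_. borel) \<Otimes>\<^sub>M (lborel :: real measure))"
    by measurable
  from measurable_compose[OF this level_integrand_measurable[of K UNIV]] show ?thesis by (simp add: split_beta)
qed

text \<open>Only almost every path is continuous, so the event in the Berman functional agrees with the measurable
event about occupation times only up to a null set, which the completion absorbs. Fubini's theorem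
then interchanges the level integral with the expectation.\<close>

lemma berman_set_eq_mean_level:
  assumes "AE \<omega> in M. \<forall>s\<ge>0. (\<integral>\<^sup>+t\<in>E. indicator {s<..} (Z t \<omega>) \<partial>grid_measure \<delta>) = (\<Sum>k\<in>K. occupation (path \<omega>) k s)"
  shows "berman_set M Z \<delta> E x = mean_level K"
proof -
  have ev: "emeasure (completion M) {\<omega>\<in>space M. (\<integral>\<^sup>+t\<in>E. indicator {s<..} (Z t \<omega>) \<partial>grid_measure \<delta>) > ennreal x}
      = (\<integral>\<^sup>+\<omega>. (if (\<Sum>k\<in>K. occupation (path \<omega>) k s) > ennreal x then 1 else 0) \<partial>M)" if "0 \<le> s" for s
  proof -
    let ?A = "{\<omega>\<in>space M. (\<integral>\<^sup>+t\<in>E. indicator {s<..} (Z t \<omega>) \<partial>grid_measure \<delta>) > ennreal x}"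
    let ?B = "{\<omega>\<in>space M. (\<Sum>k\<in>K. occupation (path \<omega>) k s) > ennreal x}"
    have [measurable]: "(\<lambda>\<omega>. if (\<Sum>k\<in>K. occupation (path \<omega>) k s) > ennreal x then 1 else 0 :: ennreal) \<in> borel_measurable M"
    proof -
      have "(\<lambda>\<omega>. (\<omega>, s)) \<in> measurable M (M \<Otimes>\<^sub>M (lborel :: real measure))" by measurable
      from measurable_compose[OF this level_integrand_path_measurable[of K]] show ?thesis by simp
    qed
    have "?B = (\<lambda>\<omega>. if (\<Sum>k\<in>K. occupation (path \<omega>) k s) > ennreal x then 1 else 0 :: ennreal) -` {1} \<inter> space M"
      by (auto split: if_splits)
    also have "\<dots> \<in> sets M" by measurable
    finally have B: "?B \<in> sets M" .
    have AE: "AE \<omega> in M. \<omega> \<in> ?A \<longleftrightarrow> \<omega> \<in> ?B" using assms by eventually_elim (use that in auto)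
    have "emeasure (completion M) ?A = emeasure M ?B"
      by (rule completion_event_cong(2)[OF B _ AE]) auto
    also have "\<dots> = (\<integral>\<^sup>+\<omega>. indicator ?B \<omega> \<partial>M)" using B by simp
    also have "\<dots> = (\<integral>\<^sup>+\<omega>. (if (\<Sum>k\<in>K. occupation (path \<omega>) k s) > ennreal x then 1 else 0) \<partial>M)"
      by (intro nn_integral_cong) (auto simp: indicator_def)
    finally show ?thesis .
  qed
  interpret PS: pair_sigma_finite M lborel ..
  have m: "(\<lambda>z. indicator {0..} (snd z) * (if (\<Sum>k\<in>K. occupation (path (fst z)) k (snd z)) > ennreal x then 1 else 0) :: ennreal)
      \<in> borel_measurable (M \<Otimes>\<^sub>M (lborel :: real measure))"
    using level_integrand_path_measurable[of K] unfolding split_beta by measurable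
  have "berman_set M Z \<delta> E x =
     (\<integral>\<^sup>+s. (\<integral>\<^sup>+\<omega>. indicator {0..} s * (if (\<Sum>k\<in>K. occupation (path \<omega>) k s) > ennreal x then 1 else 0) \<partial>M) \<partial>lborel)"
    unfolding berman_set_def
  proof (rule nn_integral_cong)
    fix s
    show "emeasure (completion M) {\<omega>\<in>space M. (\<integral>\<^sup>+t\<in>E. indicator {s<..} (Z t \<omega>) \<partial>grid_measure \<delta>) > ennreal x} * indicator {0..} s
      = (\<integral>\<^sup>+\<omega>. indicator {0..} s * (if (\<Sum>k\<in>K. occupation (path \<omega>) k s) > ennreal x then 1 else 0) \<partial>M)"
      by (cases "0 \<le> s") (simp_all add: ev)
  qed
  also have "\<dots> = (\<integral>\<^sup>+\<omega>. (\<integral>\<^sup>+s. indicator {0..} s * (if (\<Sum>k\<in>K. occupation (path \<omega>) k s) > ennreal x then 1 else 0) \<partial>lborel) \<partial>M)"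
    using PS.Fubini[OF m] by simp
  also have "\<dots> = mean_level K" unfolding mean_level_def level_def ..
  finally show ?thesis .
qed

end

context controlled_cells
begin

lemma cell_share_finite: "finite K \<Longrightarrow> cell_share K < \<infinity>"
  using cell_share_le[of K] sup_integrable le_less_trans by blast

lemma overlap_finite: "overlap k < \<infinity>"
  using overlap_le[of k] by (rule le_less_trans) simp

end

lemma (in controlled_cells) cell_share_compare_real:
  assumes "finite K'" "K \<subseteq> K'" "0 \<in> K"
  shows "\<bar>enn2real (cell_share K') - enn2real (cell_share K)\<bar> \<le> (\<Sum>k\<in>K' - K. enn2real (overlap k))"
proof -
  have fK: "finite K" using assms finite_subset by auto
  have s: "cell_share K = ennreal (enn2real (cell_share K))" "cell_share K' = ennreal (enn2real (cell_share K'))"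
    using cell_share_finite[OF fK] cell_share_finite[OF assms(1)] by simp_all
  have "(\<Sum>k\<in>K' - K. overlap k) = (\<Sum>k\<in>K' - K. ennreal (enn2real (overlap k)))"
    using overlap_finite by (intro sum.cong) auto
  also have "\<dots> = ennreal (\<Sum>k\<in>K' - K. enn2real (overlap k))" by (rule sum_ennreal) simp
  finally have o: "(\<Sum>k\<in>K' - K. overlap k) = ennreal (\<Sum>k\<in>K' - K. enn2real (overlap k))" .
  have n: "0 \<le> (\<Sum>k\<in>K' - K. enn2real (overlap k))" by (intro sum_nonneg) simp
  have le: "A \<le> B + S" if "ennreal A \<le> ennreal B + ennreal S" "0 \<le> A" "0 \<le> B" "0 \<le> S" for A B S
    using that by (simp flip: ennreal_plus)
  have "enn2real (cell_share K') \<le> enn2real (cell_share K) + (\<Sum>k\<in>K' - K. enn2real (overlap k))"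
    by (rule le[OF _ _ _ n]) (use cell_share_compare(1)[OF assms] in \<open>simp_all only: o s[symmetric] enn2real_nonneg\<close>)
  moreover have "enn2real (cell_share K) \<le> enn2real (cell_share K') + (\<Sum>k\<in>K' - K. enn2real (overlap k))"
    by (rule le[OF _ _ _ n]) (use cell_share_compare(2)[OF assms] in \<open>simp_all only: o s[symmetric] enn2real_nonneg\<close>)
  ultimately show ?thesis by linarith
qed

lemma (in controlled_cells) mean_level_real:
  assumes "finite K"
  shows "enn2real (mean_level K) = (\<Sum>h\<in>K. enn2real (cell_share ((\<lambda>k. k - h) ` K)))"
proof -
  have "mean_level K = (\<Sum>h\<in>K. ennreal (enn2real (cell_share ((\<lambda>k. k - h) ` K))))"
    unfolding mean_level_eq_sum[OF assms] using cell_share_finite assms by (intro sum.cong) auto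
  also have "\<dots> = ennreal (\<Sum>h\<in>K. enn2real (cell_share ((\<lambda>k. k - h) ` K)))" by (rule sum_ennreal) simp
  finally show ?thesis by (simp add: sum_nonneg)
qed

lemma box_mean_level_rate:
  fixes V :: "real ^ 'n \<Rightarrow> 'a \<Rightarrow> real"
  assumes "controlled_cells M V \<kappa> P \<pi> C vm" and a: "0 < a" and \<epsilon>: "0 < \<epsilon>" "\<epsilon> < 1"
    and growth: "0 < c" "0 < \<alpha>" "\<And>t. R \<le> norm t \<Longrightarrow> c * norm t powr \<alpha> \<le> var_fn M V t"
  shows "\<exists>G C. 0 \<le> G \<and> 0 \<le> C \<and> (\<forall>\<^sub>F n in sequentially.
    \<bar>enn2real (tilted_cells.mean_level M V \<kappa> \<pi> x (lattice_box a (\<lambda>_. {0..<int n}))) - G * real n ^ CARD('n)\<bar>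
      \<le> C * real n powr (\<epsilon> - 1) * real n ^ CARD('n))"
proof -
  interpret controlled_cells M V \<kappa> P \<pi> x C vm by (rule assms(1))
  show ?thesis
  proof (rule box_average_rate[OF a \<epsilon>, where g = "\<lambda>K. enn2real (cell_share K)" and ov = "\<lambda>k. enn2real (overlap k)"
        and ?C0.0 = "enn2real (\<integral>\<^sup>+\<omega>. cell_sup (path \<omega>) 0 \<partial>M)"])
    fix K :: "(real ^ 'n) set" assume "finite K"
    then show "enn2real (cell_share K) \<le> enn2real (\<integral>\<^sup>+\<omega>. cell_sup (path \<omega>) 0 \<partial>M)"
      using cell_share_le[of K] sup_integrable by (intro enn2real_mono) auto
  next
    fix q
    obtain D where D: "0 \<le> D" "\<And>t. exp (- var_fn M V t / 32) \<le> D / (1 + norm t) ^ q"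
      using exp_growth_decay[of c \<alpha> "var_fn M V" R q] growth var_fn_nonneg by blast
    let ?L = "exp (3 * vm / 8) * ((1 + C) / 2)"
    have L: "0 \<le> ?L" using C_nonneg by simp
    have "enn2real (overlap k) \<le> ?L * D / (1 + norm k) ^ q" for k
    proof -
      have "enn2real (overlap k) \<le> ?L * exp (- var_fn M V k / 32)"
        using overlap_le[of k] L by (intro enn2real_leI) auto
      also have "\<dots> \<le> ?L * (D / (1 + norm k) ^ q)" using D(2) L by (intro mult_left_mono) auto
      finally show ?thesis by simp
    qed
    then show "\<exists>D\<ge>0. \<forall>k. enn2real (overlap k) \<le> D / (1 + norm k) ^ q"
      using L D(1) by (intro exI[of _ "?L * D"]) auto
  qed (use mean_level_real cell_share_compare_real in auto)
qed

section \<open>From lattice boxes to cubes with real side\<close>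

lemma one_plus_power_le:
  fixes z :: real assumes "0 \<le> z" "z \<le> 1"
  shows "(1 + z) ^ d \<le> 1 + 2 ^ d * z"
proof -
  have "(1 + z) ^ d \<le> 1 + (2 ^ d - 1) * z"
  proof (induction d)
    case (Suc d)
    have "(1 + z) ^ Suc d \<le> (1 + z) * (1 + (2 ^ d - 1) * z)" using Suc assms by (simp add: mult_left_mono)
    also have "\<dots> = 1 + 2 ^ d * z + (2 ^ d - 1) * (z * z)" by (simp add: algebra_simps)
    also have "\<dots> \<le> 1 + 2 ^ d * z + (2 ^ d - 1) * z"
      using assms by (intro add_left_mono mult_left_mono) (auto simp: mult_left_le)
    also have "\<dots> = 1 + (2 ^ Suc d - 1) * z" by (simp add: algebra_simps)
    finally show ?case .
  qed simp
  also have "\<dots> \<le> 1 + 2 ^ d * z" using assms by (simp add: algebra_simps)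
  finally show ?thesis .
qed

text \<open>Replacing \<open>u = T/a\<close> by its integer part changes the volume by a relative error \<open>O(1/u)\<close>, which is of
smaller order than \<open>u powr (\<epsilon> - 1)\<close>.\<close>

lemma sandwich_average_rate:
  fixes f :: "nat \<Rightarrow> real" and \<beta> :: "real \<Rightarrow> real"
  assumes a: "0 < a" and \<epsilon>: "0 < \<epsilon>" "\<epsilon> < 1" and G: "0 \<le> G" and C: "0 \<le> C"
    and rate: "\<forall>\<^sub>F n in sequentially. \<bar>f n - G * real n ^ d\<bar> \<le> C * real n powr (\<epsilon> - 1) * real n ^ d"
    and \<beta>: "\<forall>\<^sub>F T in at_top. f (nat \<lfloor>T / a\<rfloor>) \<le> \<beta> T \<and> \<beta> T \<le> f (Suc (nat \<lfloor>T / a\<rfloor>))"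
  shows "\<exists>C'. \<forall>\<^sub>F T in at_top. \<bar>\<beta> T / T ^ d - G / a ^ d\<bar> \<le> C' * T powr (\<epsilon> - 1)"
proof -
  define C1 where "C1 = G * 2 ^ d + G * real d + C * (1 + 2 ^ d) + 2 * C"
  define C' where "C' = C1 * a powr (1 - \<epsilon>) / a ^ d"
  obtain N where N: "\<And>n. N \<le> n \<Longrightarrow> \<bar>f n - G * real n ^ d\<bar> \<le> C * real n powr (\<epsilon> - 1) * real n ^ d"
    using rate unfolding eventually_sequentially by auto
  have "\<forall>\<^sub>F T in at_top. a * (real N + 2) \<le> T" by (rule eventually_ge_at_top)
  with \<beta> have "\<forall>\<^sub>F T in at_top. \<bar>\<beta> T / T ^ d - G / a ^ d\<bar> \<le> C' * T powr (\<epsilon> - 1)"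
  proof eventually_elim
    case (elim T)
    define u where "u = T / a"
    define n where "n = nat \<lfloor>u\<rfloor>"
    have u: "real N + 2 \<le> u" using elim(2) a by (simp add: u_def field_simps)
    then have u2: "2 \<le> u" by linarith
    have n: "real n \<le> u" "u < real n + 1" using u2 unfolding n_def by linarith+
    have Nn: "N \<le> n" using n u by linarith
    define p where "p = u powr (\<epsilon> - 1)"
    have p0: "0 \<le> p" by (simp add: p_def)
    have iu: "1 / u \<le> p"
      using u2 \<epsilon> powr_mono[of "-1" "\<epsilon> - 1" u] by (simp add: p_def powr_minus_divide)
    have p1: "p \<le> 1" using u2 \<epsilon> powr_mono[of "\<epsilon> - 1" 0 u] by (simp add: p_def)
    have ud: "0 < u ^ d" using u2 by simp
    have up: "real (Suc n) ^ d \<le> u ^ d * (1 + 2 ^ d * (1 / u))"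
    proof -
      have "real (Suc n) ^ d \<le> (u * (1 + 1 / u)) ^ d" using n u2 by (intro power_mono) (auto simp: field_simps)
      also have "\<dots> = u ^ d * (1 + 1 / u) ^ d" by (simp add: power_mult_distrib)
      also have "\<dots> \<le> u ^ d * (1 + 2 ^ d * (1 / u))"
        using u2 by (intro mult_left_mono one_plus_power_le) (auto simp: divide_simps)
      finally show ?thesis .
    qed
    have dn: "u ^ d * (1 - real d * (1 / u)) \<le> real n ^ d"
    proof -
      have "1 + real d * (- (1 / u)) \<le> (1 + - (1 / u)) ^ d"
        by (rule Bernoulli_inequality) (use u2 in \<open>simp add: divide_simps\<close>)
      then have "u ^ d * (1 - real d * (1 / u)) \<le> u ^ d * (1 + - (1 / u)) ^ d" using ud by (intro mult_left_mono) auto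
      also have "\<dots> = (u - 1) ^ d" using u2 by (simp flip: power_mult_distrib add: right_diff_distrib)
      also have "\<dots> \<le> real n ^ d" using n u2 by (intro power_mono) auto
      finally show ?thesis .
    qed
    have pS: "real (Suc n) powr (\<epsilon> - 1) \<le> p"
      unfolding p_def using n u2 \<epsilon> by (intro powr_mono2') auto
    have pn: "real n powr (\<epsilon> - 1) \<le> 2 * p"
    proof -
      have "real n powr (\<epsilon> - 1) \<le> (u / 2) powr (\<epsilon> - 1)" using n u2 \<epsilon> by (intro powr_mono2') auto
      also have "\<dots> = p * 2 powr (1 - \<epsilon>)"
        using u2 powr_minus_divide[of 2 "\<epsilon> - 1"] by (simp add: p_def powr_divide)
      also have "\<dots> \<le> p * 2 powr 1" using \<epsilon> p0 by (intro mult_left_mono powr_mono) auto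
      finally show ?thesis by simp
    qed
    have "\<beta> T \<le> f (Suc n)" using elim(1) by (simp add: n_def u_def)
    also have "\<dots> \<le> (G + C * real (Suc n) powr (\<epsilon> - 1)) * real (Suc n) ^ d"
      using N[of "Suc n"] Nn by (simp add: abs_le_iff algebra_simps)
    also have "\<dots> \<le> (G + C * p) * (u ^ d * (1 + 2 ^ d * (1 / u)))"
      using pS up G C p0 by (intro mult_mono add_left_mono mult_left_mono) auto
    also have "\<dots> = u ^ d * (G + C * p + G * 2 ^ d * (1 / u) + C * 2 ^ d * (p * (1 / u)))" by (simp add: algebra_simps add_divide_distrib)
    also have "\<dots> \<le> u ^ d * (G + C * p + G * 2 ^ d * p + C * 2 ^ d * (p * 1))"
      using iu p1 G C p0 ud by (intro mult_left_mono add_mono) auto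
    also have "\<dots> \<le> u ^ d * (G + C1 * p)"
      using ud G C p0 unfolding C1_def by (intro mult_left_mono) (auto simp: algebra_simps)
    finally have "\<beta> T / u ^ d \<le> G + C1 * p" using ud by (simp add: field_simps)
    moreover have "G - C1 * p \<le> \<beta> T / u ^ d"
    proof -
      have "u ^ d * (G - C1 * p) \<le> u ^ d * (G - G * real d * p - 2 * C * p)"
        using ud G C p0 unfolding C1_def by (intro mult_left_mono) (auto simp: algebra_simps)
      also have "\<dots> \<le> u ^ d * (G - G * real d * (1 / u) - 2 * C * p)"
        using ud G C iu by (intro mult_left_mono diff_mono) auto
      also have "\<dots> = G * (u ^ d * (1 - real d * (1 / u))) - C * (2 * p) * u ^ d" by (simp add: algebra_simps add_divide_distrib diff_divide_distrib)
      also have "\<dots> \<le> G * real n ^ d - C * real n powr (\<epsilon> - 1) * real n ^ d"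
      proof (rule diff_mono)
        show "G * (u ^ d * (1 - real d * (1 / u))) \<le> G * real n ^ d" using dn G by (intro mult_left_mono) auto
        have "real n ^ d \<le> u ^ d" using n by (intro power_mono) auto
        then show "C * real n powr (\<epsilon> - 1) * real n ^ d \<le> C * (2 * p) * u ^ d"
          using pn C p0 by (intro mult_mono mult_left_mono) auto
      qed
      also have "\<dots> \<le> f n" using N[OF Nn] by (simp add: abs_le_iff)
      also have "\<dots> \<le> \<beta> T" using elim(1) by (simp add: n_def u_def)
      finally show ?thesis using ud by (simp add: le_divide_eq mult.commute)
    qed
    ultimately have "\<bar>\<beta> T / u ^ d - G\<bar> \<le> C1 * p" by (simp add: abs_le_iff)
    then have "\<bar>\<beta> T / u ^ d - G\<bar> / a ^ d \<le> C1 * p / a ^ d" using a by (intro divide_right_mono) auto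
    moreover have "\<beta> T / T ^ d - G / a ^ d = (\<beta> T / u ^ d - G) / a ^ d"
      using a by (simp add: u_def power_divide diff_divide_distrib)
    moreover have "C1 * p / a ^ d = C' * T powr (\<epsilon> - 1)"
    proof -
      have T: "0 < T" using u2 a by (simp add: u_def divide_simps split: if_splits)
      have "p = T powr (\<epsilon> - 1) * a powr (1 - \<epsilon>)"
        using a T powr_minus_divide[of a "\<epsilon> - 1"] by (simp add: p_def u_def powr_divide)
      then show ?thesis by (simp add: C'_def)
    qed
    ultimately show ?case using a by (simp add: abs_divide)
  qed
  then show ?thesis by blast
qed

text \<open>The rate also shows that the limit defining the constant exists, so that \<open>Lim\<close> has its intended value.\<close>

lemma ereal_rate_limit:
  fixes \<beta> :: "real \<Rightarrow> ennreal"
  assumes fin: "\<forall>\<^sub>F T in at_top. \<beta> T = ennreal (r T) \<and> 0 \<le> r T"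
    and rate: "\<forall>\<^sub>F T in at_top. \<bar>r T / T ^ d - b\<bar> \<le> C' * T powr (\<epsilon> - 1)"
    and b: "0 \<le> b" and lam: "0 < lam" "lam + \<epsilon> < 1"
  shows "((\<lambda>T. \<bar>enn2ereal (Lim at_top (\<lambda>T. \<beta> T / ennreal (T ^ d))) - enn2ereal (\<beta> T) / ereal (T ^ d)\<bar>
      * ereal (T powr lam)) \<longlongrightarrow> 0) at_top"
proof -
  have z1: "((\<lambda>T::real. C' * T powr (\<epsilon> - 1)) \<longlongrightarrow> 0) at_top"
    using lam by (intro tendsto_mult_right_zero tendsto_neg_powr filterlim_ident) auto
  have z2: "((\<lambda>T::real. C' * T powr (\<epsilon> - 1 + lam)) \<longlongrightarrow> 0) at_top"
    using lam by (intro tendsto_mult_right_zero tendsto_neg_powr filterlim_ident) auto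
  have "((\<lambda>T. r T / T ^ d - b) \<longlongrightarrow> 0) at_top"
    by (rule Lim_null_comparison[OF _ z1]) (use rate in simp)
  then have "((\<lambda>T. r T / T ^ d) \<longlongrightarrow> b) at_top" by (simp add: LIM_zero_iff)
  then have l: "((\<lambda>T. ennreal (r T / T ^ d)) \<longlongrightarrow> ennreal b) at_top" by (rule tendsto_ennrealI)
  have "\<forall>\<^sub>F T in at_top. ennreal (r T / T ^ d) = \<beta> T / ennreal (T ^ d)"
    using fin eventually_gt_at_top[of 0] by eventually_elim (simp add: divide_ennreal)
  with l have "((\<lambda>T. \<beta> T / ennreal (T ^ d)) \<longlongrightarrow> ennreal b) at_top" by (rule Lim_transform_eventually)
  then have Lim: "Lim at_top (\<lambda>T. \<beta> T / ennreal (T ^ d)) = ennreal b" by (intro tendsto_Lim) auto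
  have "((\<lambda>T. \<bar>r T / T ^ d - b\<bar> * T powr lam) \<longlongrightarrow> 0) at_top"
  proof (rule Lim_null_comparison[OF _ z2])
    show "\<forall>\<^sub>F T in at_top. norm (\<bar>r T / T ^ d - b\<bar> * T powr lam) \<le> C' * T powr (\<epsilon> - 1 + lam)"
      using rate eventually_gt_at_top[of 0]
    proof eventually_elim
      case (elim T)
      have "\<bar>r T / T ^ d - b\<bar> * T powr lam \<le> C' * T powr (\<epsilon> - 1) * T powr lam"
        using elim by (intro mult_right_mono) auto
      then show ?case by (simp add: powr_add abs_mult mult.assoc)
    qed
  qed
  then have e: "((\<lambda>T. ereal (\<bar>r T / T ^ d - b\<bar> * T powr lam)) \<longlongrightarrow> ereal 0) at_top" by simp
  have "\<forall>\<^sub>F T in at_top. ereal (\<bar>r T / T ^ d - b\<bar> * T powr lam) =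
    \<bar>enn2ereal (Lim at_top (\<lambda>T. \<beta> T / ennreal (T ^ d))) - enn2ereal (\<beta> T) / ereal (T ^ d)\<bar> * ereal (T powr lam)"
    using fin eventually_gt_at_top[of 0] unfolding Lim
    by eventually_elim (simp add: b enn2ereal_ennreal abs_minus_commute)
  with e show ?thesis unfolding zero_ereal_def by (rule Lim_transform_eventually)
qed



section \<open>The growth of the variance\<close>

text \<open>Near 0 the bound is the hypothesis on the upper limit, and away from 0 it is boundedness of a
continuous function on a ball.\<close>

lemma holder_bound:
  fixes v :: "real ^ 'n \<Rightarrow> real"
  assumes cont: "continuous_on UNIV v" and v0: "v 0 = 0" and vn: "\<And>t. 0 \<le> v t"
    and \<alpha>: "0 < \<alpha>" and lim: "Limsup (at 0) (\<lambda>t. ereal (v t / norm t powr \<alpha>)) \<le> ereal A0"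
  shows "\<exists>A\<ge>0. \<forall>t. norm t \<le> R \<longrightarrow> v t \<le> A * norm t powr \<alpha>"
proof -
  have "Limsup (at 0) (\<lambda>t. ereal (v t / norm t powr \<alpha>)) < ereal (\<bar>A0\<bar> + 1)"
    using lim by (rule le_less_trans) simp
  then have "\<forall>\<^sub>F t in at 0. ereal (v t / norm t powr \<alpha>) < ereal (\<bar>A0\<bar> + 1)" by (rule Limsup_lessD)
  then obtain r where r: "0 < r" "\<And>t. t \<noteq> 0 \<Longrightarrow> dist t 0 < r \<Longrightarrow> v t / norm t powr \<alpha> < \<bar>A0\<bar> + 1"
    unfolding eventually_at by auto
  have "bounded (v ` cball 0 R)"
    by (intro compact_imp_bounded compact_continuous_image continuous_on_subset[OF cont]) auto
  then obtain B where B: "\<And>t. norm t \<le> R \<Longrightarrow> v t \<le> B" unfolding bounded_iff by (force simp: abs_le_iff)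
  define A where "A = \<bar>A0\<bar> + 1 + \<bar>B\<bar> / r powr \<alpha>"
  have "v t \<le> A * norm t powr \<alpha>" if "norm t \<le> R" for t
  proof (cases "t = 0")
    case False
    show ?thesis
    proof (cases "norm t < r")
      case True
      have "v t \<le> (\<bar>A0\<bar> + 1) * norm t powr \<alpha>" using r(2)[OF False] True False by (simp add: pos_divide_less_eq)
      also have "\<dots> \<le> A * norm t powr \<alpha>" by (intro mult_right_mono) (auto simp: A_def)
      finally show ?thesis .
    next
      case ge: False
      have "v t \<le> \<bar>B\<bar> * 1" using B[OF that] by simp
      also have "\<dots> \<le> \<bar>B\<bar> * (norm t powr \<alpha> / r powr \<alpha>)"
        using ge r(1) \<alpha> by (intro mult_left_mono) (auto simp: powr_mono2)
      also have "\<dots> = \<bar>B\<bar> / r powr \<alpha> * norm t powr \<alpha>" by simp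
      also have "\<dots> \<le> A * norm t powr \<alpha>" by (intro mult_right_mono) (auto simp: A_def)
      finally show ?thesis .
    qed
  qed (simp add: v0)
  then show ?thesis by (intro exI[of _ A]) (auto simp: A_def)
qed

lemma power_growth:
  fixes v :: "real ^ 'n \<Rightarrow> real"
  assumes "0 < Liminf at_infinity (\<lambda>t. ereal (v t / norm t powr \<alpha>))"
  shows "\<exists>c R. 0 < c \<and> (\<forall>t. R \<le> norm t \<longrightarrow> c * norm t powr \<alpha> \<le> v t)"
proof -
  obtain c where c: "0 < ereal c" "ereal c < Liminf at_infinity (\<lambda>t. ereal (v t / norm t powr \<alpha>))"
    using ereal_dense2[OF assms] by auto
  then have "\<forall>\<^sub>F t in at_infinity. ereal c < ereal (v t / norm t powr \<alpha>)" by (intro less_LiminfD)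
  then obtain R where R: "\<And>t. R \<le> norm t \<Longrightarrow> c < v t / norm t powr \<alpha>"
    unfolding eventually_at_infinity by auto
  have "c * norm t powr \<alpha> \<le> v t" if "max R 1 \<le> norm t" for t
  proof -
    have "0 < norm t" using that by linarith
    then have "0 < norm t powr \<alpha>" by simp
    then show ?thesis using R[of t] that by (simp add: pos_less_divide_eq less_imp_le)
  qed
  then show ?thesis using c by (intro exI[of _ c] exI[of _ "max R 1"]) auto
qed

section \<open>Dyadic rounding\<close>

definition dyadic_floor :: "nat \<Rightarrow> real ^ 'n \<Rightarrow> real ^ 'n" where
  "dyadic_floor n t = (\<chi> i. of_int \<lfloor>2 ^ n * t $ i\<rfloor> / 2 ^ n)"

definition unit_cell :: "(real ^ 'n) set" where
  "unit_cell = {t. \<forall>i. 0 \<le> t $ i \<and> t $ i < 1}"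

definition dyadic_net :: "nat \<Rightarrow> (real ^ 'n) set" where
  "dyadic_net n = {t \<in> unit_cell. dyadic_floor n t = t}"

lemma dyadic_floor_bounds: "dyadic_floor n t $ i \<le> t $ i" "t $ i < dyadic_floor n t $ i + 1 / 2 ^ n"
  unfolding dyadic_floor_def
  using floor_correct[of "2 ^ n * t $ i"] by (auto simp: divide_simps mult.commute)

lemma floor_half_floor_double: "\<lfloor>real_of_int \<lfloor>2 * y\<rfloor> / 2\<rfloor> = \<lfloor>y :: real\<rfloor>"
proof (rule floor_unique)
  have "2 * \<lfloor>y\<rfloor> \<le> \<lfloor>2 * y\<rfloor>" by (simp add: le_floor_iff)
  then show "real_of_int \<lfloor>y\<rfloor> \<le> real_of_int \<lfloor>2 * y\<rfloor> / 2" by linarith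
  show "real_of_int \<lfloor>2 * y\<rfloor> / 2 < real_of_int \<lfloor>y\<rfloor> + 1" by linarith
qed

text \<open>Rounding is consistent between levels, so the successive roundings of a point form a chain.\<close>

lemma dyadic_floor_nested: "dyadic_floor n (dyadic_floor (Suc n) t) = dyadic_floor n t"
  using floor_half_floor_double[of "2 ^ n * t $ i" for i] by (simp add: dyadic_floor_def vec_eq_iff mult.assoc)

lemma dyadic_floor_idem: "dyadic_floor n (dyadic_floor n t) = dyadic_floor n t"
  by (simp add: dyadic_floor_def vec_eq_iff)

lemma dyadic_floor_unit_cell: "t \<in> unit_cell \<Longrightarrow> dyadic_floor n t \<in> unit_cell"
  using le_less_trans[OF dyadic_floor_bounds(1)[of n t]] by (auto simp: unit_cell_def) (simp add: dyadic_floor_def)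

lemma dyadic_floor_eq_lattice_point: "dyadic_floor n t = lattice_point (1 / 2 ^ n) (\<lambda>i. \<lfloor>2 ^ n * t $ i\<rfloor>)"
  by (simp add: dyadic_floor_def lattice_point_def)

lemma dyadic_floor_tendsto: "(\<lambda>n. dyadic_floor n t) \<longlonglongrightarrow> t"
proof (rule vec_tendstoI)
  fix i
  have "(\<lambda>n. t $ i - (1 / 2) ^ n) \<longlonglongrightarrow> t $ i - 0" by (intro tendsto_intros LIMSEQ_power_zero) simp
  then have l: "(\<lambda>n. t $ i - (1 / 2) ^ n) \<longlonglongrightarrow> t $ i" by simp
  show "(\<lambda>n. dyadic_floor n t $ i) \<longlonglongrightarrow> t $ i"
  proof (rule tendsto_sandwich[OF _ _ l tendsto_const])
    show "\<forall>\<^sub>F n in sequentially. t $ i - (1 / 2) ^ n \<le> dyadic_floor n t $ i"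
      using dyadic_floor_bounds(2)[of t i] by (intro always_eventually allI) (simp add: power_divide less_imp_le diff_le_eq)
    show "\<forall>\<^sub>F n in sequentially. dyadic_floor n t $ i \<le> t $ i"
      by (intro always_eventually allI dyadic_floor_bounds)
  qed
qed

lemma norm_diff_dyadic_floor: "norm (t - dyadic_floor n (t :: real ^ 'n)) \<le> real CARD('n) * (1 / 2) ^ n"
proof -
  have "norm (t - dyadic_floor n t) \<le> (\<Sum>i\<in>UNIV. \<bar>(t - dyadic_floor n t) $ i\<bar>)" by (rule norm_le_l1_cart)
  also have "\<dots> \<le> (\<Sum>i\<in>(UNIV :: 'n set). (1 / 2) ^ n)"
  proof (rule sum_mono)
    fix i show "\<bar>(t - dyadic_floor n t) $ i\<bar> \<le> (1 / 2) ^ n"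
      using dyadic_floor_bounds[where n = n and t = t and i = i] by (simp add: power_divide)
  qed
  finally show ?thesis by simp
qed

lemma dyadic_net_subset: "dyadic_net n \<subseteq> lattice_point (1 / 2 ^ n) ` Pi UNIV (\<lambda>_. {0..<2 ^ n})"
proof
  fix t :: "real ^ 'n" assume t: "t \<in> dyadic_net n"
  have "t = lattice_point (1 / 2 ^ n) (\<lambda>i. \<lfloor>2 ^ n * t $ i\<rfloor>)"
    using t dyadic_floor_eq_lattice_point[of n t] by (simp add: dyadic_net_def)
  moreover have "\<lfloor>2 ^ n * t $ i\<rfloor> \<in> {0..<2 ^ n}" for i
    using t by (auto simp: dyadic_net_def unit_cell_def floor_less_iff)
  ultimately show "t \<in> lattice_point (1 / 2 ^ n) ` Pi UNIV (\<lambda>_. {0..<2 ^ n})" by blast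
qed

lemma finite_dyadic_net: "finite (dyadic_net n)"
  by (rule finite_subset[OF dyadic_net_subset]) (simp flip: PiE_UNIV_domain add: finite_PiE)

lemma card_dyadic_net: "card (dyadic_net n :: (real ^ 'n) set) \<le> (2 ^ n) ^ CARD('n)"
proof -
  have "card (dyadic_net n :: (real ^ 'n) set) \<le> card (lattice_point (1 / 2 ^ n) ` Pi (UNIV :: 'n set) (\<lambda>_. {0..<2 ^ n}))"
    by (rule card_mono[OF _ dyadic_net_subset]) (simp flip: PiE_UNIV_domain add: finite_PiE)
  also have "\<dots> \<le> card (Pi (UNIV :: 'n set) (\<lambda>_. {0..<2 ^ n :: int}))"
    by (rule card_image_le) (simp flip: PiE_UNIV_domain add: finite_PiE)
  also have "\<dots> = (2 ^ n) ^ CARD('n)" by (simp add: card_int_box nat_power_eq)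
  finally show ?thesis .
qed

lemma countable_range_dyadic_floor: "countable (range (dyadic_floor n))"
  by (rule countable_subset[of _ "range (lattice_point (1 / 2 ^ n))"]) (auto simp: dyadic_floor_eq_lattice_point)

lemma borel_measurable_vec_nth[measurable]: "(\<lambda>t :: real ^ 'n. t $ i) \<in> borel_measurable borel"
  by (intro borel_measurable_continuous_onI continuous_intros)

lemma measurable_dyadic_floor: "dyadic_floor n \<in> measurable borel (count_space (range (dyadic_floor n)))"
proof (rule measurable_count_space_eq_countable[OF countable_range_dyadic_floor, THEN iffD2], intro conjI ballI)
  fix p :: "real ^ 'n"
  have "dyadic_floor n -` {p} \<inter> space borel = {t. \<forall>i. real_of_int \<lfloor>2 ^ n * t $ i\<rfloor> / 2 ^ n = p $ i}"
    by (auto simp: dyadic_floor_def vec_eq_iff)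
  also have "\<dots> \<in> sets borel" by measurable
  finally show "dyadic_floor n -` {p} \<inter> space borel \<in> sets borel" .
qed auto

lemma unit_cell_borel[measurable]: "unit_cell \<in> sets borel"
proof -
  show ?thesis unfolding unit_cell_def by measurable
qed

lemma emeasure_unit_cell: "emeasure lborel (unit_cell :: (real ^ 'n) set) < \<infinity>"
proof -
  have "emeasure lborel (unit_cell :: (real ^ 'n) set) \<le> emeasure lborel (cbox 0 (1 :: real ^ 'n))"
    by (intro emeasure_mono) (auto simp: unit_cell_def mem_box_cart less_imp_le)
  also have "\<dots> < \<infinity>" by (rule emeasure_lborel_cbox_finite)
  finally show ?thesis .
qed

text \<open>Half-open cells tile the space: the only cell that contains \<open>t\<close> is the one at the integer part of \<open>t\<close>.\<close>

lemma sum_indicator_unit_cell: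
  assumes "finite K" "K \<subseteq> range (lattice_point 1)"
  shows "(\<Sum>k\<in>K. indicator unit_cell (t - k)) = (indicator {t. dyadic_floor 0 t \<in> K} t :: ennreal)"
proof -
  have "indicator unit_cell (t - k) = (if k = dyadic_floor 0 t then 1 else 0 :: ennreal)" if kK: "k \<in> K" for k
  proof -
    obtain j where k: "k = lattice_point 1 j" using kK assms(2) by blast
    have "t - k \<in> unit_cell \<longleftrightarrow> (\<forall>i. j i = \<lfloor>t $ i\<rfloor>)"
      unfolding unit_cell_def k lattice_point_def by (auto simp: floor_eq_iff eq_commute[of "j _"] algebra_simps)
    also have "\<dots> \<longleftrightarrow> k = dyadic_floor 0 t" unfolding k by (auto simp: lattice_point_def dyadic_floor_def vec_eq_iff)
    finally show ?thesis by (simp add: indicator_def)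
  qed
  then have "(\<Sum>k\<in>K. indicator unit_cell (t - k)) = (\<Sum>k\<in>K. if k = dyadic_floor 0 t then 1 else 0 :: ennreal)"
    by (intro sum.cong) auto
  then show ?thesis using assms(1) by (simp add: sum.delta indicator_def)
qed

lemma nn_integral_lattice_tiling:
  fixes g :: "real ^ 'n \<Rightarrow> ennreal"
  assumes K: "finite K" "K \<subseteq> range (lattice_point 1)" and [measurable]: "g \<in> borel_measurable borel"
  shows "(\<integral>\<^sup>+t\<in>{t. dyadic_floor 0 t \<in> K}. g t \<partial>lborel) = (\<Sum>k\<in>K. \<integral>\<^sup>+t. g (k + t) \<partial>restrict_space lborel unit_cell)"
proof -
  have "(\<integral>\<^sup>+t\<in>{t. dyadic_floor 0 t \<in> K}. g t \<partial>lborel) = (\<integral>\<^sup>+t. (\<Sum>k\<in>K. g t * indicator unit_cell (t - k)) \<partial>lborel)"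
    by (simp only: sum_indicator_unit_cell[OF K, symmetric] sum_distrib_left)
  also have "\<dots> = (\<Sum>k\<in>K. \<integral>\<^sup>+t. g t * indicator unit_cell (t - k) \<partial>lborel)"
    by (rule nn_integral_sum) measurable
  also have "\<dots> = (\<Sum>k\<in>K. \<integral>\<^sup>+t. g (k + t) \<partial>restrict_space lborel unit_cell)"
  proof (rule sum.cong[OF refl])
    fix k
    have "(\<integral>\<^sup>+t. g t * indicator unit_cell (t - k) \<partial>lborel) = (\<integral>\<^sup>+t. g t * indicator unit_cell (t - k) \<partial>distr lborel borel ((+) k))"
      by (simp only: lborel_distr_plus)
    also have "\<dots> = (\<integral>\<^sup>+t. g (k + t) * indicator unit_cell t \<partial>lborel)"
      by (subst nn_integral_distr) auto
    also have "\<dots> = (\<integral>\<^sup>+t. g (k + t) \<partial>restrict_space lborel unit_cell)"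
      by (rule nn_integral_restrict_space[symmetric]) simp
    finally show "(\<integral>\<^sup>+t. g t * indicator unit_cell (t - k) \<partial>lborel) = (\<integral>\<^sup>+t. g (k + t) \<partial>restrict_space lborel unit_cell)" .
  qed
  finally show ?thesis .
qed


lemma cube_as_floor:
  "{t. dyadic_floor 0 t \<in> lattice_box 1 (\<lambda>_. {0..<int n})} = {t :: real ^ 'n. \<forall>i. 0 \<le> t $ i \<and> t $ i < real n}"
proof (rule set_eqI)
  fix t :: "real ^ 'n"
  have "dyadic_floor 0 t = lattice_point 1 (\<lambda>i. \<lfloor>t $ i\<rfloor>)" using dyadic_floor_eq_lattice_point[of 0 t] by simp
  then have "dyadic_floor 0 t \<in> lattice_box 1 (\<lambda>_. {0..<int n}) \<longleftrightarrow> (\<lambda>i. \<lfloor>t $ i\<rfloor>) \<in> Pi UNIV (\<lambda>_. {0..<int n})"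
    unfolding lattice_box_def using inj_image_mem_iff[OF inj_lattice_point[of 1]] by simp
  also have "\<dots> \<longleftrightarrow> (\<forall>i. 0 \<le> t $ i \<and> t $ i < real n)" by (auto simp: floor_less_iff)
  finally show "t \<in> {t. dyadic_floor 0 t \<in> lattice_box 1 (\<lambda>_. {0..<int n})} \<longleftrightarrow> t \<in> {t. \<forall>i. 0 \<le> t $ i \<and> t $ i < real n}" by simp
qed

lemma cube_borel: "cube T \<in> sets borel"
proof -
  show ?thesis unfolding cube_def by measurable
qed

lemma cube_grid_eq_lattice_box:
  assumes "0 < \<delta>" "0 \<le> T"
  shows "cube T \<inter> grid \<delta> = lattice_box \<delta> (\<lambda>_. {0..<int (Suc (nat \<lfloor>T / \<delta>\<rfloor>))})"
proof -
  have *: "(0 \<le> \<delta> * of_int k \<and> \<delta> * of_int k \<le> T) \<longleftrightarrow> k \<in> {0..<int (Suc (nat \<lfloor>T / \<delta>\<rfloor>))}" for k :: int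
  proof -
    have "0 \<le> \<lfloor>T / \<delta>\<rfloor>" using assms by simp
    moreover have "\<delta> * of_int k \<le> T \<longleftrightarrow> k \<le> \<lfloor>T / \<delta>\<rfloor>" using assms by (simp add: le_floor_iff pos_le_divide_eq mult.commute)
    moreover have "0 \<le> \<delta> * of_int k \<longleftrightarrow> 0 \<le> k" using assms by (simp add: zero_le_mult_iff)
    ultimately show ?thesis by auto
  qed
  show ?thesis
  proof (intro equalityI subsetI)
    fix t :: "real ^ 'n" assume t: "t \<in> cube T \<inter> grid \<delta>"
    then obtain j where j: "\<And>i. t $ i = \<delta> * of_int (j i)" using assms unfolding grid_def by simp metis
    have "t = lattice_point \<delta> j" using j by (simp add: lattice_point_def vec_eq_iff)
    moreover have "j \<in> Pi UNIV (\<lambda>_. {0..<int (Suc (nat \<lfloor>T / \<delta>\<rfloor>))})"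
      using t j *[of "j _"] by (auto simp: cube_def simp del: atLeastLessThan_iff of_nat_Suc)
    ultimately show "t \<in> lattice_box \<delta> (\<lambda>_. {0..<int (Suc (nat \<lfloor>T / \<delta>\<rfloor>))})" unfolding lattice_box_def by blast
  next
    fix t :: "real ^ 'n" assume "t \<in> lattice_box \<delta> (\<lambda>_. {0..<int (Suc (nat \<lfloor>T / \<delta>\<rfloor>))})"
    then obtain j where t: "t = lattice_point \<delta> j" and "j \<in> Pi UNIV (\<lambda>_. {0..<int (Suc (nat \<lfloor>T / \<delta>\<rfloor>))})"
      unfolding lattice_box_def by blast
    then have j: "j i \<in> {0..<int (Suc (nat \<lfloor>T / \<delta>\<rfloor>))}" for i by blast
    show "t \<in> cube T \<inter> grid \<delta>" using *[of "j _", THEN iffD2, OF j] assms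
      unfolding t cube_def grid_def lattice_point_def by auto
  qed
qed

section \<open>The rate, given a sandwich between lattice boxes\<close>

lemma berman_rate_of_sandwich:
  fixes V :: "real ^ 'n \<Rightarrow> 'a \<Rightarrow> real" and Z :: "real ^ 'n \<Rightarrow> 'a \<Rightarrow> real"
  assumes cells: "controlled_cells M V \<kappa> P \<pi> C vm" and a: "0 < a" and lam: "0 < lam" "lam < 1"
    and growth: "0 < c" "0 < \<alpha>" "\<And>t. R \<le> norm t \<Longrightarrow> c * norm t powr \<alpha> \<le> var_fn M V t"
    and sandwich: "\<And>T. 0 \<le> T \<Longrightarrow>
       tilted_cells.mean_level M V \<kappa> \<pi> x (lattice_box a (\<lambda>_. {0..<int (nat \<lfloor>T / a\<rfloor>)})) \<le> berman_set M Z \<delta> (cube T \<inter> grid \<delta>) x \<and>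
       berman_set M Z \<delta> (cube T \<inter> grid \<delta>) x \<le> tilted_cells.mean_level M V \<kappa> \<pi> x (lattice_box a (\<lambda>_. {0..<int (Suc (nat \<lfloor>T / a\<rfloor>))}))"
  shows "((\<lambda>T. \<bar>enn2ereal (berman M Z \<delta> x) - enn2ereal (berman_set M Z \<delta> (cube T \<inter> grid \<delta>) x) / ereal (T ^ CARD('n))\<bar>
            * ereal (T powr lam)) \<longlongrightarrow> 0) at_top"
proof -
  interpret controlled_cells M V \<kappa> P \<pi> x C vm by (rule cells)
  define \<epsilon> where "\<epsilon> = (1 - lam) / 2"
  have \<epsilon>: "0 < \<epsilon>" "\<epsilon> < 1" "lam + \<epsilon> < 1" using lam unfolding \<epsilon>_def by (simp_all add: field_simps)
  define K where "K n = (lattice_box a (\<lambda>_. {0..<int n}) :: (real ^ 'n) set)" for n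
  have fK: "finite (K n)" for n unfolding K_def by (rule finite_lattice_box) simp
  define f where "f n = enn2real (mean_level (K n))" for n
  have f: "mean_level (K n) = ennreal (f n)" for n using mean_level_finite[OF fK] by (simp add: f_def)
  define \<beta> where "\<beta> T = berman_set M Z \<delta> (cube T \<inter> grid \<delta>) x" for T
  define r where "r T = enn2real (\<beta> T)" for T
  have sw: "ennreal (f (nat \<lfloor>T / a\<rfloor>)) \<le> \<beta> T" "\<beta> T \<le> ennreal (f (Suc (nat \<lfloor>T / a\<rfloor>)))" if "0 \<le> T" for T
    using sandwich[OF that] by (simp_all only: f[symmetric] K_def \<beta>_def)
  have \<beta>r: "\<beta> T = ennreal (r T)" if "0 \<le> T" for T
  proof -
    have "\<beta> T < top" using sw(2)[OF that] by (rule le_less_trans) simp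
    then show ?thesis by (simp add: r_def)
  qed
  have f0: "0 \<le> f n" and r0: "0 \<le> r T" for n T by (simp_all add: f_def r_def)
  have ge0: "\<forall>\<^sub>F T :: real in at_top. 0 \<le> T" by (rule eventually_ge_at_top)
  have "\<exists>G C. 0 \<le> G \<and> 0 \<le> C \<and> (\<forall>\<^sub>F n in sequentially.
      \<bar>f n - G * real n ^ CARD('n)\<bar> \<le> C * real n powr (\<epsilon> - 1) * real n ^ CARD('n))"
    unfolding f_def K_def by (rule box_mean_level_rate[OF cells a \<epsilon>(1,2) growth])
  then obtain G C' where G: "0 \<le> G" "0 \<le> C'"
    and rate: "\<forall>\<^sub>F n in sequentially. \<bar>f n - G * real n ^ CARD('n)\<bar> \<le> C' * real n powr (\<epsilon> - 1) * real n ^ CARD('n)"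
    by (elim exE conjE)
  have "\<forall>\<^sub>F T in at_top. f (nat \<lfloor>T / a\<rfloor>) \<le> r T \<and> r T \<le> f (Suc (nat \<lfloor>T / a\<rfloor>))"
    using ge0
  proof eventually_elim
    case (elim T)
    show ?case using sw[OF elim] f0 r0 by (simp add: \<beta>r[OF elim])
  qed
  from sandwich_average_rate[OF a \<epsilon>(1,2) G rate this]
  obtain C'' where r: "\<forall>\<^sub>F T in at_top. \<bar>r T / T ^ CARD('n) - G / a ^ CARD('n)\<bar> \<le> C'' * T powr (\<epsilon> - 1)" by blast
  have "\<forall>\<^sub>F T in at_top. \<beta> T = ennreal (r T) \<and> 0 \<le> r T"
    using ge0 by eventually_elim (use \<beta>r r0 in blast)
  from ereal_rate_limit[OF this r _ lam(1) \<epsilon>(3)] G a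
  show ?thesis unfolding berman_def \<beta>_def by simp
qed

lemma holder_variance:
  fixes V :: "real ^ 'n \<Rightarrow> 'a \<Rightarrow> real"
  assumes "gaussian_field M V" "cond_A1 (var_fn M V)"
  shows "\<exists>A \<alpha>. 0 \<le> A \<and> 0 < \<alpha> \<and> (\<forall>t. norm t \<le> R \<longrightarrow> var_fn M V t \<le> A * norm t powr \<alpha>)"
proof -
  interpret gaussian_field M V by fact
  show ?thesis using assms(2) holder_bound[of "var_fn M V" _ _ R] var_0 var_fn_nonneg unfolding cond_A1_def by blast
qed

section \<open>The discrete grid\<close>

text \<open>Each cell is a single grid point of mass \<open>\<delta>^d\<close>, so there is no fluctuation inside a cell. The part of
the grid in a cube is exactly a lattice box.\<close>

lemma berman_rate_grid:
  fixes V :: "real ^ 'n \<Rightarrow> 'a \<Rightarrow> real"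
  assumes field: "gaussian_field M V" and \<delta>: "0 < \<delta>" and lam: "0 < lam" "lam < 1"
    and growth: "0 < c" "0 < \<alpha>" "\<And>t. R \<le> norm t \<Longrightarrow> c * norm t powr \<alpha> \<le> var_fn M V t"
  shows "((\<lambda>T. \<bar>enn2ereal (berman M (Z_field M V) \<delta> x) - enn2ereal (berman_set M (Z_field M V) \<delta> (cube T \<inter> grid \<delta>) x) / ereal (T ^ CARD('n))\<bar>
            * ereal (T powr lam)) \<longlongrightarrow> 0) at_top"
proof -
  interpret gaussian_field M V by fact
  define \<kappa> where "\<kappa> = scale_measure (ennreal (\<delta> ^ CARD('n))) (count_space {0 :: real ^ 'n})"
  define \<pi> where "\<pi> = (\<lambda>(n :: nat) (t :: real ^ 'n). 0 :: real ^ 'n)"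
  have int: "(\<integral>\<^sup>+t. h t \<partial>\<kappa>) = ennreal (\<delta> ^ CARD('n)) * h 0" for h
    unfolding \<kappa>_def by (subst nn_integral_scale_measure) (simp_all add: nn_integral_count_space_finite)
  have fin: "finite_measure \<kappa>"
    unfolding \<kappa>_def by (intro finite_measureI) (simp add: space_scale_measure ennreal_mult_less_top)
  interpret cell \<kappa> "{0}" \<pi> x
  proof (intro cell.intro fin cell_axioms.intro)
    fix n show "\<pi> n \<in> measurable \<kappa> (count_space {0})" by (simp add: \<pi>_def)
  qed auto
  have cells: "controlled_cells M V \<kappa> {0} \<pi> 1 0"
    by unfold_locales (auto simp: emeasure_space_1 var_0)
  interpret controlled_cells M V \<kappa> "{0}" \<pi> x 1 0 by (rule cells)
  have occ: "occupation (path \<omega>) k s = ennreal (\<delta> ^ CARD('n)) * indicator {s<..} (Z_field M V k \<omega>)" if "0 \<le> s" for \<omega> k s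
  proof -
    have "cell_val (path \<omega>) k 0 = ennreal (Z_field M V k \<omega>)"
      unfolding cell_val_def by (simp add: \<pi>_def Limsup_const logZ_def Z_field_def)
    then show ?thesis unfolding occupation_def int using that
      by (simp add: indicator_def Z_field_def ennreal_less_iff)
  qed
  have grid: "(\<integral>\<^sup>+t\<in>E. h t \<partial>grid_measure \<delta>) = ennreal (\<delta> ^ CARD('n)) * (\<Sum>t\<in>E. h t)"
    if "finite E" "E \<subseteq> grid \<delta>" for E and h :: "real ^ 'n \<Rightarrow> ennreal"
  proof -
    have "(\<integral>\<^sup>+t\<in>E. h t \<partial>grid_measure \<delta>) = ennreal (\<delta> ^ CARD('n)) * (\<integral>\<^sup>+t. h t * indicator E t \<partial>count_space (grid \<delta>))"
      unfolding grid_measure_def using \<delta> by (simp add: nn_integral_scale_measure)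
    also have "(\<integral>\<^sup>+t. h t * indicator E t \<partial>count_space (grid \<delta>)) = (\<Sum>t\<in>E. h t * indicator E t)"
      by (rule nn_integral_count_space'[OF that(1) _ that(2)]) simp
    also have "\<dots> = (\<Sum>t\<in>E. h t)" by (intro sum.cong) auto
    finally show ?thesis .
  qed
  have eq: "berman_set M (Z_field M V) \<delta> (cube T \<inter> grid \<delta>) x = mean_level (lattice_box \<delta> (\<lambda>_. {0..<int (Suc (nat \<lfloor>T / \<delta>\<rfloor>))}))"
    if "0 \<le> T" for T
  proof (rule berman_set_eq_mean_level, intro AE_I2 allI impI)
    fix \<omega> and s :: real assume s: "0 \<le> s"
    let ?E = "lattice_box \<delta> (\<lambda>_. {0..<int (Suc (nat \<lfloor>T / \<delta>\<rfloor>))}) :: (real ^ 'n) set"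
    have E: "cube T \<inter> grid \<delta> = ?E" by (rule cube_grid_eq_lattice_box[OF \<delta> that])
    have "finite ?E" by (rule finite_lattice_box) simp
    moreover have "?E \<subseteq> grid \<delta>" using E by blast
    ultimately show "(\<integral>\<^sup>+t\<in>cube T \<inter> grid \<delta>. indicator {s<..} (Z_field M V t \<omega>) \<partial>grid_measure \<delta>) = (\<Sum>k\<in>?E. occupation (path \<omega>) k s)"
      unfolding E by (simp add: grid occ[OF s] sum_distrib_left)
  qed
  show ?thesis
  proof (rule berman_rate_of_sandwich[OF cells \<delta> lam growth])
    fix T :: real assume T: "0 \<le> T"
    show "mean_level (lattice_box \<delta> (\<lambda>_. {0..<int (nat \<lfloor>T / \<delta>\<rfloor>)})) \<le> berman_set M (Z_field M V) \<delta> (cube T \<inter> grid \<delta>) x \<and>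
       berman_set M (Z_field M V) \<delta> (cube T \<inter> grid \<delta>) x \<le> mean_level (lattice_box \<delta> (\<lambda>_. {0..<int (Suc (nat \<lfloor>T / \<delta>\<rfloor>))}))"
      unfolding eq[OF T] by (intro conjI mean_level_mono finite_lattice_box lattice_box_mono) auto
  qed
qed


section \<open>The continuum\<close>

text \<open>The cells are half-open unit cubes with Lebesgue measure, \<open>P\<close> consists of their dyadic points, and
rounding provides both the maps \<open>\<pi> n\<close> and the chain of projections. For a continuous path, values at
dyadic points determine the path, so occupation times are the Lebesgue measures in the Berman
functional. A cube is only sandwiched between unions of cells, hence monotonicity of the Berman
functional in the set is proved first; it needs measurability of the events for the larger set.\<close>

lemma berman_rate_continuum:
  fixes V :: "real ^ 'n \<Rightarrow> 'a \<Rightarrow> real"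
  assumes field: "gaussian_field M V" and lam: "0 < lam" "lam < 1"
    and paths: "AE \<omega> in M. continuous_on UNIV (\<lambda>t. V t \<omega>)" and A1: "cond_A1 (var_fn M V)"
    and growth: "0 < c" "0 < \<alpha>" "\<And>t. R \<le> norm t \<Longrightarrow> c * norm t powr \<alpha> \<le> var_fn M V t"
  shows "((\<lambda>T. \<bar>enn2ereal (berman M (Z_field M V) 0 x) - enn2ereal (berman_set M (Z_field M V) 0 (cube T \<inter> grid 0) x) / ereal (T ^ CARD('n))\<bar>
            * ereal (T powr lam)) \<longlongrightarrow> 0) at_top"
proof -
  interpret gaussian_field M V by fact
  let ?d = "CARD('n)"
  define \<kappa> where "\<kappa> = restrict_space lborel (unit_cell :: (real ^ 'n) set)"
  define P where "P = {p \<in> (unit_cell :: (real ^ 'n) set). \<exists>N. dyadic_floor N p = p}"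
  have cP: "countable P"
  proof (rule countable_subset)
    show "P \<subseteq> (\<Union>N. range (dyadic_floor N))" unfolding P_def by (auto, metis rangeI)
  qed (simp add: countable_range_dyadic_floor)
  have floorP: "dyadic_floor n t \<in> P" if "t \<in> unit_cell" for n and t :: "real ^ 'n"
    using that dyadic_floor_unit_cell dyadic_floor_idem unfolding P_def by blast
  have sp: "space \<kappa> = unit_cell" by (simp add: \<kappa>_def space_restrict_space)
  have floor_sets: "{t \<in> space \<kappa>. dyadic_floor n t = p} \<in> sets \<kappa>" for n p
  proof (cases "p \<in> range (dyadic_floor n)")
    case True
    have "dyadic_floor n \<in> measurable \<kappa> (count_space (range (dyadic_floor n)))"
      unfolding \<kappa>_def by (intro measurable_restrict_space1) (simp add: measurable_dyadic_floor)
    from measurable_sets[OF this, of "{p}"] True show ?thesis by (simp add: vimage_def Int_def conj_commute)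
  next
    case False
    then have e: "{t \<in> space \<kappa>. dyadic_floor n t = p} = {}" by auto
    show ?thesis unfolding e by simp
  qed
  have fin: "finite_measure \<kappa>"
    unfolding \<kappa>_def using emeasure_unit_cell
    by (intro finite_measureI) (simp add: space_restrict_space emeasure_restrict_space less_top)
  interpret cell \<kappa> P dyadic_floor x
  proof (intro cell.intro fin cell_axioms.intro cP)
    have "dyadic_floor 0 (0 :: real ^ 'n) = 0" by (simp add: dyadic_floor_def vec_eq_iff)
    moreover have "(0 :: real ^ 'n) \<in> unit_cell" by (simp add: unit_cell_def)
    ultimately show "0 \<in> P" unfolding P_def by blast
    fix n show "dyadic_floor n \<in> measurable \<kappa> (count_space P)"
    proof (rule measurable_count_space_eq_countable[OF cP, THEN iffD2], intro conjI ballI)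
      show "dyadic_floor n \<in> space \<kappa> \<rightarrow> P" using floorP sp by auto
      show "dyadic_floor n -` {p} \<inter> space \<kappa> \<in> sets \<kappa>" for p
        using floor_sets[of n p] by (simp add: vimage_def Int_def conj_commute)
    qed
  qed
  obtain A \<alpha>0 where A: "0 \<le> A" "0 < \<alpha>0" "\<And>t. norm t \<le> real ?d \<Longrightarrow> var_fn M V t \<le> A * norm t powr \<alpha>0"
    using holder_variance[OF field A1, of "real ?d"] by blast
  \<comment> \<open>the standard deviation of an increment over the distance \<open>2^(-n)\<close> is of order \<open>r^n\<close>\<close>
  define r where "r = 2 powr (- \<alpha>0 / 2)"
  have r: "0 < r" "r < 1" using A(2) powr_less_mono[of "- \<alpha>0 / 2" 0 2] by (simp_all add: r_def)
  have var_floor: "var_fn M V (t - dyadic_floor n t) \<le> (A * real ?d powr \<alpha>0) * (r ^ n)\<^sup>2" for t n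
  proof -
    let ?u = "t - dyadic_floor n t"
    have nu: "norm ?u \<le> real ?d * (1 / 2) ^ n" by (rule norm_diff_dyadic_floor)
    also have "\<dots> \<le> real ?d * 1" by (intro mult_left_mono power_le_one) auto
    finally have "var_fn M V ?u \<le> A * norm ?u powr \<alpha>0" using A(3) by simp
    also have "\<dots> \<le> A * (real ?d * (1 / 2) ^ n) powr \<alpha>0"
      using nu A by (intro mult_left_mono powr_mono2) auto
    also have "\<dots> = A * real ?d powr \<alpha>0 * ((1 / 2) ^ n) powr \<alpha>0" by (simp add: powr_mult)
    also have "((1 / 2 :: real) ^ n) powr \<alpha>0 = (r ^ n)\<^sup>2"
    proof -
      have "(1 / 2 :: real) ^ n = 2 powr (- real n)" using powr_minus_divide[of 2 "real n"] by (simp add: powr_realpow power_divide)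
      then have "((1 / 2 :: real) ^ n) powr \<alpha>0 = 2 powr (- real n * \<alpha>0)" by (simp only: powr_powr)
      moreover have "(r ^ n)\<^sup>2 = r powr real (2 * n)" using r by (simp add: powr_realpow power_mult[symmetric] mult.commute del: of_nat_mult)
      moreover have "\<dots> = 2 powr (- \<alpha>0 / 2 * real (2 * n))" by (simp only: r_def powr_powr)
      ultimately show ?thesis by (simp add: mult.commute)
    qed
    finally show ?thesis .
  qed
  define vm where "vm = A * real ?d powr \<alpha>0"
  define Cst where "Cst = exp (ln (2 ^ ?d) / (1 - r)) * (1 + 2 * 2 ^ ?d * exp (4\<^sup>2 * (A * real ?d powr \<alpha>0) / (2 * (1 - r)\<^sup>2)))"
  have fluct: "(\<integral>\<^sup>+\<omega>. (SUP p\<in>P. ennreal (exp (4 * \<bar>V (k + p) \<omega> - V k \<omega>\<bar>))) \<partial>M) \<le> ennreal Cst" for k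
    unfolding Cst_def
  proof (rule chaining[OF r, where Q = dyadic_net and \<rho> = dyadic_floor])
    fix n
    have "real (card (dyadic_net (Suc n) :: (real ^ 'n) set)) \<le> real ((2 ^ Suc n) ^ ?d)"
      using card_dyadic_net[of "Suc n", where 'n = 'n] by (simp only: of_nat_le_iff)
    also have "\<dots> = 2 ^ ?d * (2 ^ ?d) ^ n" by (simp add: power_mult_distrib power_mult[symmetric] mult.commute)
    finally show "real (card (dyadic_net (Suc n) :: (real ^ 'n) set)) \<le> 2 ^ ?d * (2 ^ ?d) ^ n" .
  next
    fix p assume p: "p \<in> P"
    then have pc: "p \<in> unit_cell" by (simp add: P_def)
    then have "\<lfloor>p $ i\<rfloor> = 0" for i unfolding unit_cell_def by (simp add: floor_eq_iff)
    then show "dyadic_floor 0 p = 0" by (simp add: dyadic_floor_def vec_eq_iff)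
    show "\<exists>N. dyadic_floor N p = p" using p by (simp add: P_def)
    fix n
    show "dyadic_floor (Suc n) p \<in> dyadic_net (Suc n)"
      unfolding dyadic_net_def using dyadic_floor_unit_cell[OF pc] dyadic_floor_idem by blast
    show "dyadic_floor n (dyadic_floor (Suc n) p) = dyadic_floor n p" by (rule dyadic_floor_nested)
  qed (simp_all add: finite_dyadic_net var_floor)
  have cells: "controlled_cells M V \<kappa> P dyadic_floor Cst vm"
  proof (intro controlled_cells.intro controlled_cells_axioms.intro fluct)
    show "0 \<le> Cst" by (simp add: Cst_def add_nonneg_nonneg)
    fix p assume "p \<in> P"
    then have "\<lfloor>p $ i\<rfloor> = 0" for i unfolding P_def unit_cell_def by (simp add: floor_eq_iff)
    then have "p - dyadic_floor 0 p = p" by (simp add: dyadic_floor_def vec_eq_iff)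
    then show "var_fn M V p \<le> vm" using var_floor[of p 0] by (simp add: vm_def)
  qed unfold_locales
  interpret controlled_cells M V \<kappa> P dyadic_floor x Cst vm by (rule cells)
  have contv: "continuous_on UNIV (var_fn M V)" using A1 by (simp add: cond_A1_def)
  have contZ: "continuous_on UNIV (\<lambda>t. Z_field M V t \<omega>)" if "continuous_on UNIV (\<lambda>t. V t \<omega>)" for \<omega>
    unfolding Z_field_def by (intro continuous_intros that contv) simp
  have lim: "limsup (\<lambda>n. ennreal (exp (logZ (k + dyadic_floor n t) \<omega>))) = ennreal (Z_field M V (k + t) \<omega>)"
    if "continuous_on UNIV (\<lambda>t. V t \<omega>)" for \<omega> k t
  proof (rule lim_imp_Limsup[OF trivial_limit_sequentially])
    have "isCont (\<lambda>t. Z_field M V t \<omega>) (k + t)"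
      using contZ[OF that] by (simp add: continuous_on_eq_continuous_at)
    then have "(\<lambda>n. Z_field M V (k + dyadic_floor n t) \<omega>) \<longlonglongrightarrow> Z_field M V (k + t) \<omega>"
      by (rule isCont_tendsto_compose) (intro tendsto_intros dyadic_floor_tendsto)
    then have "(\<lambda>n. ennreal (Z_field M V (k + dyadic_floor n t) \<omega>)) \<longlonglongrightarrow> ennreal (Z_field M V (k + t) \<omega>)"
      by (rule tendsto_ennrealI)
    then show "(\<lambda>n. ennreal (exp (logZ (k + dyadic_floor n t) \<omega>))) \<longlonglongrightarrow> ennreal (Z_field M V (k + t) \<omega>)"
      by (simp add: Z_field_def logZ_def)
  qed
  have ind: "indicator {ennreal s<..} (ennreal (Z_field M V t \<omega>)) = (indicator {s<..} (Z_field M V t \<omega>) :: ennreal)" if "0 \<le> s" for s t \<omega>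
    using that by (simp add: indicator_def ennreal_less_iff)
  have box: "berman_set M (Z_field M V) 0 {t. dyadic_floor 0 t \<in> lattice_box 1 (\<lambda>_. {0..<int n})} x = mean_level (lattice_box 1 (\<lambda>_. {0..<int n}))" for n
  proof (rule berman_set_eq_mean_level)
    let ?K = "lattice_box 1 (\<lambda>_. {0..<int n}) :: (real ^ 'n) set"
    have K: "finite ?K" "?K \<subseteq> range (lattice_point 1)" by (rule finite_lattice_box, simp) (auto simp: lattice_box_def)
    show "AE \<omega> in M. \<forall>s\<ge>0. (\<integral>\<^sup>+t\<in>{t. dyadic_floor 0 t \<in> ?K}. indicator {s<..} (Z_field M V t \<omega>) \<partial>grid_measure 0) = (\<Sum>k\<in>?K. occupation (path \<omega>) k s)"
      using paths
    proof eventually_elim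
      case (elim \<omega>)
      have [measurable]: "(\<lambda>t. Z_field M V t \<omega>) \<in> borel_measurable borel"
        by (rule borel_measurable_continuous_onI[OF contZ[OF elim]])
      show ?case
      proof (intro allI impI)
        fix s :: real assume s: "0 \<le> s"
        have "(\<integral>\<^sup>+t\<in>{t. dyadic_floor 0 t \<in> ?K}. indicator {s<..} (Z_field M V t \<omega>) \<partial>lborel) =
            (\<Sum>k\<in>?K. \<integral>\<^sup>+t. indicator {s<..} (Z_field M V (k + t) \<omega>) \<partial>\<kappa>)"
          unfolding \<kappa>_def by (rule nn_integral_lattice_tiling[OF K]) measurable
        also have "\<dots> = (\<Sum>k\<in>?K. occupation (path \<omega>) k s)"
          unfolding occupation_def cell_val_def lim[OF elim] ind[OF s] ..
        finally show "(\<integral>\<^sup>+t\<in>{t. dyadic_floor 0 t \<in> ?K}. indicator {s<..} (Z_field M V t \<omega>) \<partial>grid_measure 0) = (\<Sum>k\<in>?K. occupation (path \<omega>) k s)"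
          by (simp add: grid_measure_def)
      qed
    qed
  qed
  have event: "{\<omega>\<in>space M. (\<integral>\<^sup>+t\<in>E. indicator {s<..} (Z_field M V t \<omega>) \<partial>grid_measure 0) > ennreal x} \<in> sets (completion M)"
    if [measurable]: "E \<in> sets borel" and s: "0 \<le> s" for E :: "(real ^ 'n) set" and s
  proof -
    have "(\<lambda>z. (\<lambda>p z. logZ p (fst z)) (dyadic_floor n (snd z)) z) \<in> borel_measurable (M \<Otimes>\<^sub>M (lborel :: (real ^ 'n) measure))" for n
    proof (rule measurable_compose_countable'[OF _ _ countable_range_dyadic_floor[of n], where f = "\<lambda>p z. logZ p (fst z)" and g = "\<lambda>z. dyadic_floor n (snd z)"])
      have "snd \<in> measurable (M \<Otimes>\<^sub>M (lborel :: (real ^ 'n) measure)) borel" by measurable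
      then show "(\<lambda>z. dyadic_floor n (snd z)) \<in> measurable (M \<Otimes>\<^sub>M (lborel :: (real ^ 'n) measure)) (count_space (range (dyadic_floor n)))"
        by (rule measurable_compose[OF _ measurable_dyadic_floor])
    qed measurable
    then have [measurable]: "(\<lambda>z. logZ (dyadic_floor n (snd z)) (fst z)) \<in> borel_measurable (M \<Otimes>\<^sub>M (lborel :: (real ^ 'n) measure))" for n by simp
    define W where "W \<omega> = (\<integral>\<^sup>+t. indicator {ennreal s<..} (limsup (\<lambda>n. ennreal (exp (logZ (dyadic_floor n t) \<omega>)))) * indicator E t \<partial>lborel)" for \<omega>
    have "(\<lambda>z. indicator {ennreal s<..} (limsup (\<lambda>n. ennreal (exp (logZ (dyadic_floor n (snd z)) (fst z))))) * indicator E (snd z) :: ennreal)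
        \<in> borel_measurable (M \<Otimes>\<^sub>M (lborel :: (real ^ 'n) measure))" by measurable
    from lborel.borel_measurable_nn_integral_fst[OF this]
    have [measurable]: "W \<in> borel_measurable M" unfolding W_def[abs_def] by simp
    show ?thesis
    proof (rule completion_event_cong(1))
      show "{\<omega>\<in>space M. W \<omega> > ennreal x} \<in> sets M" by measurable
      show "AE \<omega> in M. \<omega> \<in> {\<omega>\<in>space M. (\<integral>\<^sup>+t\<in>E. indicator {s<..} (Z_field M V t \<omega>) \<partial>grid_measure 0) > ennreal x} \<longleftrightarrow> \<omega> \<in> {\<omega>\<in>space M. W \<omega> > ennreal x}"
        using paths
      proof eventually_elim
        case (elim \<omega>)
        have "W \<omega> = (\<integral>\<^sup>+t\<in>E. indicator {s<..} (Z_field M V t \<omega>) \<partial>grid_measure 0)"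
          unfolding W_def using lim[OF elim, of 0] by (simp add: ind[OF s] grid_measure_def)
        then show ?case by simp
      qed
    qed auto
  qed
  have mono: "berman_set M (Z_field M V) 0 E x \<le> berman_set M (Z_field M V) 0 E' x"
    if "E \<subseteq> E'" "E' \<in> sets borel" for E E' :: "(real ^ 'n) set"
    unfolding berman_set_def
  proof (rule nn_integral_mono)
    fix s :: real
    have le: "(\<integral>\<^sup>+t\<in>E. indicator {s<..} (Z_field M V t \<omega>) \<partial>grid_measure 0) \<le> (\<integral>\<^sup>+t\<in>E'. indicator {s<..} (Z_field M V t \<omega>) \<partial>grid_measure 0)" for \<omega>
      using that(1) by (intro nn_integral_mono mult_left_mono) (auto simp: indicator_def)
    show "emeasure (completion M) {\<omega>\<in>space M. (\<integral>\<^sup>+t\<in>E. indicator {s<..} (Z_field M V t \<omega>) \<partial>grid_measure 0) > ennreal x} * indicator {0..} s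
      \<le> emeasure (completion M) {\<omega>\<in>space M. (\<integral>\<^sup>+t\<in>E'. indicator {s<..} (Z_field M V t \<omega>) \<partial>grid_measure 0) > ennreal x} * indicator {0..} s"
    proof (cases "0 \<le> s")
      case True
      show ?thesis using less_le_trans[OF _ le]
        by (intro mult_right_mono emeasure_mono event that(2) True) auto
    qed simp
  qed
  have gu: "grid 0 = (UNIV :: (real ^ 'n) set)" by (simp add: grid_def)
  show ?thesis
  proof (rule berman_rate_of_sandwich[OF cells zero_less_one lam growth])
    fix T :: real assume T: "0 \<le> T"
    define n where "n = nat \<lfloor>T\<rfloor>"
    have n: "real n \<le> T" "T < real (Suc n)" using T unfolding n_def by linarith+
    have sub: "{t. dyadic_floor 0 t \<in> lattice_box 1 (\<lambda>_. {0..<int n})} \<subseteq> (cube T :: (real ^ 'n) set)"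
      "(cube T :: (real ^ 'n) set) \<subseteq> {t. dyadic_floor 0 t \<in> lattice_box 1 (\<lambda>_. {0..<int (Suc n)})}"
      unfolding cube_as_floor cube_def using n by (auto intro: le_less_trans less_imp_le[OF less_le_trans])
    have bor: "{t. dyadic_floor 0 t \<in> lattice_box 1 (\<lambda>_. {0..<int (Suc n)})} \<in> sets (borel :: (real ^ 'n) measure)"
    proof -
      show ?thesis unfolding cube_as_floor by measurable
    qed
    show "mean_level (lattice_box 1 (\<lambda>_. {0..<int (nat \<lfloor>T / 1\<rfloor>)})) \<le> berman_set M (Z_field M V) 0 (cube T \<inter> grid 0) x \<and>
       berman_set M (Z_field M V) 0 (cube T \<inter> grid 0) x \<le> mean_level (lattice_box 1 (\<lambda>_. {0..<int (Suc (nat \<lfloor>T / 1\<rfloor>))}))"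
      unfolding gu Int_UNIV_right div_by_1 n_def[symmetric] box[symmetric]
      using mono[OF sub(1) cube_borel] mono[OF sub(2) bor] by blast
  qed
qed

section \<open>The convergence rate of the Berman constants\<close>

theorem theorem3p2:
  fixes M :: "'a measure" and V :: "real ^ 'n \<Rightarrow> 'a \<Rightarrow> real"
    and \<delta> x lam :: real
  assumes "prob_space M"
    and "centered_gaussian_field M V"
    and "AE \<omega> in M. continuous_on UNIV (\<lambda>t. V t \<omega>)"
    and "stationary_increments M V"
    and "var_fn M V 0 = 0"
    and "cond_A1 (var_fn M V)"
    and "cond_A2 (var_fn M V)"
    and "0 \<le> \<delta>" and "0 \<le> x" and "0 < lam" and "lam < 1"
  shows "((\<lambda>T. \<bar>enn2ereal (berman M (Z_field M V) \<delta> x)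
              - enn2ereal (berman_set M (Z_field M V) \<delta> (cube T \<inter> grid \<delta>) x)
                / ereal (T ^ CARD('n))\<bar>
            * ereal (T powr lam)) \<longlongrightarrow> 0) at_top"
proof -
  have field: "gaussian_field M V"
    using assms(1,2,4,5) by (simp add: gaussian_field_def gaussian_field_axioms_def)
  obtain \<alpha> where \<alpha>: "0 < \<alpha>" "0 < Liminf at_infinity (\<lambda>t. ereal (var_fn M V t / norm t powr \<alpha>))"
    using assms(7) unfolding cond_A2_def by blast
  obtain c R where growth: "0 < c" "\<And>t. R \<le> norm t \<Longrightarrow> c * norm t powr \<alpha> \<le> var_fn M V t"
    using power_growth[OF \<alpha>(2)] by blast
  show ?thesis
  proof (cases "\<delta> = 0")
    case True
    show ?thesis unfolding True
      by (rule berman_rate_continuum[OF field assms(10,11,3,6) growth(1) \<alpha>(1) growth(2)])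
  next
    case False
    then have "0 < \<delta>" using assms(8) by simp
    then show ?thesis by (rule berman_rate_grid[OF field _ assms(10,11) growth(1) \<alpha>(1) growth(2)])
  qed
qed

end
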